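(* Each permutable matchgate signature $F'$ of arity $n$ can be realized, up to a constant factor, by a symmetric matchgate signature $h$ of arity $n$ and $O(n)$ symmetric binary matchgate signatures, in the following way (where $F$ denotes a normalization of $F'$). 1. If $F$ is of Pinning type, then $h=[1,0,\dots,0]$ and $O(n)$ symmetric binary signatures $[0,1,0]$ can realize $F'$ up to a constant factor. 2. If $F$ is of Parity type, then $h=[1,0,1,0,\dots]$ or $h=[0,1,0,1,\dots]$, together with $O(n)$ symmetric binary signatures each of the form $[1,0,y]$ ($y\in\mathbb{C}$) or $[0,0,1]$, can realize $F'$ up to a constant factor. 3. If $F$ is of Matching type, not of Pinning type and not of Parity type, then $h=[0,1,0,0,\dots]$ and $O(n)$ symmetric binary signatures each of the form $[1,0,y]$ ($y\in\mathbb{C}$) or $[0,1,0]$ can realize $F'$ up to a constant factor.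
   Context: A signature of arity $n$ is a function $f:\{0,1\}^n\to\mathbb{C}$. It is symmetric if its value depends only on the Hamming weight of the input, and is then written $[f_0,f_1,\dots,f_n]$, $f_i$ being the value at inputs of Hamming weight $i$. Matchgate signatures: a matchgate is a plane graph $G=(V,E)$ with edge weights $w:E\to\mathbb{C}$ and external nodes $U\subseteq V$ on its outer face labelled $1,\dots,|U|$ in clockwise order. Its signature $f$ has arity $|U|$ and, for $\alpha\in\{0,1\}^{|U|}$, $f(\alpha)=\#\mathrm{PM}(G-X)$, where $X\subseteq U$ consists of the external nodes whose label $i$ satisfies $\alpha_i=1$, and $\#\mathrm{PM}(G)=\sum_{M}\prod_{e\in M}w(e)$, the sum over all perfect matchings $M$ of $G$. A signature is a matchgate signature if it is the signature of some matchgate. A signature $f$ of arity $n$ is a permutable matchgate signature if for every $\pi\in S_n$ the signature $f_\pi$ obtained from $f$ by permuting its variables by $\pi$ is a matchgate signature. Realization: a gadget is a graph with vertex set $V$, normal edges $E$ and dangling edges $D$ (edges with only one endpoint), each vertex $v$ being assigned a signature $f_v$ whose arguments are the edges (normal or dangling) at $v$. It realizes the signature $f$ of arity $|D|$ given by $f(\alpha)=\sum_{\sigma\in\{0,1\}^{E}}\prod_{v\in V}f_v(\alpha\sigma)$ for $\alpha\in\{0,1\}^{D}$. "Realized by $h$ and $O(n)$ binary signatures" means realized by a gadget whose vertices are one vertex assigned $h$ and $O(n)$ vertices assigned binary signatures of the listed kind. Normalization: a signature $f$ is normalized if $f(0\cdots0)=1$. For a matchgate signature $g$ of arity $n$ that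 is not identically $0$ and a string $\beta\in\{0,1\}^n$ with $g(\beta)\ne0$, the signature $f(\alpha)=g(\alpha\oplus\beta)/g(\beta)$ is called a normalization of $g$. The index expression $F$ of a normalized $f$ is $F(b_1\dots b_k)=f(\alpha)$ for distinct $b_1,\dots,b_k\in\{1,\dots,n\}$, where $\alpha_{b_1}=\dots=\alpha_{b_k}=1$ and all other bits of $\alpha$ are $0$. One identifies $f$ with $F$. Types of a normalized permutable matchgate signature $F$ of arity $n$: - Pinning type: $F(ab)=0$ for all distinct $1\le a,b\le n$. - Parity type: there exist distinct $1\le a,b,c\le n$ with $F(ab)F(ac)F(bc)\neq0$. - Matching type: there exist distinct $1\le a,b,c,d\le n$ with $F(bc)=F(bd)=F(cd)=0$ but $F(ab)\ne0$. *)

theory Defs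
  imports "HOL-Analysis.Analysis" "HOL-Combinatorics.Permutations"
begin

section \<open>Signatures\<close>

text \<open>
  A signature of arity \<open>n\<close> is a function on bit strings of length \<open>n\<close>. The arity is carried
  separately; values on lists of any other length are irrelevant. Variables, and hence the
  external nodes and dangling edges below, are numbered from \<open>0\<close> to \<open>n - 1\<close>.
\<close>

type_synonym signature = "bool list \<Rightarrow> complex"

text \<open>\<open>sym_sig [f\<^sub>0, \<dots>, f\<^sub>n]\<close> is the symmetric signature of arity \<open>n\<close> written
  \<open>[f\<^sub>0, \<dots>, f\<^sub>n]\<close>.\<close>

definition sym_sig :: "complex list \<Rightarrow> signature" where
  "sym_sig fs \<alpha> = fs ! count_list \<alpha> True"


section \<open>Matchgates\<close>

text \<open>
  A plane graph consists of a finite set \<open>V\<close> of points of the plane and a finite set \<open>E\<close> of arcs,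
  each identified with the set of its points. Both ends of an arc are vertices, and it meets no
  other vertex and no other edge except at vertices. Thus \<open>e \<inter> V\<close> is the set of endpoints of an
  edge \<open>e\<close>. Parallel edges are allowed.
\<close>

definition plane_graph :: "complex set \<Rightarrow> complex set set \<Rightarrow> bool" where
  "plane_graph V E \<longleftrightarrow>
     finite V \<and> finite E \<and>
     (\<forall>e\<in>E. \<exists>g. arc g \<and> path_image g = e \<and> e \<inter> V = {pathstart g, pathfinish g}) \<and>
     (\<forall>e\<in>E. \<forall>e'\<in>E. e \<noteq> e' \<longrightarrow> e \<inter> e' \<subseteq> V)"

definition outer_face :: "complex set \<Rightarrow> complex set set \<Rightarrow> complex set" where
  "outer_face V E = outside (V \<union> \<Union>E)"

text \<open>
  The vertices \<open>us\<close> lie on the outer face in clockwise order: each of them can be joined to a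
  circle around the drawing by an arc that runs inside the outer face, these arcs are pairwise
  disjoint, and they arrive at the circle in clockwise order, that is, with decreasing argument.
  A vertex is on the boundary of the outer face iff it is accessible by such an arc. The arcs also
  fix the meaning of the order if the boundary of the outer face is not a simple cycle.
\<close>

definition clockwise_on_outer_face ::
    "complex set \<Rightarrow> complex set set \<Rightarrow> complex list \<Rightarrow> bool" where
  "clockwise_on_outer_face V E us \<longleftrightarrow>
     (\<exists>(r::real) (\<theta> :: nat \<Rightarrow> real) (\<gamma> :: nat \<Rightarrow> real \<Rightarrow> complex).
        V \<union> \<Union>E \<subseteq> ball 0 r \<and>
        (\<forall>i j. i < j \<and> j < length us \<longrightarrow> \<theta> j < \<theta> i \<and> \<theta> i < \<theta> j + 2 * pi) \<and>
        (\<forall>i < length us.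
           arc (\<gamma> i) \<and> pathstart (\<gamma> i) = us ! i \<and> pathfinish (\<gamma> i) = rcis r (\<theta> i) \<and>
           path_image (\<gamma> i) - {us ! i} \<subseteq> outer_face V E \<and>
           path_image (\<gamma> i) - {rcis r (\<theta> i)} \<subseteq> ball 0 r) \<and>
        (\<forall>i < length us. \<forall>j < length us.
           i \<noteq> j \<longrightarrow> path_image (\<gamma> i) \<inter> path_image (\<gamma> j) = {}))"

definition matchgate :: "complex set \<Rightarrow> complex set set \<Rightarrow> complex list \<Rightarrow> bool" where
  "matchgate V E us \<longleftrightarrow>
     plane_graph V E \<and> distinct us \<and> set us \<subseteq> V \<and> clockwise_on_outer_face V E us"

definition perfect_matching :: "complex set \<Rightarrow> complex set set \<Rightarrow> complex set set \<Rightarrow> bool" where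
  "perfect_matching V E M \<longleftrightarrow> M \<subseteq> E \<and> (\<forall>v\<in>V. \<exists>!e. e \<in> M \<and> v \<in> e)"

definition num_PM :: "complex set \<Rightarrow> complex set set \<Rightarrow> (complex set \<Rightarrow> complex) \<Rightarrow> complex" where
  "num_PM V E w = (\<Sum>M | perfect_matching V E M. \<Prod>e\<in>M. w e)"

definition matchgate_value ::
    "complex set \<Rightarrow> complex set set \<Rightarrow> (complex set \<Rightarrow> complex) \<Rightarrow> complex list \<Rightarrow> signature" where
  "matchgate_value V E w us \<alpha> =
     (let X = {us ! i | i. i < length us \<and> \<alpha> ! i}
      in num_PM (V - X) {e \<in> E. e \<inter> X = {}} w)"

definition matchgate_signature :: "nat \<Rightarrow> signature \<Rightarrow> bool" where
  "matchgate_signature n f \<longleftrightarrow>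
     (\<exists>V E w us. matchgate V E us \<and> length us = n \<and>
        (\<forall>\<alpha>. length \<alpha> = n \<longrightarrow> f \<alpha> = matchgate_value V E w us \<alpha>))"

definition permutable_matchgate_signature :: "nat \<Rightarrow> signature \<Rightarrow> bool" where
  "permutable_matchgate_signature n f \<longleftrightarrow>
     (\<forall>\<pi>. \<pi> permutes {..<n} \<longrightarrow> matchgate_signature n (\<lambda>\<alpha>. f (permute_list \<pi> \<alpha>)))"


section \<open>Gadgets\<close>

text \<open>
  The dangling edges of a gadget of arity \<open>n\<close> are \<open>Dangling 0, \<dots>, Dangling (n - 1)\<close>, in the order
  of the arguments of the realized signature; the normal edges are \<open>Normal e\<close> with \<open>e \<in> E\<close>.
  \<open>inc v\<close> lists the edges at \<open>v\<close> in the order in which they are arguments of the signature of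
  \<open>v\<close>. There are no loops.
\<close>

datatype gadget_edge = Dangling nat | Normal nat

definition gadget :: "nat \<Rightarrow> nat set \<Rightarrow> nat set \<Rightarrow> (nat \<Rightarrow> gadget_edge list) \<Rightarrow> bool" where
  "gadget n V E inc \<longleftrightarrow>
     finite V \<and> finite E \<and>
     (\<forall>v\<in>V. distinct (inc v) \<and> set (inc v) \<subseteq> Dangling ` {..<n} \<union> Normal ` E) \<and>
     (\<forall>e\<in>E. card {v \<in> V. Normal e \<in> set (inc v)} = 2) \<and>
     (\<forall>i<n. card {v \<in> V. Dangling i \<in> set (inc v)} = 1)"

definition gadget_value ::
    "nat set \<Rightarrow> nat set \<Rightarrow> (nat \<Rightarrow> gadget_edge list) \<Rightarrow> (nat \<Rightarrow> signature) \<Rightarrow> signature" where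
  "gadget_value V E inc fs \<alpha> =
     (\<Sum>\<sigma> \<in> E \<rightarrow>\<^sub>E (UNIV :: bool set).
        \<Prod>v\<in>V. fs v (map (case_gadget_edge (\<lambda>i. \<alpha> ! i) \<sigma>) (inc v)))"

text \<open>
  Up to a nonzero constant factor, the signature \<open>f\<close> of arity \<open>n\<close> is realized by a gadget with one
  vertex assigned the symmetric signature \<open>h\<close> and at most \<open>k\<close> further vertices, each assigned a
  symmetric binary signature from \<open>B\<close>.
\<close>

definition realized_up_to_const ::
    "nat \<Rightarrow> signature \<Rightarrow> complex list \<Rightarrow> complex list set \<Rightarrow> nat \<Rightarrow> bool" where
  "realized_up_to_const n f h B k \<longleftrightarrow>
     (\<exists>V E inc fs v\<^sub>0 c.
        gadget n V E inc \<and> v\<^sub>0 \<in> V \<and> card (V - {v\<^sub>0}) \<le> k \<and>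
        Suc (length (inc v\<^sub>0)) = length h \<and> fs v\<^sub>0 = sym_sig h \<and>
        (\<forall>v \<in> V - {v\<^sub>0}. length (inc v) = 2 \<and> (\<exists>b\<in>B. length b = 3 \<and> fs v = sym_sig b)) \<and>
        c \<noteq> 0 \<and>
        (\<forall>\<alpha>. length \<alpha> = n \<longrightarrow> f \<alpha> = c * gadget_value V E inc fs \<alpha>))"

definition binary_matchgates :: "complex list set" where
  "binary_matchgates = {b. length b = 3 \<and> matchgate_signature 2 (sym_sig b)}"


section \<open>Normalization and types\<close>

definition normalization :: "nat \<Rightarrow> signature \<Rightarrow> signature \<Rightarrow> bool" where
  "normalization n g f \<longleftrightarrow>
     (\<exists>\<beta>. length \<beta> = n \<and> g \<beta> \<noteq> 0 \<and>
        (\<forall>\<alpha>. length \<alpha> = n \<longrightarrow> f \<alpha> = g (map2 (\<noteq>) \<alpha> \<beta>) / g \<beta>))"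

definition index_expr :: "nat \<Rightarrow> signature \<Rightarrow> nat list \<Rightarrow> complex" where
  "index_expr n f bs = f (map (\<lambda>i. i \<in> set bs) [0..<n])"

definition pinning_type :: "nat \<Rightarrow> signature \<Rightarrow> bool" where
  "pinning_type n f \<longleftrightarrow> (\<forall>a<n. \<forall>b<n. a \<noteq> b \<longrightarrow> index_expr n f [a, b] = 0)"

definition parity_type :: "nat \<Rightarrow> signature \<Rightarrow> bool" where
  "parity_type n f \<longleftrightarrow>
     (\<exists>a<n. \<exists>b<n. \<exists>c<n. distinct [a, b, c] \<and>
        index_expr n f [a, b] * index_expr n f [a, c] * index_expr n f [b, c] \<noteq> 0)"

definition matching_type :: "nat \<Rightarrow> signature \<Rightarrow> bool" where
  "matching_type n f \<longleftrightarrow>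
     (\<exists>a<n. \<exists>b<n. \<exists>c<n. \<exists>d<n. distinct [a, b, c, d] \<and>
        index_expr n f [b, c] = 0 \<and> index_expr n f [b, d] = 0 \<and> index_expr n f [c, d] = 0 \<and>
        index_expr n f [a, b] \<noteq> 0)"


section \<open>The symmetric signatures of arity \<open>n\<close> in the realizations\<close>

definition pin_sig :: "nat \<Rightarrow> complex list" where
  "pin_sig n = map (\<lambda>i. if i = 0 then 1 else 0) [0..<Suc n]"

definition even_sig :: "nat \<Rightarrow> complex list" where
  "even_sig n = map (\<lambda>i. if even i then 1 else 0) [0..<Suc n]"

definition odd_sig :: "nat \<Rightarrow> complex list" where
  "odd_sig n = map (\<lambda>i. if odd i then 1 else 0) [0..<Suc n]"

definition one_sig :: "nat \<Rightarrow> complex list" where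
  "one_sig n = map (\<lambda>i. if i = 1 then 1 else 0) [0..<Suc n]"

end

theory Submission
  imports Defs
begin

text \<open>
  A bit string is identified with the set of positions of its ones, so that a signature of arity
  \<open>n\<close> becomes a function \<open>g\<close> on the subsets of \<open>{..<n}\<close>, and flipping bits becomes forming a symmetric
  difference.

  The heart of the proof is that signatures of matchgates satisfy the matchgate identities
  \<open>(\<Sum>i \<in> A \<triangle> B. (-1) ^ r i * g (A \<triangle> {i}) * g (B \<triangle> {i})) = 0\<close>,
  where \<open>\<triangle>\<close> is the symmetric difference and \<open>r i\<close> the number of elements of \<open>A \<triangle> B\<close> below \<open>i\<close>
  (\<open>matchgate_identities_matchgate_signature\<close>). A summand counts pairs of matchings. The
  superposition of such a pair consists of cycles, isolated vertices and paths, and the ends of the paths are the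
  external nodes with label in \<open>A \<triangle> B\<close>. Exchanging the two matchings along the path that starts
  at node \<open>i\<close> turns a pair counted by the summand of \<open>i\<close> into a pair counted by the summand of
  the other end \<open>j\<close>, with the same weight. In the plane the paths cannot cross, so the nodes
  strictly between \<open>i\<close> and \<open>j\<close> are paired among themselves, \<open>r i\<close> and \<open>r j\<close> have different
  parity, and everything cancels. That the paths cannot cross is a statement about two chords of a
  disc (\<open>crossing_chords_meet\<close>).

  If \<open>g\<close> is permutable, the identities hold for every order of the variables, and so do those of
  a normalization \<open>G\<close>, with \<open>G {} = 1\<close>. The identities for one order express \<open>G\<close> by its values on
  pairs. Comparing the orders of four variables gives
  \<open>G {a, b} * G {c, d} = G {a, c} * G {b, d}\<close> (\<open>pair_products_eq\<close>). Therefore the graph of the pairs with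
  nonzero value has no edge, or contains a triangle, or is a star.

  \<^item> No edge: \<open>G\<close> vanishes except at the empty set.
  \<^item> A triangle: the pair values have the form \<open>G {a, b} = y a * y b\<close>, and \<open>G S\<close> is the product of
    the \<open>y i\<close> over \<open>S\<close> if \<open>S\<close> has even size and \<open>0\<close> otherwise.
  \<^item> A star with centre \<open>a\<close>: \<open>G\<close> vanishes except at the empty set and at the pairs \<open>{a, b}\<close>.

  Hence \<open>F'\<close> is, up to a constant, a symmetric signature with at most two binary signatures inserted into each of
  its dangling edges: \<open>[1, 0, y]\<close> multiplies by a factor that depends on one bit, and \<open>[0, 1, 0]\<close>
  flips a bit. Finally, straight-line drawings show that the symmetric signatures and the binary ones are
  signatures of matchgates.
\<close>


section \<open>Involutions on finite sets\<close>

lemma sum_sign_reversing_involution: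
  fixes g :: "'a \<Rightarrow> complex"
  assumes "\<And>t. t \<in> T \<Longrightarrow> \<phi> t \<in> T" "\<And>t. t \<in> T \<Longrightarrow> \<phi> (\<phi> t) = t" "\<And>t. t \<in> T \<Longrightarrow> g (\<phi> t) = - g t"
  shows "sum g T = 0"
proof -
  have "sum g T = sum (\<lambda>t. - g t) T"
    by (rule sum.reindex_bij_witness[of T \<phi> \<phi>]) (use assms in auto)
  then show ?thesis by (simp add: sum_negf)
qed

lemma even_card_involution:
  assumes "finite A" "\<And>x. x \<in> A \<Longrightarrow> \<tau> x \<in> A" "\<And>x. x \<in> A \<Longrightarrow> \<tau> (\<tau> x) = x" "\<And>x. x \<in> A \<Longrightarrow> \<tau> x \<noteq> x"
  shows "even (card A)"
  using assms
proof (induction "card A" arbitrary: A rule: less_induct)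
  case less
  show ?case
  proof (cases "A = {}")
    case False
    then obtain x where x: "x \<in> A" by blast
    let ?B = "A - {x, \<tau> x}"
    have card: "card ?B = card A - 2" "card A \<ge> 2"
      using less.prems(1,2) less.prems(4)[OF x, symmetric] x card_mono[of A "{x, \<tau> x}"] by (auto simp: card_Diff_subset)
    have "even (card ?B)"
    proof (rule less.hyps)
      show "card ?B < card A" using card by simp
      show "\<tau> y \<in> ?B" if "y \<in> ?B" for y
        using that less.prems(2,3) x by (metis DiffE DiffI insert_iff singletonD)
    qed (use less.prems in auto)
    with card show ?thesis by auto
  qed simp
qed

text \<open>
  \<open>C\<close> is the orbit of \<open>p\<close> under \<open>a\<close> and \<open>b\<close>: it is closed, and no smaller nonempty set is. It is a path from \<open>p\<close> to
  \<open>q\<close> along which \<open>a\<close> and \<open>b\<close> alternate. Only the ends of this path are fixed by one of them.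
\<close>

definition orbit_between ::
    "'a set \<Rightarrow> ('a \<Rightarrow> 'a) \<Rightarrow> ('a \<Rightarrow> 'a) \<Rightarrow> 'a \<Rightarrow> 'a set \<Rightarrow> 'a \<Rightarrow> bool" where
  "orbit_between V a b p C q \<longleftrightarrow>
    C \<subseteq> V \<and> p \<in> C \<and> q \<in> C \<and> q \<noteq> p \<and> a ` C \<subseteq> C \<and> b ` C \<subseteq> C \<and>
    (\<forall>T. T \<subseteq> C \<and> T \<noteq> {} \<and> a ` T \<subseteq> T \<and> b ` T \<subseteq> T \<longrightarrow> T = C) \<and>
    (\<forall>v\<in>C. a v = v \<or> b v = v \<longrightarrow> v = p \<or> v = q) \<and> (a q = q) \<noteq> (b q = q)"

text \<open>
  Induction along the path: after removing \<open>p\<close>, its neighbour \<open>a p\<close> becomes a fixed point of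
  the restriction of \<open>a\<close>, and the roles of \<open>a\<close> and \<open>b\<close> are exchanged.
\<close>

lemma two_involutions_orbit:
  assumes "finite V" "\<And>v. v \<in> V \<Longrightarrow> a v \<in> V \<and> a (a v) = v" "\<And>v. v \<in> V \<Longrightarrow> b v \<in> V \<and> b (b v) = v"
    and "p \<in> V" "b p = p" "a p \<noteq> p"
  shows "\<exists>C q. orbit_between V a b p C q"
  using assms
proof (induction "card V" arbitrary: V a b p rule: less_induct)
  case less
  define p' where "p' = a p"
  have p': "p' \<in> V" "p' \<noteq> p" "a p' = p" using less.prems by (auto simp: p'_def)
  show ?case
  proof (cases "b p' = p'")
    case True
    have min: "T = {p, p'}" if T: "T \<subseteq> {p, p'}" "T \<noteq> {}" "a ` T \<subseteq> T" for T
    proof -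
      have "p \<in> T \<Longrightarrow> p' \<in> T" "p' \<in> T \<Longrightarrow> p \<in> T" using T(3) p' p'_def by auto
      with T(1,2) show ?thesis by blast
    qed
    show ?thesis
      by (rule exI[of _ "{p, p'}"], rule exI[of _ p'])
        (use True p' less.prems p'_def min in \<open>auto simp: orbit_between_def\<close>)
  next
    case False
    define W where "W = V - {p}"
    define a' where "a' = a(p' := p')"
    have cW: "card W < card V" unfolding W_def by (meson less.prems(1,4) card_Diff1_less)
    have "\<exists>C q. orbit_between W b a' p' C q"
    proof (rule less.hyps[OF cW])
      show "finite W" using less.prems by (simp add: W_def)
      show "a' v \<in> W \<and> a' (a' v) = v" if "v \<in> W" for v
        using that less.prems(2)[of v] p' p'_def by (auto simp: W_def a'_def)
      show "b v \<in> W \<and> b (b v) = v" if "v \<in> W" for v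
        using that less.prems(3)[of v] less.prems(5) by (auto simp: W_def)
      show "p' \<in> W" using p' by (simp add: W_def)
      show "a' p' = p'" by (simp add: a'_def)
      show "b p' \<noteq> p'" by (rule False)
    qed
    then obtain C q where oc: "orbit_between W b a' p' C q" by blast
    then have C: "C \<subseteq> W" "p' \<in> C" "q \<in> C" "q \<noteq> p'" "b ` C \<subseteq> C" "a' ` C \<subseteq> C"
      and min: "\<And>T. T \<subseteq> C \<Longrightarrow> T \<noteq> {} \<Longrightarrow> b ` T \<subseteq> T \<Longrightarrow> a' ` T \<subseteq> T \<Longrightarrow> T = C"
      and fixed: "\<And>v. v \<in> C \<Longrightarrow> b v = v \<or> a' v = v \<Longrightarrow> v = p' \<or> v = q"
      and q: "(b q = q) \<noteq> (a' q = q)"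
      unfolding orbit_between_def by blast+
    have pO: "p \<notin> C" using C(1) by (auto simp: W_def)
    have a_a': "a v = a' v" if "v \<noteq> p'" for v using that by (simp add: a'_def)
    show ?thesis unfolding orbit_between_def
    proof (intro exI conjI allI impI ballI)
      show "insert p C \<subseteq> V" using C(1) less.prems(4) by (auto simp: W_def)
      show "p \<in> insert p C" "q \<in> insert p C" "q \<noteq> p" using C(3) pO by auto
      show "a ` insert p C \<subseteq> insert p C"
        using C(2,6) p' unfolding a'_def by (auto simp: p'_def split: if_splits)
      show "b ` insert p C \<subseteq> insert p C" using C(5) less.prems(5) by auto
      show "(a q = q) \<noteq> (b q = q)" using q a_a'[OF C(4)] by auto
      show "v = p \<or> v = q" if "v \<in> insert p C" "a v = v \<or> b v = v" for v
        using that fixed[of v] a_a'[of v] p' False by (cases "v = p'") auto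
      fix T assume T: "T \<subseteq> insert p C \<and> T \<noteq> {} \<and> a ` T \<subseteq> T \<and> b ` T \<subseteq> T"
      have Tp: "p \<in> T \<Longrightarrow> p' \<in> T" using T by (auto simp: p'_def)
      \<comment> \<open>Remove \<open>p\<close> from \<open>T\<close> to apply the minimality of the orbit without \<open>p\<close>.\<close>
    have "T - {p} = C"
      proof (rule min)
        show "T - {p} \<subseteq> C" using T by auto
        show "T - {p} \<noteq> {}" using T Tp p'(2) by blast
        show "b ` (T - {p}) \<subseteq> T - {p}"
        proof (intro image_subsetI)
          fix v assume v: "v \<in> T - {p}"
          then have "b v \<in> C" "b v \<in> T" using T C(5) by auto
          then show "b v \<in> T - {p}" using pO by blast
        qed
        show "a' ` (T - {p}) \<subseteq> T - {p}"
        proof (intro image_subsetI)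
          fix v assume v: "v \<in> T - {p}"
          then have "a' v \<in> C" "a' v \<in> T" using T C(6) by (auto simp: a'_def)
          then show "a' v \<in> T - {p}" using pO by blast
        qed
      qed
      moreover from this have "p \<in> T" using C(2) T p'(3) by (metis DiffD1 image_subset_iff)
      ultimately show "T = insert p C" by blast
    qed
  qed
qed

section \<open>Chords of a disc\<close>

text \<open>
  The Cayley transform maps the disc of radius \<open>norm w\<close> to the upper half plane, its boundary
  circle to the real axis, and \<open>w\<close> to infinity.
\<close>

definition cayley :: "complex \<Rightarrow> complex \<Rightarrow> complex" where
  "cayley w z = \<i> * (w + z) / (w - z)"

lemma Im_cayley: "w \<noteq> z \<Longrightarrow> Im (cayley w z) = ((norm w)\<^sup>2 - (norm z)\<^sup>2) / (norm (w - z))\<^sup>2"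
proof -
  assume "w \<noteq> z"
  have "cayley w z = \<i> * ((w + z) * cnj (w - z)) / (norm (w - z))\<^sup>2"
    unfolding cayley_def using complex_div_cnj[of "\<i> * (w + z)" "w - z"] by (simp add: mult.assoc)
  then have "Im (cayley w z) = Re ((w + z) * cnj (w - z)) / (norm (w - z))\<^sup>2"
    by (metis Im_divide_of_real Im_i_times)
  also have "Re ((w + z) * cnj (w - z)) = (norm w)\<^sup>2 - (norm z)\<^sup>2"
    by (simp only: cmod_power2) (simp add: algebra_simps power2_eq_square)
  finally show ?thesis .
qed

lemma cayley_rcis:
  assumes "r > 0" "sin ((t - \<phi>) / 2) \<noteq> 0"
  shows "cayley (rcis r \<phi>) (rcis r t) = of_real (- cot ((t - \<phi>) / 2))"
proof -
  define d where "d = (t - \<phi>) / 2"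
  define m where "m = (t + \<phi>) / 2"
  have t: "t = m + d" and ph: "\<phi> = m - d" by (auto simp: d_def m_def field_simps)
  have A: "rcis r \<phi> + rcis r t = rcis r m * (2 * cos d)"
    by (auto simp: t ph complex_eq_iff cos_add cos_diff sin_add sin_diff algebra_simps)
  have B: "rcis r \<phi> - rcis r t = rcis r m * (- 2 * \<i> * sin d)"
    by (auto simp: t ph complex_eq_iff cos_add cos_diff sin_add sin_diff algebra_simps)
  have "rcis r m \<noteq> 0" using assms by simp
  moreover have "sin d \<noteq> 0" using assms by (simp add: d_def)
  ultimately have "cayley (rcis r \<phi>) (rcis r t) = - (cos d / sin d)"
    unfolding cayley_def A B by (simp add: field_simps)
  then show ?thesis by (simp add: cot_def d_def)
qed

lemma minus_cot_strict_mono: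
  assumes "-pi < y" "y < x" "x < (0::real)"
  shows "- cot y < - cot x"
proof -
  have s: "sin x < 0" "sin y < 0" using assms
    by (metis add.inverse_inverse add_less_cancel_right minus_less_iff neg_0_less_iff_less neg_less_0_iff_less order.strict_trans sin_gt_zero sin_minus)+
  have "sin (x - y) > 0" using assms by (intro sin_gt_zero) auto
  then have "sin (x - y) / (sin x * sin y) > 0" using s by (simp add: zero_less_mult_iff)
  also have "sin (x - y) / (sin x * sin y) = cot y - cot x"
    using s by (simp add: cot_def sin_diff field_simps)
  finally show ?thesis by simp
qed

text \<open>
  The Cayley transform turns the chords into paths in the upper half plane whose four ends
  interlace on the real axis. Such paths meet by the Fashoda meet theorem.
\<close>

lemma crossing_chords_meet:
  assumes r: "r > 0" and \<theta>: "\<theta>4 < \<theta>3" "\<theta>3 < \<theta>2" "\<theta>2 < \<theta>1" "\<theta>1 < \<theta>4 + 2 * pi"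
    and f: "path f" "pathstart f = rcis r \<theta>1" "pathfinish f = rcis r \<theta>3"
    and g: "path g" "pathstart g = rcis r \<theta>2" "pathfinish g = rcis r \<theta>4"
    and fi: "path_image f \<subseteq> ball 0 r \<union> {rcis r \<theta>1, rcis r \<theta>3}"
    and gi: "path_image g \<subseteq> ball 0 r \<union> {rcis r \<theta>2, rcis r \<theta>4}"
  shows "path_image f \<inter> path_image g \<noteq> {}"
proof -
  \<comment> \<open>The pole \<open>w\<close> lies on the circle in the gap between the last and the first of the four ends.\<close>
  define \<phi> where "\<phi> = (\<theta>1 + \<theta>4 + 2 * pi) / 2"
  define w where "w = rcis r \<phi>"
  have rng: "\<phi> - 2 * pi < t \<and> t < \<phi>" if "t \<in> {\<theta>1, \<theta>2, \<theta>3, \<theta>4}" for t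
    using that \<theta> by (auto simp: \<phi>_def field_simps)
  have sn: "sin ((t - \<phi>) / 2) \<noteq> 0" if "t \<in> {\<theta>1, \<theta>2, \<theta>3, \<theta>4}" for t
  proof -
    have "sin (- ((t - \<phi>) / 2)) > 0" using rng[OF that] by (intro sin_gt_zero) (auto simp: field_simps)
    then show ?thesis by simp
  qed
  have cy: "cayley w (rcis r t) = of_real (- cot ((t - \<phi>) / 2))" if "t \<in> {\<theta>1, \<theta>2, \<theta>3, \<theta>4}" for t
    unfolding w_def using r sn[OF that] by (rule cayley_rcis)
  have wn: "w \<noteq> rcis r t" if "t \<in> {\<theta>1, \<theta>2, \<theta>3, \<theta>4}" for t
  proof
    assume "w = rcis r t"
    then have "cis \<phi> = cis t" using r by (simp add: w_def rcis_def)
    then have "cis (t - \<phi>) = 1" by (metis cis_divide cis_neq_zero divide_self)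
    moreover have "2 * ((t - \<phi>)/2) = t - \<phi>" by simp
    ultimately have "cos (2 * ((t - \<phi>)/2)) = 1" by (metis cis.sel(1) one_complex.sel(1))
    then have "sin ((t - \<phi>)/2) ^ 2 = 0" unfolding cos_double_sin by simp
    then show False using sn[OF that] by simp
  qed
  have normw: "norm w = r" using r by (simp add: w_def)
  define K where "K = path_image f \<union> path_image g"
  have K: "norm z \<le> r" "w \<noteq> z" if "z \<in> K" for z
  proof -
    have z: "z \<in> ball 0 r \<or> z \<in> {rcis r \<theta>1, rcis r \<theta>2, rcis r \<theta>3, rcis r \<theta>4}" using that fi gi by (auto simp: K_def)
    then show "norm z \<le> r" using r by auto
    show "w \<noteq> z" using z wn normw by auto
  qed
  define c where "c = (\<lambda>z. vector [Re (cayley w z), Im (cayley w z)] :: real^2)"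
  have cont: "continuous_on K c"
  proof -
    have "continuous_on K (cayley w)" unfolding cayley_def by (intro continuous_intros) (use K in auto)
    then have "continuous_on K (\<lambda>z. (\<chi> i. if i = 1 then Re (cayley w z) else Im (cayley w z)) :: real^2)"
      by (intro continuous_on_vec_lambda, rename_tac i, case_tac "i = 1") (auto intro!: continuous_intros)
    moreover have "c = (\<lambda>z. \<chi> i. if i = 1 then Re (cayley w z) else Im (cayley w z))"
      unfolding c_def by (auto simp: fun_eq_iff vec_eq_iff forall_2)
    ultimately show ?thesis by simp
  qed
  have inj: "inj_on c K"
  proof
    fix x y assume xy: "x \<in> K" "y \<in> K" "c x = c y"
    then have "c x $ 1 = c y $ 1" "c x $ 2 = c y $ 2" by auto
    then have "cayley w x = cayley w y" by (simp add: c_def complex_eq_iff)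
    then have "(w + x) * (w - y) = (w + y) * (w - x)"
      using K(2)[OF xy(1)] K(2)[OF xy(2)] by (simp add: cayley_def field_simps)
    then have "2 * w * (x - y) = 0" by (simp add: algebra_simps)
    then show "x = y" using normw r by auto
  qed
  have im: "c z $ 2 \<ge> 0" if "z \<in> K" for z
    using K[OF that] normw r by (auto simp: c_def Im_cayley intro!: divide_nonneg_nonneg)
  have comp: "compact (c ` K)" unfolding K_def[symmetric]
    by (rule compact_continuous_image[OF cont]) (simp add: K_def compact_Un compact_path_image f(1) g(1))
  obtain a b where ab: "c ` K \<subseteq> cbox a b" using bounded_subset_cbox_symmetric[OF compact_imp_bounded[OF comp]] by blast
  \<comment> \<open>Move the bottom of the box to the real axis, where the ends of the paths are.\<close>
  define a' where "a' = (vector [a$1, 0] :: real^2)"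
  have ab': "c ` K \<subseteq> cbox a' b" 
  proof (intro image_subsetI)
    fix z assume z: "z \<in> K"
    then have "c z \<in> cbox a b" using ab by blast
    then show "c z \<in> cbox a' b" using im[OF z] by (auto simp: mem_box_cart forall_2 a'_def)
  qed
  have val: "c (rcis r t) $ 1 = - cot ((t - \<phi>) / 2)" "c (rcis r t) $ 2 = 0" if "t \<in> {\<theta>1, \<theta>2, \<theta>3, \<theta>4}" for t
    using cy[OF that] by (simp_all add: c_def)
  have ord: "c (rcis r s) $ 1 < c (rcis r t) $ 1" if "s < t" "s \<in> {\<theta>1, \<theta>2, \<theta>3, \<theta>4}" "t \<in> {\<theta>1, \<theta>2, \<theta>3, \<theta>4}" for s t
    unfolding val(1)[OF that(2)] val(1)[OF that(3)]
    by (rule minus_cot_strict_mono) (use that(1) rng[OF that(2)] rng[OF that(3)] in auto)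
  have pf: "path (c \<circ> f)" "path (c \<circ> g)"
    by (auto intro!: path_continuous_image f(1) g(1) continuous_on_subset[OF cont] simp: K_def)
  have subf: "path_image (c \<circ> f) \<subseteq> cbox a' b" and subg: "path_image (c \<circ> g) \<subseteq> cbox a' b"
    using ab' by (auto simp: path_image_compose K_def)
  \<comment> \<open>On the real axis the order of the ends is \<open>\<theta>4 < \<theta>3 < \<theta>2 < \<theta>1\<close>, hence both paths are reversed.\<close>
  have "\<exists>z. z \<in> path_image (reversepath (c \<circ> g)) \<and> z \<in> path_image (reversepath (c \<circ> f))"
  proof (rule fashoda_interlace[of "reversepath (c \<circ> g)" "reversepath (c \<circ> f)" a' b])
  qed (use pf subf subg val ord \<theta> f g in \<open>auto simp: pathstart_compose pathfinish_compose a'_def\<close>)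
  then obtain x y where "x \<in> path_image f" "y \<in> path_image g" "c x = c y"
    by (auto simp: path_image_compose)
  then have "x = y" using inj by (auto simp: K_def inj_on_def)
  then show ?thesis using \<open>x \<in> path_image f\<close> \<open>y \<in> path_image g\<close> by blast
qed

section \<open>Superposition of two matchings\<close>

definition edge_closed :: "complex set \<Rightarrow> complex set set \<Rightarrow> complex set \<Rightarrow> bool" where
  "edge_closed V N C \<longleftrightarrow> (\<forall>e\<in>N. e \<inter> V \<inter> C \<noteq> {} \<longrightarrow> e \<inter> V \<subseteq> C)"

text \<open>
  The vertex set of the connected component of \<open>p\<close>. As the least closed set it depends only on
  the edges, is handled without walks, and yields statements about all reachable vertices by
  exhibiting a closed set.
\<close>

definition component :: "complex set \<Rightarrow> complex set set \<Rightarrow> complex \<Rightarrow> complex set" where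
  "component V N p = \<Inter>{C. p \<in> C \<and> edge_closed V N C}"

lemma component_self [simp]: "p \<in> component V N p"
  by (simp add: component_def)

lemma edge_closed_component: "edge_closed V N (component V N p)"
  unfolding component_def edge_closed_def by blast

lemma component_least: "edge_closed V N C \<Longrightarrow> p \<in> C \<Longrightarrow> component V N p \<subseteq> C"
  unfolding component_def by blast

lemma component_subset: "p \<in> V \<Longrightarrow> component V N p \<subseteq> V"
  by (rule component_least) (auto simp: edge_closed_def)

lemma edge_closed_Compl: "edge_closed V N C \<Longrightarrow> edge_closed V N (- C)"
  unfolding edge_closed_def by blast

lemma component_disjoint: "q \<notin> component V N p \<Longrightarrow> component V N p \<inter> component V N q = {}"
  using component_least[OF edge_closed_Compl[OF edge_closed_component], of q V N p] by auto

lemma component_eq: "q \<in> component V N p \<Longrightarrow> component V N q = component V N p"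
proof -
  assume q: "q \<in> component V N p"
  have "p \<in> component V N q"
    using component_disjoint[of p V N q] q component_self[of q V N] by (metis component_self disjoint_iff)
  with q show ?thesis
    by (meson component_least edge_closed_component subset_antisym)
qed

text \<open>
  A matching of the whole graph that misses exactly the vertices in \<open>X\<close>. Compared to a perfect
  matching of the graph without \<open>X\<close>, this keeps \<open>V\<close> and \<open>E\<close> the same for all \<open>X\<close>, so that matchings for
  different \<open>X\<close> can be superposed.
\<close>

definition matching_missing ::
    "complex set \<Rightarrow> complex set set \<Rightarrow> complex set \<Rightarrow> complex set set \<Rightarrow> bool" where
  "matching_missing V E X M \<longleftrightarrow>
    M \<subseteq> E \<and> (\<forall>v\<in>V \<inter> X. \<forall>e\<in>M. v \<notin> e) \<and> (\<forall>v\<in>V - X. \<exists>!e. e \<in> M \<and> v \<in> e)"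

lemma matching_missingD:
  assumes "matching_missing V E X M"
  shows "M \<subseteq> E" and "v \<in> V \<Longrightarrow> v \<in> X \<Longrightarrow> e \<in> M \<Longrightarrow> v \<notin> e"
    and "v \<in> V \<Longrightarrow> v \<notin> X \<Longrightarrow> \<exists>!e. e \<in> M \<and> v \<in> e"
  using assms unfolding matching_missing_def by blast+

lemma perfect_matching_delete_iff:
  assumes "X \<subseteq> V"
  shows "perfect_matching (V - X) {e \<in> E. e \<inter> X = {}} M \<longleftrightarrow> matching_missing V E X M"
  using assms unfolding perfect_matching_def matching_missing_def by blast

lemma edge_ends:
  assumes "plane_graph V E" "e \<in> E"
  obtains u v where "u \<noteq> v" "e \<inter> V = {u, v}"
  using assms unfolding plane_graph_def by (metis arc_distinct_ends)

lemma edge_other_end: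
  assumes "plane_graph V E" "e \<in> E" "v \<in> e" "v \<in> V"
  obtains u where "u \<noteq> v" "e \<inter> V = {u, v}"
proof -
  obtain x y where "x \<noteq> y" "e \<inter> V = {x, y}" using edge_ends[OF assms(1,2)] .
  moreover from this assms(3,4) have "v = x \<or> v = y" by blast
  ultimately show ?thesis using that[of x] that[of y] by (metis insert_commute)
qed

text \<open>
  Missed vertices are their own mates. This makes \<open>mate V M\<close> an involution on all of \<open>V\<close>, with the missed
  vertices as fixed points.
\<close>

definition mate :: "complex set \<Rightarrow> complex set set \<Rightarrow> complex \<Rightarrow> complex" where
  "mate V M v = (if \<exists>e\<in>M. v \<in> e then THE u. u \<noteq> v \<and> (\<exists>e\<in>M. e \<inter> V = {u, v}) else v)"

lemma mate_missing: "matching_missing V E X M \<Longrightarrow> v \<in> V \<Longrightarrow> v \<in> X \<Longrightarrow> mate V M v = v"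
proof -
  assume "matching_missing V E X M" "v \<in> V" "v \<in> X"
  then have "\<not> (\<exists>e\<in>M. v \<in> e)" unfolding matching_missing_def by blast
  then show ?thesis unfolding mate_def by (simp only: if_False)
qed

lemma mate_edge:
  assumes "matching_missing V E X M" "e \<in> M" "e \<inter> V = {u, v}" "u \<noteq> v"
  shows "mate V M v = u"
proof -
  have v: "v \<in> e" "v \<in> V" using assms(3) by auto
  then have "v \<in> V - X" using assms(1,2) unfolding matching_missing_def by blast
  then have un: "\<exists>!e. e \<in> M \<and> v \<in> e" using assms(1) unfolding matching_missing_def by blast
  have "(THE u. u \<noteq> v \<and> (\<exists>e\<in>M. e \<inter> V = {u, v})) = u"
  proof (rule the_equality)
    show "u \<noteq> v \<and> (\<exists>e\<in>M. e \<inter> V = {u, v})" using assms by blast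
    fix u' assume u': "u' \<noteq> v \<and> (\<exists>e\<in>M. e \<inter> V = {u', v})"
    then obtain e' where e': "e' \<in> M" "e' \<inter> V = {u', v}" by blast
    then have "e' = e" using un assms(2) v by blast
    then show "u' = u" using e' u' assms(3,4) by (metis doubleton_eq_iff)
  qed
  then show ?thesis using assms(2) v unfolding mate_def by auto
qed

lemma mate_present:
  assumes "plane_graph V E" "matching_missing V E X M" "v \<in> V" "v \<notin> X"
  obtains e where "e \<in> M" "e \<inter> V = {mate V M v, v}" "mate V M v \<noteq> v"
proof -
  obtain e where e: "e \<in> M" "v \<in> e" "e \<in> E"
    using assms(2-4) unfolding matching_missing_def by blast
  obtain u where u: "u \<noteq> v" "e \<inter> V = {u, v}"
    using edge_other_end[OF assms(1) e(3,2) assms(3)] .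
  have "mate V M v = u" by (rule mate_edge[OF assms(2) e(1) u(2,1)])
  with e u that show ?thesis by blast
qed

lemma mate_involution:
  assumes "plane_graph V E" "matching_missing V E X M" "v \<in> V"
  shows "mate V M v \<in> V \<and> mate V M (mate V M v) = v"
proof (cases "v \<in> X")
  case True
  then show ?thesis using mate_missing[OF assms(2,3)] assms(3) by simp
next
  case False
  obtain e where e: "e \<in> M" "e \<inter> V = {mate V M v, v}" "mate V M v \<noteq> v"
    using mate_present[OF assms False] .
  have "mate V M (mate V M v) = v"
    by (rule mate_edge[OF assms(2) e(1)]) (use e in auto)
  with e show ?thesis by blast
qed

lemma edge_closed_iff_mate:
  assumes "plane_graph V E" "matching_missing V E X M" "C \<subseteq> V"
  shows "edge_closed V M C \<longleftrightarrow> mate V M ` C \<subseteq> C"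
proof
  assume c: "edge_closed V M C"
  show "mate V M ` C \<subseteq> C"
  proof (intro image_subsetI)
    fix v assume v: "v \<in> C"
    then have vV: "v \<in> V" using assms(3) by blast
    show "mate V M v \<in> C"
    proof (cases "v \<in> X")
      case True
      then show ?thesis using mate_missing[OF assms(2) vV] v by simp
    next
      case False
      obtain e where e: "e \<in> M" "e \<inter> V = {mate V M v, v}"
        using mate_present[OF assms(1,2) vV False] .
      then show ?thesis using c v unfolding edge_closed_def by fastforce
    qed
  qed
next
  assume m: "mate V M ` C \<subseteq> C"
  show "edge_closed V M C" unfolding edge_closed_def
  proof (intro ballI impI)
    fix e assume e: "e \<in> M" "e \<inter> V \<inter> C \<noteq> {}"
    then obtain v where v: "v \<in> e" "v \<in> V" "v \<in> C" by blast
    have "e \<in> E" using e assms(2) unfolding matching_missing_def by blast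
    then obtain u where u: "u \<noteq> v" "e \<inter> V = {u, v}" using edge_other_end[OF assms(1) _ v(1,2)] by blast
    have "mate V M v = u" by (rule mate_edge[OF assms(2) e(1) u(2,1)])
    then show "e \<inter> V \<subseteq> C" using m v u by auto
  qed
qed

lemma edge_closed_Un: "edge_closed V (M \<union> M') C \<longleftrightarrow> edge_closed V M C \<and> edge_closed V M' C"
  unfolding edge_closed_def by blast

text \<open>
  The component of \<open>p\<close> in the superposition is the orbit of \<open>p\<close> under the two mate involutions, and the
  vertices missed by a matching are the fixed points.
\<close>

lemma component_ends_aux:
  assumes pg: "plane_graph V E" and M: "matching_missing V E X M" and M': "matching_missing V E Y M'"
    and p: "p \<in> V" "p \<in> Y" "p \<notin> X"
  shows "\<exists>q. q \<noteq> p \<and> (q \<in> X) \<noteq> (q \<in> Y) \<and> component V (M \<union> M') p \<inter> (X \<union> Y) = {p, q}"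
proof -
  let ?a = "mate V M" and ?b = "mate V M'"
  have fix_a: "?a v = v \<longleftrightarrow> v \<in> X" if "v \<in> V" for v
    using mate_missing[OF M that] mate_present[OF pg M that] by blast
  have fix_b: "?b v = v \<longleftrightarrow> v \<in> Y" if "v \<in> V" for v
    using mate_missing[OF M' that] mate_present[OF pg M' that] by blast
  have "finite V" using pg by (simp add: plane_graph_def)
  then obtain C q where oc: "orbit_between V ?a ?b p C q"
    using two_involutions_orbit[of V ?a ?b p] mate_involution[OF pg M] mate_involution[OF pg M'] p fix_a fix_b
    by blast
  then have C: "C \<subseteq> V" "p \<in> C" "q \<in> C" "q \<noteq> p" "?a ` C \<subseteq> C" "?b ` C \<subseteq> C"
    and min: "\<And>T. T \<subseteq> C \<Longrightarrow> T \<noteq> {} \<Longrightarrow> ?a ` T \<subseteq> T \<Longrightarrow> ?b ` T \<subseteq> T \<Longrightarrow> T = C"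
    and fixed: "\<And>v. v \<in> C \<Longrightarrow> ?a v = v \<or> ?b v = v \<Longrightarrow> v = p \<or> v = q"
    and q: "(?a q = q) \<noteq> (?b q = q)"
    unfolding orbit_between_def by blast+
  let ?K = "component V (M \<union> M') p"
  have KV: "?K \<subseteq> V" using p by (simp add: component_subset)
  have "edge_closed V (M \<union> M') C"
    using C edge_closed_iff_mate[OF pg M C(1)] edge_closed_iff_mate[OF pg M' C(1)] by (simp add: edge_closed_Un)
  then have "?K \<subseteq> C" using C(2) by (rule component_least)
  moreover have "?K \<noteq> {}" using component_self by blast
  moreover have "?a ` ?K \<subseteq> ?K" "?b ` ?K \<subseteq> ?K"
    using edge_closed_component[of V "M \<union> M'" p] edge_closed_iff_mate[OF pg M KV] edge_closed_iff_mate[OF pg M' KV]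
    by (auto simp: edge_closed_Un)
  ultimately have K: "?K = C" by (rule min)
  have "q \<in> V" using C by blast
  then have "(q \<in> X) \<noteq> (q \<in> Y)" using q fix_a fix_b by blast
  moreover have "C \<inter> (X \<union> Y) = {p, q}"
    using fixed fix_a fix_b C(1,2,3) p \<open>(q \<in> X) \<noteq> (q \<in> Y)\<close> by blast
  ultimately show ?thesis using C(4) K by blast
qed

lemma component_ends:
  assumes "plane_graph V E" "matching_missing V E X M" "matching_missing V E Y M'"
    and "p \<in> V" "(p \<in> X) \<noteq> (p \<in> Y)"
  shows "\<exists>q. q \<noteq> p \<and> (q \<in> X) \<noteq> (q \<in> Y) \<and> component V (M \<union> M') p \<inter> (X \<union> Y) = {p, q}"
proof (cases "p \<in> Y")
  case True
  then have "p \<notin> X" using assms(5) by simp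
  with True show ?thesis by (rule component_ends_aux[OF assms(1,2,3,4)])
next
  case False
  then have "p \<in> X" using assms(5) by simp
  from component_ends_aux[OF assms(1,3,2,4) this False]
  show ?thesis by (simp add: Un_commute eq_commute)
qed

text \<open>
  The matching \<open>M\<close> outside \<open>C\<close> and \<open>M'\<close> inside. The superposition of \<open>swap_on C M M'\<close> and \<open>swap_on C M' M\<close>
  is that of \<open>M\<close> and \<open>M'\<close>, hence it has the same components; this is why swapping on a
  component is an involution.
\<close>

definition swap_on :: "complex set \<Rightarrow> complex set set \<Rightarrow> complex set set \<Rightarrow> complex set set" where
  "swap_on C M M' = {e \<in> M. e \<inter> C = {}} \<union> {e \<in> M'. e \<inter> C \<noteq> {}}"

lemma swap_on_swap_on: "swap_on C (swap_on C M M') (swap_on C M' M) = M"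
  unfolding swap_on_def by blast

lemma swap_on_Un: "swap_on C M M' \<union> swap_on C M' M = M \<union> M'"
  unfolding swap_on_def by blast

lemma prod_swap_on:
  assumes "finite M" "finite M'"
  shows "prod w (swap_on C M M') * prod w (swap_on C M' M) = prod w M * (prod w M' :: complex)"
proof -
  have split: "prod w N = prod w {e \<in> N. e \<inter> C = {}} * prod w {e \<in> N. e \<inter> C \<noteq> {}}" if "finite N" for N
    using that by (subst prod.union_disjoint[symmetric]) (auto intro: prod.cong)
  have sw: "prod w (swap_on C N N') = prod w {e \<in> N. e \<inter> C = {}} * prod w {e \<in> N'. e \<inter> C \<noteq> {}}"
    if "finite N" "finite N'" for N N'
    unfolding swap_on_def using that by (subst prod.union_disjoint) auto
  show ?thesis using assms by (simp add: sw split[of M] split[of M'] mult_ac)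
qed

lemma matching_missing_swap_on:
  assumes pg: "plane_graph V E" and M: "matching_missing V E X M" and M': "matching_missing V E Y M'"
    and C: "C \<subseteq> V" "edge_closed V (M \<union> M') C"
  shows "matching_missing V E ((X - C) \<union> (Y \<inter> C)) (swap_on C M M')"
proof -
  have off: "e \<inter> C = {}" if "e \<in> M \<union> M'" "v \<in> e" "v \<in> V" "v \<notin> C" for e v
    using that C unfolding edge_closed_def by blast
  have off': "(e \<in> swap_on C M M' \<and> v \<in> e) = (e \<in> M \<and> v \<in> e)" if "v \<in> V" "v \<notin> C" for e v
    using off[of e v] that unfolding swap_on_def by blast
  have on': "(e \<in> swap_on C M M' \<and> v \<in> e) = (e \<in> M' \<and> v \<in> e)" if "v \<in> C" for e v
    using that unfolding swap_on_def by blast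
  show ?thesis unfolding matching_missing_def
  proof (intro conjI ballI)
    show "swap_on C M M' \<subseteq> E" 
      using matching_missingD(1)[OF M] matching_missingD(1)[OF M'] unfolding swap_on_def by blast
  next
    fix v e assume v: "v \<in> V \<inter> ((X - C) \<union> (Y \<inter> C))" and e: "e \<in> swap_on C M M'"
    show "v \<notin> e"
    proof (cases "v \<in> C")
      case True
      then have "\<not> (e \<in> M' \<and> v \<in> e)" using v matching_missingD(2)[OF M'] by blast
      then show ?thesis using on'[OF True] e by blast
    next
      case False
      then have vX: "v \<in> V" "v \<in> X" using v by blast+
      then have "\<not> (e \<in> M \<and> v \<in> e)" using matching_missingD(2)[OF M] by blast
      then show ?thesis using off'[OF vX(1) False] e by blast
    qed
  next
    fix v assume v: "v \<in> V - ((X - C) \<union> (Y \<inter> C))"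
    show "\<exists>!e. e \<in> swap_on C M M' \<and> v \<in> e"
    proof (cases "v \<in> C")
      case True
      then have "v \<in> V" "v \<notin> Y" using v by blast+
      then show ?thesis unfolding on'[OF True] by (rule matching_missingD(3)[OF M'])
    next
      case False
      then have vX: "v \<in> V" "v \<notin> X" using v by blast+
      then show ?thesis unfolding off'[OF vX(1) False] by (rule matching_missingD(3)[OF M])
    qed
  qed
qed

section \<open>Paths in a plane graph between external nodes\<close>

text \<open>
  The part of the drawing occupied by the vertices in \<open>C\<close> and the edges at them.
\<close>

definition region :: "complex set \<Rightarrow> complex set set \<Rightarrow> complex set \<Rightarrow> complex set" where
  "region V N C = C \<union> \<Union>{e \<in> N. e \<inter> V \<inter> C \<noteq> {}}"

lemma region_disjoint:
  assumes pg: "plane_graph V E" and N: "N \<subseteq> E" and C: "C \<subseteq> V" "edge_closed V N C"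
    and C': "C' \<subseteq> V" "edge_closed V N C'" and disj: "C \<inter> C' = {}"
  shows "region V N C \<inter> region V N C' = {}"
proof -
  have meet: "e \<inter> e' \<subseteq> V" if "e \<in> N" "e' \<in> N" "e \<noteq> e'" for e e'
    using that pg N unfolding plane_graph_def by (meson subsetD)
  show ?thesis
  proof (rule ccontr)
    assume "\<not> ?thesis"
    then obtain x where x: "x \<in> region V N C" "x \<in> region V N C'" by blast
    have xC: "x \<in> C" if "x \<in> V" "x \<in> region V N C"
      using that C unfolding region_def edge_closed_def by blast
    have xC': "x \<in> C'" if "x \<in> V" "x \<in> region V N C'"
      using that C' unfolding region_def edge_closed_def by blast
    have "x \<notin> V" using x xC xC' disj by blast
    then obtain e e' where e: "e \<in> N" "e' \<in> N" "x \<in> e" "x \<in> e'" "e \<inter> V \<inter> C \<noteq> {}" "e' \<inter> V \<inter> C' \<noteq> {}"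
      using x C(1) C'(1) unfolding region_def by blast
    have "e = e'" using meet[OF e(1,2)] e(3,4) \<open>x \<notin> V\<close> by blast
    then show False using e C(2) C'(2) disj unfolding edge_closed_def by blast
  qed
qed

lemma component_path_component:
  assumes pg: "plane_graph V E" and N: "N \<subseteq> E" and p: "p \<in> V" and q: "q \<in> component V N p"
  shows "path_component (region V N (component V N p)) p q"
proof -
  let ?C = "component V N p"
  let ?R = "region V N ?C"
  have CR: "?C \<subseteq> ?R" by (auto simp: region_def)
  define T where "T = {v \<in> ?C. path_component ?R p v}"
  have "edge_closed V N T" unfolding edge_closed_def
  proof (intro ballI impI)
    fix e assume e: "e \<in> N" "e \<inter> V \<inter> T \<noteq> {}"
    then obtain v where v: "v \<in> e" "v \<in> V" "v \<in> T" by blast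
    have vC: "v \<in> ?C" and pv: "path_component ?R p v" using v by (auto simp: T_def)
    have eC: "e \<inter> V \<subseteq> ?C" using edge_closed_component[of V N p] e(1) v vC unfolding edge_closed_def by blast
    have eR: "e \<subseteq> ?R" using e(1) v vC unfolding region_def by blast
    have "e \<in> E" using e(1) N by blast
    then have "path_connected e"
      using pg unfolding plane_graph_def by (metis path_connected_path_image arc_imp_path)
    then have "path_component ?R v u" if "u \<in> e" for u
      using that v(1) eR by (meson path_component_of_subset path_connected_component)
    then show "e \<inter> V \<subseteq> T" using eC pv unfolding T_def by (auto intro: path_component_trans)
  qed
  moreover have "p \<in> T" using CR by (auto simp: T_def path_component_refl_eq)
  ultimately have "?C \<subseteq> T" by (rule component_least)
  then show ?thesis using q by (auto simp: T_def)
qed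

text \<open>
  If the components of nodes \<open>i\<close> and \<open>j\<close> were different, they would occupy disjoint regions. Extended by the arcs in
  the outer face, a path from \<open>i\<close> to \<open>k\<close> in the first and a path from \<open>j\<close> to \<open>l\<close> in the second would be
  disjoint chords with interlacing ends.
\<close>

lemma components_do_not_cross:
  assumes mg: "matchgate V E us" and N: "N \<subseteq> E"
    and ij: "i < j" "j < k" "k < l" "l < length us"
    and ik: "us ! k \<in> component V N (us ! i)" and jl: "us ! l \<in> component V N (us ! j)"
  shows "us ! j \<in> component V N (us ! i)"
proof (rule ccontr)
  assume no: "us ! j \<notin> component V N (us ! i)"
  have pg: "plane_graph V E" and usV: "set us \<subseteq> V" using mg by (auto simp: matchgate_def)
  have inV: "us ! m \<in> V" if "m < length us" for m using that usV by auto
  obtain r \<theta> \<gamma> where r: "V \<union> \<Union>E \<subseteq> ball 0 r"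
    and \<theta>: "\<And>i j. i < j \<Longrightarrow> j < length us \<Longrightarrow> \<theta> j < \<theta> i \<and> \<theta> i < \<theta> j + 2 * pi"
    and \<gamma>: "\<And>i. i < length us \<Longrightarrow> arc (\<gamma> i) \<and> pathstart (\<gamma> i) = us ! i \<and> pathfinish (\<gamma> i) = rcis r (\<theta> i) \<and>
           path_image (\<gamma> i) - {us ! i} \<subseteq> outer_face V E \<and> path_image (\<gamma> i) - {rcis r (\<theta> i)} \<subseteq> ball 0 r"
    and \<gamma>d: "\<And>i j. i < length us \<Longrightarrow> j < length us \<Longrightarrow> i \<noteq> j \<Longrightarrow> path_image (\<gamma> i) \<inter> path_image (\<gamma> j) = {}"
    using mg unfolding matchgate_def clockwise_on_outer_face_def by metis
  have rpos: "r > 0" using r inV[OF ij(4)] by (metis UnCI ball_empty empty_iff not_le subset_iff)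
  define R where "R = (\<lambda>m. region V N (component V N (us ! m)))"
  have Rsub: "R m \<subseteq> V \<union> \<Union>E" if "m < length us" for m
    using component_subset[OF inV[OF that], of N] N unfolding R_def region_def by blast
  have \<gamma>R: "path_image (\<gamma> m) \<inter> R m' \<subseteq> {us ! m}" if "m < length us" "m' < length us" for m m'
  proof -
    have "outer_face V E \<inter> (V \<union> \<Union>E) = {}" unfolding outer_face_def by (metis outside_no_overlap inf_commute)
    then show ?thesis using \<gamma>[OF that(1)] Rsub[OF that(2)] by blast
  qed
  have chord: "\<exists>f. path f \<and> pathstart f = rcis r (\<theta> m) \<and> pathfinish f = rcis r (\<theta> m') \<and>
      path_image f \<subseteq> path_image (\<gamma> m) \<union> R m \<union> path_image (\<gamma> m')"
    if mm: "m < length us" "m' < length us" "us ! m' \<in> component V N (us ! m)" for m m'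
  proof -
    obtain h where h: "path h" "path_image h \<subseteq> R m" "pathstart h = us ! m" "pathfinish h = us ! m'"
      using component_path_component[OF pg N inV[OF mm(1)] mm(3)] unfolding path_component_def R_def by blast
    let ?f = "reversepath (\<gamma> m) +++ (h +++ \<gamma> m')"
    have "path ?f" "pathstart ?f = rcis r (\<theta> m)" "pathfinish ?f = rcis r (\<theta> m')"
      using \<gamma>[OF mm(1)] \<gamma>[OF mm(2)] h by (auto simp: arc_imp_path)
    moreover have "path_image ?f \<subseteq> path_image (\<gamma> m) \<union> R m \<union> path_image (\<gamma> m')"
      using h(2) path_image_join_subset[of "reversepath (\<gamma> m)" "h +++ \<gamma> m'"] path_image_join_subset[of h "\<gamma> m'"]
      by auto
    ultimately show ?thesis by blast
  qed
  have len: "i < length us" "j < length us" "k < length us" "l < length us" using ij by auto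
  obtain f where f: "path f" "pathstart f = rcis r (\<theta> i)" "pathfinish f = rcis r (\<theta> k)"
      "path_image f \<subseteq> path_image (\<gamma> i) \<union> R i \<union> path_image (\<gamma> k)"
    using chord[OF len(1,3) ik] by blast
  obtain g where g: "path g" "pathstart g = rcis r (\<theta> j)" "pathfinish g = rcis r (\<theta> l)"
      "path_image g \<subseteq> path_image (\<gamma> j) \<union> R j \<union> path_image (\<gamma> l)"
    using chord[OF len(2,4) jl] by blast
  have inside: "R m \<subseteq> ball 0 r" "path_image (\<gamma> m) \<subseteq> ball 0 r \<union> {rcis r (\<theta> m)}" if "m < length us" for m
    using Rsub[OF that] r \<gamma>[OF that] by blast+
  have "path_image f \<inter> path_image g \<noteq> {}"
  proof (rule crossing_chords_meet[OF rpos _ _ _ _ f(1-3) g(1-3)])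
    show "\<theta> l < \<theta> k" "\<theta> k < \<theta> j" "\<theta> j < \<theta> i" "\<theta> i < \<theta> l + 2 * pi"
      using \<theta>[of k l] \<theta>[of j k] \<theta>[of i j] \<theta>[of i l] ij by auto
    show "path_image f \<subseteq> ball 0 r \<union> {rcis r (\<theta> i), rcis r (\<theta> k)}"
      using f(4) inside[OF len(1)] inside[OF len(3)] by blast
    show "path_image g \<subseteq> ball 0 r \<union> {rcis r (\<theta> j), rcis r (\<theta> l)}"
      using g(4) inside[OF len(2)] inside[OF len(4)] by blast
  qed
  moreover have disjC: "component V N (us ! i) \<inter> component V N (us ! j) = {}"
    using no by (rule component_disjoint)
  have "R i \<inter> R j = {}" unfolding R_def
    by (rule region_disjoint[OF pg N _ _ _ _ disjC])
      (use component_subset inV len edge_closed_component in auto)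
  moreover have ends: "us ! i \<in> R i" "us ! k \<in> R i" "us ! j \<in> R j" "us ! l \<in> R j"
    using ik jl by (auto simp: R_def region_def)
  ultimately obtain x where x: "x \<in> path_image f" "x \<in> path_image g" by blast
  have \<gamma>_avoids: "path_image (\<gamma> m) \<inter> R m' = {}"
    if "m < length us" "m' < length us" "us ! m \<in> R m''" "R m'' \<inter> R m' = {}" for m m' m''
    using \<gamma>R[OF that(1,2)] that(3,4) by blast
  have RR: "R i \<inter> R j = {}" "R j \<inter> R i = {}" using \<open>R i \<inter> R j = {}\<close> by blast+
  have neq: "i \<noteq> j" "i \<noteq> l" "k \<noteq> j" "k \<noteq> l" using ij by auto
  have "x \<notin> path_image (\<gamma> i)"
    using x(2) g(4) \<gamma>d[OF len(1,2) neq(1)] \<gamma>d[OF len(1,4) neq(2)] \<gamma>_avoids[OF len(1,2) ends(1) RR(1)] by blast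
  moreover have "x \<notin> path_image (\<gamma> k)"
    using x(2) g(4) \<gamma>d[OF len(3,2) neq(3)] \<gamma>d[OF len(3,4) neq(4)] \<gamma>_avoids[OF len(3,2) ends(2) RR(1)] by blast
  moreover have "x \<notin> R i"
    using x(2) g(4) RR(1) \<gamma>_avoids[OF len(2,1) ends(3) RR(2)] \<gamma>_avoids[OF len(4,1) ends(4) RR(2)] by blast
  ultimately show False using x(1) f(4) by blast
qed

section \<open>Matchgate identities\<close>

definition indicator_string :: "nat \<Rightarrow> nat set \<Rightarrow> bool list" where
  "indicator_string n S = map (\<lambda>i. i \<in> S) [0..<n]"

definition matchgate_identities :: "nat \<Rightarrow> (nat set \<Rightarrow> complex) \<Rightarrow> bool" where
  "matchgate_identities n g \<longleftrightarrow> (\<forall>A B. A \<subseteq> {..<n} \<longrightarrow> B \<subseteq> {..<n} \<longrightarrow>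
    (\<Sum>i\<in>sym_diff A B. (-1) ^ card {j \<in> sym_diff A B. j < i} * g (sym_diff A {i}) * g (sym_diff B {i})) = 0)"

lemma image_subsets_eqI:
  assumes "L \<subseteq> f ` A" "R \<subseteq> f ` A" "\<And>k. k \<in> A \<Longrightarrow> f k \<in> L \<longleftrightarrow> f k \<in> R"
  shows "L = R"
  using assms by blast

lemma matchgate_value_indicator:
  assumes "distinct us" "set us \<subseteq> V" "length us = n" "S \<subseteq> {..<n}"
  shows "matchgate_value V E w us (indicator_string n S)
    = (\<Sum>M | matching_missing V E ((!) us ` S) M. prod w M)"
proof -
  have X: "{us ! i | i. i < length us \<and> indicator_string n S ! i} = (!) us ` S"
  proof -
    have "(i < length us \<and> indicator_string n S ! i) = (i \<in> S)" for i
      using assms(3,4) by (auto simp: indicator_string_def)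
    then show ?thesis by auto
  qed
  have "(!) us ` S \<subseteq> V" using assms(2-4) nth_mem by fastforce
  then have "perfect_matching (V - (!) us ` S) {e \<in> E. e \<inter> (!) us ` S = {}} = matching_missing V E ((!) us ` S)"
    by (intro ext perfect_matching_delete_iff)
  then show ?thesis
    unfolding matchgate_value_def Let_def X num_PM_def by (simp only:)
qed

text \<open>
  Because components do not cross, the nodes of \<open>D\<close> strictly between two partners \<open>i\<close> and \<open>j\<close>
  have their partners there, too. So their number is even, and the ranks of \<open>i\<close> and \<open>j\<close> in \<open>D\<close> have
  different parity.
\<close>

lemma matchgate_partner_parity:
  assumes mg: "matchgate V E us" and N: "N \<subseteq> E" and D: "D \<subseteq> {..<length us}"
    and ends: "\<And>k. k \<in> D \<Longrightarrow> \<exists>l\<in>D. l \<noteq> k \<and> component V N (us ! k) \<inter> (!) us ` D = {us ! k, us ! l}"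
    and ij: "i \<in> D" "j \<in> D" "i < j" "us ! j \<in> component V N (us ! i)"
  shows "(-1) ^ card {k \<in> D. k < j} = - ((-1) ^ card {k \<in> D. k < i} :: complex)"
proof -
  let ?K = "\<lambda>k. component V N (us ! k)"
  have fin: "finite D" using D finite_subset by blast
  have len: "k < length us" if "k \<in> D" for k using that D by auto
  have dist: "distinct us" using mg by (simp add: matchgate_def)
  have inj: "us ! k = us ! l \<longleftrightarrow> k = l" if "k \<in> D" "l \<in> D" for k l
    using nth_eq_iff_index_eq[OF dist len[OF that(1)] len[OF that(2)]] .
  obtain \<tau> where \<tau>: "\<And>k. k \<in> D \<Longrightarrow> \<tau> k \<in> D \<and> \<tau> k \<noteq> k \<and> ?K k \<inter> (!) us ` D = {us ! k, us ! \<tau> k}"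
    using ends by metis
  have \<tau>_eq: "l = \<tau> k" if kl: "k \<in> D" "l \<in> D" "l \<noteq> k" "us ! l \<in> ?K k" for k l
  proof -
    have "us ! l \<in> {us ! k, us ! \<tau> k}" using \<tau>[OF kl(1)] kl(2,4) by blast
    then show ?thesis using inj kl \<tau>[OF kl(1)] by auto
  qed
  have \<tau>K: "us ! \<tau> k \<in> ?K k" if "k \<in> D" for k using \<tau>[OF that] by blast
  have K\<tau>: "us ! k \<in> ?K (\<tau> k)" if "k \<in> D" for k using component_eq[OF \<tau>K[OF that]] by simp
  have \<tau>\<tau>: "\<tau> (\<tau> k) = k" if "k \<in> D" for k
    using \<tau>_eq[of "\<tau> k" k] \<tau>[OF that] K\<tau>[OF that] that by auto
  have \<tau>i: "\<tau> i = j" using \<tau>_eq[of i j] ij by auto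
  have \<tau>j: "\<tau> j = i" using \<tau>\<tau>[OF ij(1)] \<tau>i by simp
  have between: "i < \<tau> k \<and> \<tau> k < j" if k: "k \<in> D" "i < k" "k < j" for k
  proof (rule ccontr)
    assume no: "\<not> ?thesis"
    have \<tau>k: "\<tau> k \<in> D" using \<tau>[OF k(1)] by blast
    have ne: "\<tau> k \<noteq> i" "\<tau> k \<noteq> j" using \<tau>i \<tau>j \<tau>\<tau>[OF k(1)] k by auto
    have "us ! k \<notin> ?K i" using \<tau>_eq[OF ij(1) k(1)] \<tau>i k by auto
    have "us ! i \<notin> ?K (\<tau> k)" using \<tau>_eq[OF \<tau>k ij(1)] ne \<tau>\<tau>[OF k(1)] k by auto
    consider "j < \<tau> k" | "\<tau> k < i" using no ne by linarith
    then show False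
    proof cases
      case 1
      then show False
        using components_do_not_cross[OF mg N k(2,3) 1 len[OF \<tau>k] ij(4) \<tau>K[OF k(1)]] \<open>us ! k \<notin> ?K i\<close> by blast
    next
      case 2
      then show False
        using components_do_not_cross[OF mg N 2 k(2,3) len[OF ij(2)] K\<tau>[OF k(1)] ij(4)] \<open>us ! i \<notin> ?K (\<tau> k)\<close> by blast
    qed
  qed
  let ?B = "{k \<in> D. i < k \<and> k < j}"
  have "even (card ?B)"
    by (rule even_card_involution[of _ \<tau>]) (use fin \<tau> \<tau>\<tau> between in auto)
  moreover have "{k \<in> D. k < j} = insert i ({k \<in> D. k < i} \<union> ?B)" using ij by auto
  moreover have "card (insert i ({k \<in> D. k < i} \<union> ?B)) = Suc (card ({k \<in> D. k < i} \<union> ?B))"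
    by (rule card_insert_disjoint) (use fin in auto)
  moreover have "card ({k \<in> D. k < i} \<union> ?B) = card {k \<in> D. k < i} + card ?B"
    by (rule card_Un_disjoint) (use fin in auto)
  ultimately show ?thesis by (simp only: power_Suc power_add) simp
qed

text \<open>
  The left hand side of an identity is a sum over triples \<open>(i, M, M')\<close>, and swapping the component of node \<open>i\<close>
  is a sign-reversing involution on these triples.
\<close>

theorem matchgate_identities_matchgate_signature:
  assumes "matchgate_signature n f"
  shows "matchgate_identities n (\<lambda>S. f (indicator_string n S))"
proof -
  obtain V E w us where mg: "matchgate V E us" and len: "length us = n"
    and f: "\<And>\<alpha>. length \<alpha> = n \<Longrightarrow> f \<alpha> = matchgate_value V E w us \<alpha>"
    using assms unfolding matchgate_signature_def by auto
  have pg: "plane_graph V E" and dist: "distinct us" and usV: "set us \<subseteq> V"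
    using mg by (auto simp: matchgate_def)
  have finE: "finite E" using pg by (simp add: plane_graph_def)
  define P where "P = (\<lambda>S. {M. matching_missing V E ((!) us ` S) M})"
  have finP: "finite (P S)" for S
    by (rule finite_subset[of _ "Pow E"]) (use finE in \<open>auto simp: P_def matching_missing_def\<close>)
  have g: "f (indicator_string n S) = (\<Sum>M\<in>P S. prod w M)" if "S \<subseteq> {..<n}" for S
    using matchgate_value_indicator[OF dist usV len that, of E w] f[of "indicator_string n S"]
    by (simp add: P_def indicator_string_def)
  show ?thesis unfolding matchgate_identities_def
  proof (intro allI impI)
    fix A B :: "nat set" assume A: "A \<subseteq> {..<n}" and B: "B \<subseteq> {..<n}"
    define D where "D = sym_diff A B"
    have D: "D \<subseteq> {..<n}" using A B by (auto simp: D_def)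
    then have finD: "finite D" using finite_subset by blast
    define s :: "nat \<Rightarrow> complex" where "s = (\<lambda>i. (-1) ^ card {j \<in> D. j < i})"
    define T where "T = (SIGMA i:D. P (sym_diff A {i}) \<times> P (sym_diff B {i}))"
    define G where "G = (\<lambda>(i, M, M'). s i * prod w M * prod w M')"
    define partner where "partner = (\<lambda>i N. SOME j. j \<in> D \<and> j \<noteq> i \<and> us ! j \<in> component V N (us ! i))"
    define \<phi> where "\<phi> = (\<lambda>(i, M, M'). let C = component V (M \<union> M') (us ! i)
      in (partner i (M \<union> M'), swap_on C M M', swap_on C M' M))"
    have inj: "us ! k = us ! l \<longleftrightarrow> k = l" if "k < n" "l < n" for k l
      using nth_eq_iff_index_eq[OF dist] that len by auto
    have inV: "us ! k \<in> V" if "k < n" for k using that usV len by auto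
    have im: "us ! k \<in> (!) us ` S \<longleftrightarrow> k \<in> S" if "k < n" "S \<subseteq> {..<n}" for k S
      using inj that by auto
    have main: "\<phi> t \<in> T \<and> \<phi> (\<phi> t) = t \<and> G (\<phi> t) = - G t" if "t \<in> T" for t
    proof -
      obtain i M M' where t: "t = (i, M, M')" by (rule prod_cases3)
      have i: "i \<in> D" and M: "M \<in> P (sym_diff A {i})" and M': "M' \<in> P (sym_diff B {i})"
        using that unfolding t T_def by simp_all
      define X where "X = (!) us ` sym_diff A {i}"
      define Y where "Y = (!) us ` sym_diff B {i}"
      have mM: "matching_missing V E X M" and mM': "matching_missing V E Y M'"
        using M M' by (simp_all add: P_def X_def Y_def)
      have i': "i < n" using i D by auto
      have Ai: "sym_diff A {i} \<subseteq> {..<n}" and Bi: "sym_diff B {i} \<subseteq> {..<n}" using A B i' by auto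
      define N where "N = M \<union> M'"
      have N: "N \<subseteq> E" using mM mM' by (auto simp: N_def dest: matching_missingD(1))
      have XY: "(us ! k \<in> X) \<noteq> (us ! k \<in> Y) \<longleftrightarrow> k \<in> D" if "k < n" for k
        unfolding X_def Y_def im[OF that Ai] im[OF that Bi] by (auto simp: D_def)
      have DXY: "(!) us ` D \<subseteq> X \<union> Y" using XY D by fastforce
      have ends': "\<exists>l\<in>D. l \<noteq> k \<and> component V N (us ! k) \<inter> (X \<union> Y) = {us ! k, us ! l}" if k: "k \<in> D" for k
      proof -
        have k': "k < n" using k D by auto
        obtain q where q: "q \<noteq> us ! k" "(q \<in> X) \<noteq> (q \<in> Y)" "component V N (us ! k) \<inter> (X \<union> Y) = {us ! k, q}"
          using component_ends[OF pg mM mM' inV[OF k']] XY[OF k'] k unfolding N_def by blast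
        then have "q \<in> X \<union> Y" by blast
        then obtain l where l: "l < n" "q = us ! l" using Ai Bi unfolding X_def Y_def by auto
        then have "l \<in> D" "l \<noteq> k" using q XY by auto
        with q l show ?thesis by blast
      qed
      have ends: "\<exists>l\<in>D. l \<noteq> k \<and> component V N (us ! k) \<inter> (!) us ` D = {us ! k, us ! l}" if "k \<in> D" for k
        using ends'[OF that] DXY that by blast
      define C where "C = component V N (us ! i)"
      have CV: "C \<subseteq> V" and Cc: "edge_closed V N C"
        using component_subset[OF inV[OF i']] edge_closed_component by (auto simp: C_def)
      obtain j where j: "j \<in> D" "j \<noteq> i" "C \<inter> (X \<union> Y) = {us ! i, us ! j}"
        using ends'[OF i] unfolding C_def by blast
      have j': "j < n" using j D by auto
      have jC: "us ! j \<in> C" using j(3) by blast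
      have Cj: "component V N (us ! j) = C" using component_eq[of "us ! j" V N "us ! i"] jC by (simp add: C_def)
      have only: "l = i \<or> l = j" if "l \<in> D" "us ! l \<in> C" for l
      proof -
        have "us ! l \<in> {us ! i, us ! j}" using that DXY j(3) by blast
        then show ?thesis using inj that(1) D i' j' by auto
      qed
      have partner_i: "partner i N = j" unfolding partner_def
        by (rule some_equality) (use j jC only in \<open>auto simp: C_def\<close>)
      have partner_j: "partner j N = i" unfolding partner_def Cj
        by (rule some_equality) (use i j only in \<open>auto simp: C_def\<close>)
      have \<phi>t: "\<phi> t = (j, swap_on C M M', swap_on C M' M)"
        by (simp add: t \<phi>_def partner_i flip: N_def C_def)
      \<comment> \<open>A component contains no missed nodes but its ends, so the swap toggles just \<open>i\<close> and \<open>j\<close> among the missed nodes.\<close>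
      have toggle: "(!) us ` sym_diff S {i} - C \<union> (!) us ` sym_diff S' {i} \<inter> C = (!) us ` sym_diff S {j}"
        if S: "S \<subseteq> {..<n}" "S' \<subseteq> {..<n}" "sym_diff S S' = D" and
          C: "C \<inter> ((!) us ` sym_diff S {i} \<union> (!) us ` sym_diff S' {i}) = {us ! i, us ! j}" for S S'
      proof -
        have Si: "sym_diff S {i} \<subseteq> {..<n}" "sym_diff S' {i} \<subseteq> {..<n}" "sym_diff S {j} \<subseteq> {..<n}"
          using S i' j' by auto
        have iS: "i \<in> S \<longleftrightarrow> i \<notin> S'" and jS: "j \<in> S \<longleftrightarrow> j \<notin> S'" using S i j by auto
        show ?thesis
        proof (rule image_subsets_eqI[of _ "(!) us" "{..<n}"])
          show "(!) us ` sym_diff S {i} - C \<union> (!) us ` sym_diff S' {i} \<inter> C \<subseteq> (!) us ` {..<n}"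
            "(!) us ` sym_diff S {j} \<subseteq> (!) us ` {..<n}" using Si by blast+
        next
          fix k assume "k \<in> {..<n}"
          then have k: "k < n" by simp
          show "us ! k \<in> (!) us ` sym_diff S {i} - C \<union> (!) us ` sym_diff S' {i} \<inter> C
            \<longleftrightarrow> us ! k \<in> (!) us ` sym_diff S {j}"
        proof (cases "k = i \<or> k = j")
          case True
          then have "us ! k \<in> C" using jC by (auto simp: C_def)
          then show ?thesis using True iS jS j(2) im[OF k Si(2)] im[OF k Si(3)] by auto
        next
          case False
          then have "us ! k \<noteq> us ! i" "us ! k \<noteq> us ! j" using inj k i' j' by auto
          then have "us ! k \<in> C \<Longrightarrow> us ! k \<notin> (!) us ` sym_diff S {i} \<union> (!) us ` sym_diff S' {i}"
            using C by blast
          then show ?thesis using False im[OF k Si(1)] im[OF k Si(2)] im[OF k Si(3)] by auto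
        qed
        qed
      qed
      have "(X - C) \<union> (Y \<inter> C) = (!) us ` sym_diff A {j}"
        unfolding X_def Y_def by (rule toggle) (use A B D_def j(3) in \<open>auto simp: X_def Y_def\<close>)
      then have P1: "swap_on C M M' \<in> P (sym_diff A {j})"
        using matching_missing_swap_on[OF pg mM mM' CV Cc[unfolded N_def]] by (simp add: P_def)
      have "(Y - C) \<union> (X \<inter> C) = (!) us ` sym_diff B {j}"
        unfolding X_def Y_def by (rule toggle) (use A B D_def j(3) in \<open>auto simp: X_def Y_def\<close>)
      then have P2: "swap_on C M' M \<in> P (sym_diff B {j})"
        using matching_missing_swap_on[OF pg mM' mM CV Cc[unfolded N_def Un_commute[of M]]] by (simp add: P_def)
      have T: "\<phi> t \<in> T" using P1 P2 j(1) by (simp add: \<phi>t T_def)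
      have "\<phi> (\<phi> t) = t"
        unfolding \<phi>t by (simp add: \<phi>_def t swap_on_Un partner_j Cj swap_on_swap_on flip: N_def)
      moreover have "G (\<phi> t) = - G t"
      proof -
        have "s j = - s i"
        proof (cases "i < j")
          case True
          show ?thesis unfolding s_def
            by (rule matchgate_partner_parity[OF mg N _ ends i j(1) True]) (use D len jC in \<open>auto simp: C_def\<close>)
        next
          case False
          then have "j < i" using j(2) by simp
          have "s i = - s j" unfolding s_def
            by (rule matchgate_partner_parity[OF mg N _ ends j(1) i \<open>j < i\<close>]) (use D len Cj in \<open>auto simp: C_def\<close>)
          then show ?thesis by simp
        qed
        moreover have "finite M" "finite M'" using N finE finite_subset[of _ E] by (auto simp: N_def)
        then have "prod w (swap_on C M M') * prod w (swap_on C M' M) = prod w M * prod w M'"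
          by (rule prod_swap_on)
        ultimately show ?thesis unfolding \<phi>t by (simp add: G_def t mult.assoc)
      qed
      ultimately show ?thesis using T by blast
    qed
    have "sum G T = 0"
      by (rule sum_sign_reversing_involution[of T \<phi>]) (use main in blast)+
    moreover have "sum G T = (\<Sum>i\<in>D. s i * f (indicator_string n (sym_diff A {i})) * f (indicator_string n (sym_diff B {i})))"
    proof -
      have "sum G T = (\<Sum>i\<in>D. \<Sum>(M, M')\<in>P (sym_diff A {i}) \<times> P (sym_diff B {i}). s i * prod w M * prod w M')"
        unfolding T_def G_def using finD finP by (subst sum.Sigma) (auto intro!: sum.cong)
      also have "\<dots> = (\<Sum>i\<in>D. s i * f (indicator_string n (sym_diff A {i})) * f (indicator_string n (sym_diff B {i})))"
      proof (rule sum.cong[OF refl])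
        fix i assume "i \<in> D"
        then have "sym_diff A {i} \<subseteq> {..<n}" "sym_diff B {i} \<subseteq> {..<n}" using A B D by auto
        then have "s i * f (indicator_string n (sym_diff A {i})) * f (indicator_string n (sym_diff B {i}))
          = s i * (\<Sum>M\<in>P (sym_diff A {i}). \<Sum>M'\<in>P (sym_diff B {i}). prod w M * prod w M')"
          by (simp only: g mult.assoc sum_product)
        also have "\<dots> = (\<Sum>(M, M')\<in>P (sym_diff A {i}) \<times> P (sym_diff B {i}). s i * prod w M * prod w M')"
          by (simp add: sum_distrib_left sum.cartesian_product mult.assoc case_prod_unfold)
        finally show "(\<Sum>(M, M')\<in>P (sym_diff A {i}) \<times> P (sym_diff B {i}). s i * prod w M * prod w M')
          = s i * f (indicator_string n (sym_diff A {i})) * f (indicator_string n (sym_diff B {i}))" ..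
      qed
      finally show ?thesis .
    qed
    ultimately show "(\<Sum>i\<in>sym_diff A B. (-1) ^ card {j \<in> sym_diff A B. j < i} *
        f (indicator_string n (sym_diff A {i})) * f (indicator_string n (sym_diff B {i}))) = 0"
      by (simp add: s_def D_def)
  qed
qed

section \<open>Consequences for permutable signatures\<close>

definition permutable_identities :: "nat \<Rightarrow> (nat set \<Rightarrow> complex) \<Rightarrow> bool" where
  "permutable_identities n g \<longleftrightarrow> (\<forall>\<pi>. \<pi> permutes {..<n} \<longrightarrow> matchgate_identities n (\<lambda>S. g (\<pi> ` S)))"

lemma permutable_identities_matchgate_signature:
  assumes "permutable_matchgate_signature n f"
  shows "permutable_identities n (\<lambda>S. f (indicator_string n S))"
  unfolding permutable_identities_def
proof (intro allI impI)
  fix \<pi> assume \<pi>: "\<pi> permutes {..<n}"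
  have "matchgate_identities n (\<lambda>S. f (permute_list (inv \<pi>) (indicator_string n S)))"
    using assms permutes_inv[OF \<pi>] unfolding permutable_matchgate_signature_def
    by (intro matchgate_identities_matchgate_signature) blast
  moreover have "permute_list (inv \<pi>) (indicator_string n S) = indicator_string n (\<pi> ` S)" for S
  proof -
    have "indicator_string n S ! inv \<pi> i = (i \<in> \<pi> ` S)" if "i < n" for i
    proof -
      have "inv \<pi> i < n" using permutes_in_image[OF permutes_inv[OF \<pi>], of i] that by simp
      then show ?thesis using \<pi>
        by (auto simp: indicator_string_def permutes_inverses image_iff) (metis permutes_inverses(1))
    qed
    then show ?thesis by (simp add: permute_list_def indicator_string_def[of n "\<pi> ` S"])
      (simp add: indicator_string_def)
  qed
  ultimately show "matchgate_identities n (\<lambda>S. f (indicator_string n (\<pi> ` S)))" by simp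
qed

text \<open>
  The identities for the translate by \<open>T\<close> at \<open>A\<close> and \<open>B\<close> are the original ones at \<open>A \<triangle> T\<close> and \<open>B \<triangle> T\<close>,
  as \<open>A \<triangle> B\<close> does not change. A normalization is such a translate.
\<close>

lemma matchgate_identities_translate:
  assumes "matchgate_identities n g" "T \<subseteq> {..<n}"
  shows "matchgate_identities n (\<lambda>S. c * g (sym_diff S T))"
  unfolding matchgate_identities_def
proof (intro allI impI)
  fix A B assume AB: "A \<subseteq> {..<n}" "B \<subseteq> {..<n}"
  have D: "sym_diff (sym_diff A T) (sym_diff B T) = sym_diff A B" by blast
  have t: "sym_diff (sym_diff S {i}) T = sym_diff (sym_diff S T) {i}" for S and i :: nat by blast
  have sub: "sym_diff A T \<subseteq> {..<n}" "sym_diff B T \<subseteq> {..<n}" using AB assms(2) by auto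
  have "(\<Sum>i\<in>sym_diff A B. (-1) ^ card {j \<in> sym_diff A B. j < i} * g (sym_diff (sym_diff A T) {i}) *
      g (sym_diff (sym_diff B T) {i})) = 0"
    using assms(1)[unfolded matchgate_identities_def, rule_format, OF sub] unfolding D .
  then have "c * c * (\<Sum>i\<in>sym_diff A B. (-1) ^ card {j \<in> sym_diff A B. j < i} * g (sym_diff (sym_diff A T) {i}) *
      g (sym_diff (sym_diff B T) {i})) = 0" by simp
  then show "(\<Sum>i\<in>sym_diff A B. (-1) ^ card {j \<in> sym_diff A B. j < i} * (c * g (sym_diff (sym_diff A {i}) T)) *
      (c * g (sym_diff (sym_diff B {i}) T))) = 0"
    unfolding sum_distrib_left t by (simp only: mult_ac)
qed

lemma permutable_identities_translate:
  assumes "permutable_identities n g" "T \<subseteq> {..<n}"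
  shows "permutable_identities n (\<lambda>S. c * g (sym_diff S T))"
  unfolding permutable_identities_def
proof (intro allI impI)
  fix \<pi> assume \<pi>: "\<pi> permutes {..<n}"
  have "sym_diff (\<pi> ` S) T = \<pi> ` sym_diff S (inv \<pi> ` T)" for S
  proof -
    have "T = \<pi> ` inv \<pi> ` T" using \<pi> by (simp add: image_image permutes_inverses)
    moreover have "inj \<pi>" using \<pi> by (rule permutes_inj)
    ultimately show ?thesis by (metis image_Un image_set_diff)
  qed
  moreover have "inv \<pi> ` T \<subseteq> {..<n}"
    using assms(2) permutes_image[OF permutes_inv[OF \<pi>]] by blast
  ultimately show "matchgate_identities n (\<lambda>S. c * g (sym_diff (\<pi> ` S) T))"
    using matchgate_identities_translate[of n "\<lambda>S. g (\<pi> ` S)" "inv \<pi> ` T" c] assms(1) \<pi>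
    by (simp add: permutable_identities_def)
qed

text \<open>
  This is the expansion of a Pfaffian along the row of \<open>a\<close>: the identity for \<open>{a}\<close> and \<open>S - {a}\<close>.
\<close>

lemma matchgate_identities_expansion:
  assumes "matchgate_identities n G" "G {} = 1" "S \<subseteq> {..<n}" "a \<in> S"
  shows "(-1) ^ card {j \<in> S. j < a} * G S
    + (\<Sum>i\<in>S - {a}. (-1) ^ card {j \<in> S. j < i} * G {a, i} * G (S - {a, i})) = 0"
proof -
  have fin: "finite S" using assms(3) finite_subset by blast
  have D: "sym_diff {a} (S - {a}) = S" using assms(4) by blast
  have sub: "{a} \<subseteq> {..<n}" "S - {a} \<subseteq> {..<n}" using assms(3,4) by auto
  have "(\<Sum>i\<in>S. (-1) ^ card {j \<in> S. j < i} * G (sym_diff {a} {i}) * G (sym_diff (S - {a}) {i})) = 0"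
    using assms(1)[unfolded matchgate_identities_def, rule_format, OF sub] unfolding D .
  moreover have "sym_diff {a} {i} = {a, i}" "sym_diff (S - {a}) {i} = S - {a, i}" if "i \<in> S - {a}" for i
    using that by auto
  moreover have "sym_diff (S - {a}) {a} = S" using assms(4) by blast
  ultimately show ?thesis
    using assms(2) by (simp add: sum.remove[OF fin assms(4)])
qed

lemma vanish_without_edges:
  assumes G: "matchgate_identities n G" "G {} = 1" and S: "S \<subseteq> {..<n}" "S \<noteq> {}"
    and no: "\<And>x y. x \<in> S \<Longrightarrow> y \<in> S \<Longrightarrow> x \<noteq> y \<Longrightarrow> G {x, y} = 0"
  shows "G S = 0"
proof -
  obtain a where a: "a \<in> S" using S by blast
  have "(\<Sum>i\<in>S - {a}. (-1) ^ card {j \<in> S. j < i} * G {a, i} * G (S - {a, i})) = 0"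
    by (rule sum.neutral) (use no a in auto)
  then show ?thesis using matchgate_identities_expansion[OF G S(1) a] by simp
qed

text \<open>
  Expand along some \<open>b \<in> S\<close> other than the centre \<open>a\<close>. Only the term with \<open>G {b, a}\<close> survives, and its cofactor
  is a set without edges.
\<close>

lemma vanish_off_star:
  assumes G: "matchgate_identities n G" "G {} = 1" and S: "S \<subseteq> {..<n}" "S \<noteq> {}"
    and star: "\<And>x y. x < n \<Longrightarrow> y < n \<Longrightarrow> x \<noteq> y \<Longrightarrow> x \<noteq> a \<Longrightarrow> y \<noteq> a \<Longrightarrow> G {x, y} = 0"
    and not_edge: "\<And>b. b \<noteq> a \<Longrightarrow> S \<noteq> {a, b}"
  shows "G S = 0"
proof (cases "a \<in> S \<and> S \<noteq> {a}")
  case False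
  show ?thesis
  proof (rule vanish_without_edges[OF G S])
    fix x y assume xy: "x \<in> S" "y \<in> S" "x \<noteq> y"
    then have "x \<noteq> a" "y \<noteq> a" using False by auto
    then show "G {x, y} = 0" using star xy S by auto
  qed
next
  case True
  then obtain b where b: "b \<in> S" "b \<noteq> a" by blast
  have "G (S - {b, a}) = 0"
    by (rule vanish_without_edges[OF G]) (use S not_edge[OF b(2)] True b star in auto)
  then have "(\<Sum>i\<in>S - {b}. (-1) ^ card {j \<in> S. j < i} * G {b, i} * G (S - {b, i})) = 0"
  proof (intro sum.neutral ballI)
    fix i assume i: "i \<in> S - {b}"
    show "(-1) ^ card {j \<in> S. j < i} * G {b, i} * G (S - {b, i}) = 0"
    proof (cases "i = a")
      case True
      then show ?thesis using \<open>G (S - {b, a}) = 0\<close> by simp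
    next
      case False
      then have "G {b, i} = 0" using star[of b i] i b S by auto
      then show ?thesis by simp
    qed
  qed
  then show ?thesis using matchgate_identities_expansion[OF G S(1) b(1)] by simp
qed

lemma four_point_0123:
  assumes "matchgate_identities n H" "H {} = 1" "4 \<le> n"
  shows "H {0, 1, 2, 3} = H {0, 1} * H {2, 3} - H {0, 2} * H {1, 3} + H {0, 3} * H {1, 2}"
proof -
  have r: "{j \<in> {0, 1, 2, 3}. j < 0} = ({} :: nat set)" "{j \<in> {0, 1, 2, 3}. j < 1} = {0 :: nat}"
    "{j \<in> {0, 1, 2, 3}. j < 2} = {0, 1 :: nat}" "{j \<in> {0, 1, 2, 3}. j < 3} = {0, 1, 2 :: nat}" by auto
  have d: "{0, 1, 2, 3} - {0 :: nat} = {1, 2, 3}" "{0, 1, 2, 3} - {0, 1 :: nat} = {2, 3}"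
    "{0, 1, 2, 3} - {0, 2 :: nat} = {1, 3}" "{0, 1, 2, 3} - {0, 3 :: nat} = {1, 2}" by auto
  have "(-1) ^ card {j \<in> {0::nat, 1, 2, 3}. j < 0} * H {0, 1, 2, 3}
    + (\<Sum>i\<in>{0, 1, 2, 3} - {0}. (-1) ^ card {j \<in> {0, 1, 2, 3}. j < i} * H {0, i} * H ({0, 1, 2, 3} - {0, i})) = 0"
    by (rule matchgate_identities_expansion[OF assms(1,2)]) (use assms(3) in auto)
  moreover have "sum f {1, 2, 3} = f 1 + f 2 + f 3" for f :: "nat \<Rightarrow> complex" by simp
  moreover have "card {0 :: nat} = 1" "card {0, 1 :: nat} = 2" "card {0, 1, 2 :: nat} = 3" by simp_all
  ultimately have "H {0, 1, 2, 3} + ((-1) ^ 1 * H {0, 1} * H {2, 3} + (-1) ^ 2 * H {0, 2} * H {1, 3}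
      + (-1) ^ 3 * H {0, 3} * H {1, 2}) = 0"
    by (simp only: r d card.empty power_0 mult_1_left)
  then show ?thesis by algebra
qed

lemma permutation_of_four:
  assumes "a < n" "b < n" "c < n" "d < n" "distinct [a, b, c, d]"
  shows "\<exists>\<pi>. \<pi> permutes {..<n} \<and> \<pi> 0 = a \<and> \<pi> 1 = b \<and> \<pi> 2 = c \<and> \<pi> (3::nat) = d"
proof -
  have "card {a, b, c, d} = 4" using assms(5) by simp
  moreover have "card {a, b, c, d} \<le> card {..<n}" by (rule card_mono) (use assms in auto)
  ultimately have n: "4 \<le> n" by simp
  have "card ({..<n} - {0, 1, 2, 3}) = card ({..<n} - {a, b, c, d})"
    using n assms by (simp add: card_Diff_subset)
  then obtain h where h: "bij_betw h ({..<n} - {0, 1, 2, 3}) ({..<n} - {a, b, c, d})"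
    using finite_same_card_bij by (metis finite_Diff finite_lessThan)
  define \<pi> where "\<pi> = (\<lambda>x. if x = 0 then a else if x = 1 then b else if x = 2 then c else if x = (3::nat) then d
    else if x < n then h x else x)"
  have "bij_betw \<pi> {0, 1, 2, 3} {a, b, c, d}"
    using assms(5) by (auto simp: bij_betw_def inj_on_def \<pi>_def)
  moreover have "bij_betw \<pi> ({..<n} - {0, 1, 2, 3}) ({..<n} - {a, b, c, d})"
    using h by (rule bij_betw_cong[THEN iffD1, rotated]) (auto simp: \<pi>_def)
  ultimately have "bij_betw \<pi> ({0, 1, 2, 3} \<union> ({..<n} - {0, 1, 2, 3})) ({a, b, c, d} \<union> ({..<n} - {a, b, c, d}))"
    by (rule bij_betw_combine) auto
  moreover have "{0, 1, 2, 3} \<union> ({..<n} - {0, 1, 2, 3}) = {..<n}" "{a, b, c, d} \<union> ({..<n} - {a, b, c, d}) = {..<n}"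
    using n assms by auto
  ultimately have "bij_betw \<pi> {..<n} {..<n}" by simp
  then have "\<pi> permutes {..<n}" by (rule bij_imp_permutes) (use n in \<open>auto simp: \<pi>_def\<close>)
  then show ?thesis by (intro exI[of _ \<pi>]) (simp add: \<pi>_def)
qed

text \<open>
  For the order \<open>a, b, c, d\<close> of the variables, \<open>G {a, b, c, d}\<close> is the alternating sum of the three products of
  pair values. Exchanging \<open>b\<close> and \<open>c\<close> exchanges the signs of two of them, but not the value.
\<close>

lemma pair_products_eq:
  assumes G: "permutable_identities n G" "G {} = 1"
    and abcd: "a < n" "b < n" "c < n" "d < n" "distinct [a, b, c, d]"
  shows "G {a, b} * G {c, d} = G {a, c} * G {b, d}"
proof -
  have four: "G {a, b, c, d} = G {a, b} * G {c, d} - G {a, c} * G {b, d} + G {a, d} * G {b, c}"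
    if abcd: "a < n" "b < n" "c < n" "d < n" "distinct [a, b, c, d]" for a b c d
  proof -
    obtain \<pi> where \<pi>: "\<pi> permutes {..<n}" "\<pi> 0 = a" "\<pi> 1 = b" "\<pi> 2 = c" "\<pi> (3::nat) = d"
      using permutation_of_four[OF abcd] by blast
    have "card {a, b, c, d} = 4" using abcd(5) by simp
    moreover have "card {a, b, c, d} \<le> card {..<n}" by (rule card_mono) (use abcd in auto)
    ultimately have n: "4 \<le> n" by simp
    have "matchgate_identities n (\<lambda>S. G (\<pi> ` S))" using G(1) \<pi>(1) by (simp add: permutable_identities_def)
    from four_point_0123[OF this _ n] show ?thesis using G(2) \<pi>(2-5) by simp
  qed
  have "distinct [a, c, b, d]" using abcd(5) by auto
  from four[OF abcd(1,3,2,4) this] four[OF abcd]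
  have "2 * (G {a, b} * G {c, d}) = 2 * (G {a, c} * G {b, d})"
    by (simp add: insert_commute algebra_simps)
  then show ?thesis by simp
qed

text \<open>
  Two disjoint edges would span a complete graph on four vertices, since their product is nonzero. So any two edges
  meet, and without a triangle they all meet in one vertex.
\<close>

lemma star_if_no_triangle:
  assumes G: "permutable_identities n G" "G {} = 1"
    and tri: "\<And>x y z. x < n \<Longrightarrow> y < n \<Longrightarrow> z < n \<Longrightarrow> distinct [x, y, z] \<Longrightarrow> G {x, y} * G {x, z} * G {y, z} = 0"
    and ab: "a < n" "b < n" "a \<noteq> b" "G {a, b} \<noteq> 0"
  shows "\<exists>c<n. \<forall>x<n. \<forall>y<n. x \<noteq> y \<and> x \<noteq> c \<and> y \<noteq> c \<longrightarrow> G {x, y} = 0"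
proof (rule ccontr)
  assume no: "\<not> ?thesis"
  have meet: "{u, v} \<inter> {x, y} \<noteq> {}"
    if e: "u < n" "v < n" "x < n" "y < n" "u \<noteq> v" "x \<noteq> y" "G {u, v} \<noteq> 0" "G {x, y} \<noteq> 0" for u v x y
  proof
    assume "{u, v} \<inter> {x, y} = {}"
    then have "distinct [u, v, x, y]" "distinct [u, v, y, x]" using e by auto
    then have "G {u, v} * G {x, y} = G {u, x} * G {v, y}" "G {u, v} * G {y, x} = G {u, y} * G {v, x}"
      using pair_products_eq[OF G] e by blast+
    then have "G {u, x} \<noteq> 0" "G {v, x} \<noteq> 0" using e(7,8) by (auto simp: insert_commute)
    then show False using tri[of u v x] e \<open>distinct [u, v, x, y]\<close> by auto
  qed
  have no': "\<exists>x y. x < n \<and> y < n \<and> x \<noteq> y \<and> x \<noteq> c \<and> y \<noteq> c \<and> G {x, y} \<noteq> 0" if "c < n" for c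
    using no that by blast
  obtain z where z: "z < n" "z \<noteq> a" "z \<noteq> b" "G {b, z} \<noteq> 0"
  proof -
    obtain x y where xy: "x < n" "y < n" "x \<noteq> y" "x \<noteq> a" "y \<noteq> a" "G {x, y} \<noteq> 0" using no'[OF ab(1)] by blast
    then have "{a, b} \<inter> {x, y} \<noteq> {}" using meet[of a b x y] ab by blast
    then consider "x = b" | "y = b" using xy by auto
    then show thesis using that[of x] that[of y] xy by cases (auto simp: insert_commute)
  qed
  obtain w where w: "w < n" "w \<noteq> a" "w \<noteq> b" "G {a, w} \<noteq> 0"
  proof -
    obtain x y where xy: "x < n" "y < n" "x \<noteq> y" "x \<noteq> b" "y \<noteq> b" "G {x, y} \<noteq> 0" using no'[OF ab(2)] by blast
    then have "{a, b} \<inter> {x, y} \<noteq> {}" using meet[of a b x y] ab by blast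
    then consider "x = a" | "y = a" using xy by auto
    then show thesis using that[of x] that[of y] xy by cases (auto simp: insert_commute)
  qed
  have "w = z" using meet[of a w b z] ab w z by auto
  then show False using tri[of a b z] ab w z by auto
qed

lemma sum_alternating_ranks:
  assumes "finite (S :: nat set)"
  shows "(\<Sum>i\<in>S. (-1) ^ card {j \<in> S. j < i}) = (if even (card S) then 0 else 1 :: complex)"
  using assms
proof (induction S rule: finite_linorder_max_induct)
  case empty
  then show ?case by simp
next
  case (insert b A)
  have "b \<notin> A" using insert by auto
  have "{j \<in> insert b A. j < i} = {j \<in> A. j < i}" if "i \<in> A" for i
    using that insert by auto
  moreover have "{j \<in> insert b A. j < b} = A" using insert by auto
  ultimately show ?case using insert \<open>b \<notin> A\<close> by simp
qed

text \<open>
  A triangle allows to solve for \<open>y a\<close>, since necessarily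
  \<open>y a * y a = G {a, b} * G {a, c} / G {b, c}\<close>; then \<open>y d\<close> is determined by \<open>G {a, d}\<close>.
\<close>

lemma pair_values_rank_one:
  assumes G: "permutable_identities n G" "G {} = 1"
    and abc: "a < n" "b < n" "c < n" "distinct [a, b, c]" "G {a, b} * G {a, c} * G {b, c} \<noteq> 0"
  shows "\<exists>y. \<forall>d<n. \<forall>e<n. d \<noteq> e \<longrightarrow> G {d, e} = y d * y e"
proof -
  \<comment> \<open>Either square root will do: the sign of all \<open>y\<close> is free.\<close>
  define r where "r = csqrt (G {a, b} * G {a, c} / G {b, c})"
  have r2: "r * r = G {a, b} * G {a, c} / G {b, c}" by (simp add: r_def flip: power2_eq_square)
  have nz: "G {a, b} \<noteq> 0" "G {a, c} \<noteq> 0" "G {b, c} \<noteq> 0" using abc(5) by auto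
  then have r0: "r \<noteq> 0" using r2 by auto
  define y where "y = (\<lambda>d. if d = a then r else G {a, d} / r)"
  note pp = pair_products_eq[OF G]
  have triple: "G {a, d} * G {a, e} * G {b, c} = G {d, e} * (G {a, b} * G {a, c})"
    if de: "d < n" "e < n" "d \<noteq> e" "d \<noteq> a" "e \<noteq> a" for d e
  proof -
    have one: "G {a, x} * G {b, c} = G {b, x} * G {a, c}" "G {a, x} * G {b, c} = G {c, x} * G {a, b}"
      if "x < n" "x \<notin> {a, b, c}" for x
      using pp[of a x b c] pp[of a x c b] that abc by (auto simp: insert_commute mult_ac)
    consider "d \<in> {b, c}" "e \<in> {b, c}" | "d = b" "e \<notin> {b, c}" | "d = c" "e \<notin> {b, c}"
      | "e = b" "d \<notin> {b, c}" | "e = c" "d \<notin> {b, c}" | "d \<notin> {b, c}" "e \<notin> {b, c}" by blast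
    then show ?thesis
    proof cases
      case 1
      then show ?thesis using de by (auto simp: insert_commute mult_ac)
    next
      case 2
      then show ?thesis using one(1)[of e] de by (simp add: mult_ac)
    next
      case 3
      then show ?thesis using one(2)[of e] de by (simp add: mult_ac)
    next
      case 4
      then show ?thesis using one(1)[of d] de by (simp add: mult_ac insert_commute)
    next
      case 5
      then show ?thesis using one(2)[of d] de by (simp add: mult_ac insert_commute)
    next
      case 6
      have swap_e: "G {a, e} * G {c, d} = G {a, c} * G {e, d}" using pp[of a e c d] 6 de abc by auto
      have swap_d: "G {a, d} * G {b, c} = G {c, d} * G {a, b}" using one(2)[of d] 6 de by auto
      have "G {a, d} * G {a, e} * G {b, c} = (G {a, d} * G {b, c}) * G {a, e}" by (simp add: mult_ac)
      also have "\<dots> = (G {a, e} * G {c, d}) * G {a, b}" unfolding swap_d by (simp add: mult_ac)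
      also have "\<dots> = G {d, e} * (G {a, b} * G {a, c})"
        unfolding swap_e by (simp add: mult_ac insert_commute)
      finally show ?thesis .
    qed
  qed
  have "G {d, e} = y d * y e" if de: "d < n" "e < n" "d \<noteq> e" for d e
  proof -
    consider "d = a" | "e = a" | "d \<noteq> a" "e \<noteq> a" by blast
    then show ?thesis
    proof cases
      case 3
      then have "y d * y e = G {a, d} * G {a, e} / (r * r)" by (simp add: y_def)
      also have "\<dots> = G {d, e}" using triple[OF de 3] nz by (simp add: r2 field_simps)
      finally show ?thesis ..
    qed (use de r0 in \<open>auto simp: y_def insert_commute\<close>)
  qed
  then show ?thesis by blast
qed

text \<open>
  In the expansion along the least element of \<open>S\<close>, by induction every term is the full product
  up to its sign. For \<open>S\<close> of even size the signs of the ranks sum to \<open>0\<close>.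
\<close>

lemma parity_product_form:
  assumes G: "matchgate_identities n G" "G {} = 1"
    and y: "\<And>d e. d < n \<Longrightarrow> e < n \<Longrightarrow> d \<noteq> e \<Longrightarrow> G {d, e} = y d * y e"
    and S: "S \<subseteq> {..<n}"
  shows "G S = (if even (card S) then \<Prod>i\<in>S. y i else 0)"
  using S
proof (induction "card S" arbitrary: S rule: less_induct)
  case less
  have fin: "finite S" using less.prems finite_subset by blast
  show ?case
  proof (cases "S = {}")
    case True
    then show ?thesis using G(2) by simp
  next
    case False
    define a where "a = Min S"
    define p where "p = (if even (card S) then \<Prod>i\<in>S. y i else 0)"
    have a: "a \<in> S" using fin False by (simp add: a_def)
    have "a \<le> j" if "j \<in> S" for j using fin that by (simp add: a_def)
    then have rank_a: "{j \<in> S. j < a} = {}" by (auto simp flip: not_le)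
    have "(-1) ^ card {j \<in> S. j < i} * G {a, i} * G (S - {a, i}) = (-1) ^ card {j \<in> S. j < i} * p"
      if i: "i \<in> S - {a}" for i
    proof -
      have sub: "{a, i} \<subseteq> S" "a \<noteq> i" using a i by auto
      have "card (S - {a, i}) = card S - 2" using sub fin by (simp add: card_Diff_subset)
      moreover have "card S \<ge> 2" using card_mono[OF fin sub(1)] sub(2) by simp
      ultimately have c: "card (S - {a, i}) < card S" "even (card (S - {a, i})) = even (card S)" by auto
      have "G (S - {a, i}) = (if even (card S) then \<Prod>i\<in>S - {a, i}. y i else 0)"
      proof -
        have "S - {a, i} \<subseteq> {..<n}" using less.prems by blast
        then show ?thesis using less.hyps[OF c(1)] c(2) by simp
      qed
      moreover have "G {a, i} = y a * y i" using y sub less.prems by auto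
      moreover have "(\<Prod>i\<in>S. y i) = y a * (y i * (\<Prod>i\<in>S - {a, i}. y i))"
      proof -
        have "(\<Prod>j\<in>insert a (insert i (S - {a, i})). y j) = y a * (y i * (\<Prod>j\<in>S - {a, i}. y j))"
          using sub fin by simp
        moreover have "insert a (insert i (S - {a, i})) = S" using sub by blast
        ultimately show ?thesis by simp
      qed
      ultimately show ?thesis by (simp add: p_def mult_ac)
    qed
    then have terms: "(\<Sum>i\<in>S - {a}. (-1) ^ card {j \<in> S. j < i} * G {a, i} * G (S - {a, i}))
        = (\<Sum>i\<in>S - {a}. (-1) ^ card {j \<in> S. j < i} * p)"
      by (rule sum.cong[OF refl])
    have "G S + (\<Sum>i\<in>S - {a}. (-1) ^ card {j \<in> S. j < i} * p) = 0"
      using matchgate_identities_expansion[OF G less.prems a] unfolding terms rank_a by simp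
    moreover have "(\<Sum>i\<in>S. (-1) ^ card {j \<in> S. j < i} * p) = p + (\<Sum>i\<in>S - {a}. (-1) ^ card {j \<in> S. j < i} * p)"
      by (subst sum.remove[OF fin a]) (simp only: rank_a card.empty power_0 mult_1_left)
    moreover have "(\<Sum>i\<in>S. (-1) ^ card {j \<in> S. j < i} * p) = 0"
      using sum_alternating_ranks[OF fin] by (simp add: p_def flip: sum_distrib_right)
    ultimately have "G S = p" by (simp add: add_eq_0_iff2)
    then show ?thesis by (simp add: p_def)
  qed
qed

section \<open>Gadgets built by subdividing dangling edges\<close>

definition support :: "nat \<Rightarrow> bool list \<Rightarrow> nat set" where
  "support n \<alpha> = {i. i < n \<and> \<alpha> ! i}"

lemma support_subset: "support n \<alpha> \<subseteq> {..<n}"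
  by (auto simp: support_def)

lemma indicator_support: "length \<alpha> = n \<Longrightarrow> indicator_string n (support n \<alpha>) = \<alpha>"
  by (auto simp: indicator_string_def support_def intro: nth_equalityI)

lemma sym_sig_indicator:
  assumes "S \<subseteq> {..<n}"
  shows "sym_sig h (indicator_string n S) = h ! card S"
proof -
  have "count_list (indicator_string n S) True = length (filter (\<lambda>i. i \<in> S) [0..<n])"
    by (simp add: indicator_string_def count_list_eq_length_filter filter_map o_def)
  also have "\<dots> = card S"
    using assms by (subst distinct_card[symmetric]) (auto intro!: arg_cong[of _ _ card])
  finally show ?thesis by (simp add: sym_sig_def)
qed

lemma realized_cong:
  assumes "realized_up_to_const n f h B k" and "\<And>\<alpha>. length \<alpha> = n \<Longrightarrow> f' \<alpha> = c * f \<alpha>" "c \<noteq> 0"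
    and "B \<subseteq> B'" "k \<le> k'"
  shows "realized_up_to_const n f' h B' k'"
proof -
  obtain V E inc fs v\<^sub>0 d where g: "gadget n V E inc" "v\<^sub>0 \<in> V" "card (V - {v\<^sub>0}) \<le> k"
      "Suc (length (inc v\<^sub>0)) = length h" "fs v\<^sub>0 = sym_sig h"
      "\<forall>v \<in> V - {v\<^sub>0}. length (inc v) = 2 \<and> (\<exists>b\<in>B. length b = 3 \<and> fs v = sym_sig b)" "d \<noteq> 0"
      "\<forall>\<alpha>. length \<alpha> = n \<longrightarrow> f \<alpha> = d * gadget_value V E inc fs \<alpha>"
    using assms(1) unfolding realized_up_to_const_def by blast
  have "\<forall>v \<in> V - {v\<^sub>0}. length (inc v) = 2 \<and> (\<exists>b\<in>B'. length b = 3 \<and> fs v = sym_sig b)"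
    using g(6) assms(4) by blast
  moreover have "\<forall>\<alpha>. length \<alpha> = n \<longrightarrow> f' \<alpha> = (c * d) * gadget_value V E inc fs \<alpha>"
    using g(8) assms(2) by (simp add: mult.assoc)
  moreover have "c * d \<noteq> 0" "card (V - {v\<^sub>0}) \<le> k'" using g assms(3,5) by auto
  ultimately show ?thesis unfolding realized_up_to_const_def using g(1,2,4,5) by blast
qed

lemma realized_by_single_vertex:
  assumes "length h = Suc n"
  shows "realized_up_to_const n (sym_sig h) h B 0"
proof -
  let ?inc = "\<lambda>_ :: nat. map Dangling [0..<n]"
  have "{v. v = (0 :: nat) \<and> Dangling i \<in> Dangling ` {0..<n}} = {0}" if "i < n" for i
    using that by auto
  then have "gadget n {0} {} ?inc"
    by (auto simp: gadget_def distinct_map inj_on_def lessThan_atLeast0)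
  moreover have "sym_sig h \<alpha> = 1 * gadget_value {0} {} ?inc (\<lambda>_. sym_sig h) \<alpha>" if "length \<alpha> = n" for \<alpha>
  proof -
    have "map (\<lambda>i. \<alpha> ! i) [0..<n] = \<alpha>" using map_nth[of \<alpha>] that by simp
    then show ?thesis by (simp add: gadget_value_def o_def)
  qed
  ultimately show ?thesis unfolding realized_up_to_const_def using assms
    by (intro exI[of _ "{0}"] exI[of _ "{}"] exI[of _ ?inc] exI[of _ "\<lambda>_. sym_sig h"] exI[of _ 0] exI[of _ 1]) auto
qed

text \<open>
  Subdivide the dangling edge \<open>i\<close> by a new vertex with signature \<open>b\<close>: the old dangling edge becomes a
  normal edge \<open>e\<close> to the new vertex, which takes over the dangling edge.
\<close>

lemma realized_attach:
  assumes real: "realized_up_to_const n f h B k" and i: "i < n" and b: "b \<in> B" "length b = 3"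
  shows "realized_up_to_const n (\<lambda>\<alpha>. \<Sum>x\<in>UNIV. sym_sig b [\<alpha> ! i, x] * f (\<alpha>[i := x])) h B (Suc k)"
proof -
  obtain V E inc fs v\<^sub>0 c where gad: "gadget n V E inc" and v0: "v\<^sub>0 \<in> V" and k: "card (V - {v\<^sub>0}) \<le> k"
    and h: "Suc (length (inc v\<^sub>0)) = length h" "fs v\<^sub>0 = sym_sig h"
    and bin: "\<forall>v \<in> V - {v\<^sub>0}. length (inc v) = 2 \<and> (\<exists>b\<in>B. length b = 3 \<and> fs v = sym_sig b)"
    and c: "c \<noteq> 0" and f: "\<forall>\<alpha>. length \<alpha> = n \<longrightarrow> f \<alpha> = c * gadget_value V E inc fs \<alpha>"
    using real unfolding realized_up_to_const_def by blast
  have fin: "finite V" "finite E" using gad by (auto simp: gadget_def)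
  have dist: "distinct (inc w)" and inc: "set (inc w) \<subseteq> Dangling ` {..<n} \<union> Normal ` E" if "w \<in> V" for w
    using gad that by (auto simp: gadget_def)
  have cE: "card {w \<in> V. Normal d \<in> set (inc w)} = 2" if "d \<in> E" for d using gad that by (simp add: gadget_def)
  have cD: "card {w \<in> V. Dangling j \<in> set (inc w)} = 1" if "j < n" for j using gad that by (simp add: gadget_def)
  obtain v where v: "v \<notin> V" using ex_new_if_finite[OF infinite_UNIV_nat fin(1)] by blast
  obtain e where e: "e \<notin> E" using ex_new_if_finite[OF infinite_UNIV_nat fin(2)] by blast
  define s where "s = (\<lambda>d. if d = Dangling i then Normal e else d)"
  define inc' where "inc' = (\<lambda>w. if w = v then [Dangling i, Normal e] else map s (inc w))"
  define fs' where "fs' = fs(v := sym_sig b)"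
  have fresh: "Normal e \<notin> set (inc w)" if "w \<in> V" for w using inc[OF that] e by auto
  have inc'_V: "inc' w = map s (inc w)" if "w \<in> V" for w using that v by (auto simp: inc'_def)
  have inc'_v: "inc' v = [Dangling i, Normal e]" by (simp add: inc'_def)
  have s_mem: "Normal d \<in> s ` D \<longleftrightarrow> Normal d \<in> D" if "d \<noteq> e" for d D using that by (auto simp: s_def image_iff)
  have s_mem': "Dangling j \<in> s ` D \<longleftrightarrow> Dangling j \<in> D" if "j \<noteq> i" for j D using that by (auto simp: s_def image_iff)
  have s_mem_e: "Normal e \<in> s ` D \<longleftrightarrow> Dangling i \<in> D" if "Normal e \<notin> D" for D using that by (auto simp: s_def image_iff)
  have s_mem_i: "Dangling i \<notin> s ` D" for D by (auto simp: s_def)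
  have "gadget n (insert v V) (insert e E) inc'" unfolding gadget_def
  proof (intro conjI ballI allI impI)
    show "finite (insert v V)" "finite (insert e E)" using fin by auto
    show "distinct (inc' w)" if "w \<in> insert v V" for w
    proof (cases "w = v")
      case False
      then have w: "w \<in> V" using that by simp
      have "inj_on s (set (inc w))" using fresh[OF w] by (auto simp: inj_on_def s_def)
      then show ?thesis using dist[OF w] by (simp add: inc'_V[OF w] distinct_map)
    qed (simp add: inc'_v)
    show "set (inc' w) \<subseteq> Dangling ` {..<n} \<union> Normal ` insert e E" if "w \<in> insert v V" for w
    proof (cases "w = v")
      case False
      then have w: "w \<in> V" using that by simp
      show ?thesis using inc[OF w] by (auto simp: inc'_V[OF w] s_def)
    qed (use i in \<open>simp add: inc'_v\<close>)
    show "card {w \<in> insert v V. Normal d \<in> set (inc' w)} = 2" if "d \<in> insert e E" for d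
    proof (cases "d = e")
      case True
      have "{w \<in> insert v V. Normal d \<in> set (inc' w)} = insert v {w \<in> V. Dangling i \<in> set (inc w)}"
        using fresh True s_mem_e by (auto simp: inc'_v inc'_V)
      then show ?thesis using cD[OF i] v fin by simp
    next
      case False
      then have "{w \<in> insert v V. Normal d \<in> set (inc' w)} = {w \<in> V. Normal d \<in> set (inc w)}"
        using v by (auto simp: inc'_v inc'_V s_mem)
      then show ?thesis using cE[of d] that False by simp
    qed
    show "card {w \<in> insert v V. Dangling j \<in> set (inc' w)} = 1" if "j < n" for j
    proof (cases "j = i")
      case True
      have "{w \<in> insert v V. Dangling j \<in> set (inc' w)} = {v}"
        using True s_mem_i by (auto simp: inc'_v inc'_V)
      then show ?thesis by simp
    next
      case False
      then have "{w \<in> insert v V. Dangling j \<in> set (inc' w)} = {w \<in> V. Dangling j \<in> set (inc w)}"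
        using v by (auto simp: inc'_v inc'_V s_mem')
      then show ?thesis using cD[OF that] by simp
    qed
  qed
  moreover have "v\<^sub>0 \<in> insert v V" using v0 by simp
  moreover have "card (insert v V - {v\<^sub>0}) \<le> Suc k"
  proof -
    have "insert v V - {v\<^sub>0} = insert v (V - {v\<^sub>0})" using v v0 by auto
    then show ?thesis using k v fin by simp
  qed
  moreover have "Suc (length (inc' v\<^sub>0)) = length h" "fs' v\<^sub>0 = sym_sig h"
    using h v v0 by (auto simp: inc'_V fs'_def)
  moreover have "\<forall>w \<in> insert v V - {v\<^sub>0}. length (inc' w) = 2 \<and> (\<exists>b\<in>B. length b = 3 \<and> fs' w = sym_sig b)"
  proof
    fix w assume w: "w \<in> insert v V - {v\<^sub>0}"
    show "length (inc' w) = 2 \<and> (\<exists>b\<in>B. length b = 3 \<and> fs' w = sym_sig b)"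
    proof (cases "w = v")
      case True
      then show ?thesis using b by (auto simp: inc'_v fs'_def)
    next
      case False
      then have "w \<in> V - {v\<^sub>0}" using w by simp
      then show ?thesis using bin False by (simp add: inc'_V fs'_def)
    qed
  qed
  moreover have "\<forall>\<alpha>. length \<alpha> = n \<longrightarrow> (\<Sum>x\<in>UNIV. sym_sig b [\<alpha> ! i, x] * f (\<alpha>[i := x]))
      = c * gadget_value (insert v V) (insert e E) inc' fs' \<alpha>"
  proof (intro allI impI)
    fix \<alpha> :: "bool list" assume \<alpha>: "length \<alpha> = n"
    let ?P = "\<lambda>\<alpha> \<sigma>. \<Prod>w\<in>V. fs w (map (case_gadget_edge (\<lambda>i. \<alpha> ! i) \<sigma>) (inc w))"
    let ?P' = "\<lambda>\<sigma>. \<Prod>w\<in>insert v V. fs' w (map (case_gadget_edge (\<lambda>i. \<alpha> ! i) \<sigma>) (inc' w))"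
    have P': "?P' (\<sigma>(e := x)) = sym_sig b [\<alpha> ! i, x] * ?P (\<alpha>[i := x]) \<sigma>" for \<sigma> x
    proof -
      have "fs' w (map (case_gadget_edge (\<lambda>i. \<alpha> ! i) (\<sigma>(e := x))) (inc' w))
          = fs w (map (case_gadget_edge (\<lambda>j. \<alpha>[i := x] ! j) \<sigma>) (inc w))" if w: "w \<in> V" for w
      proof -
        have "map (case_gadget_edge (\<lambda>i. \<alpha> ! i) (\<sigma>(e := x))) (map s (inc w))
          = map (case_gadget_edge (\<lambda>j. \<alpha>[i := x] ! j) \<sigma>) (inc w)"
          unfolding map_map
        proof (rule map_cong[OF refl])
          fix d assume "d \<in> set (inc w)"
          then have "d \<noteq> Normal e" using fresh[OF w] by blast
          then show "(case_gadget_edge (\<lambda>i. \<alpha> ! i) (\<sigma>(e := x)) \<circ> s) d = case_gadget_edge (\<lambda>j. \<alpha>[i := x] ! j) \<sigma> d"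
            using \<alpha> i by (cases d) (auto simp: s_def nth_list_update)
        qed
        moreover have "fs' w = fs w" using w v by (auto simp: fs'_def)
        ultimately show ?thesis by (simp only: inc'_V[OF w])
      qed
      moreover have "fs' v (map (case_gadget_edge (\<lambda>i. \<alpha> ! i) (\<sigma>(e := x))) (inc' v)) = sym_sig b [\<alpha> ! i, x]"
        by (simp add: inc'_v fs'_def)
      ultimately show ?thesis using fin v by simp
    qed
    have "gadget_value (insert v V) (insert e E) inc' fs' \<alpha>
      = (\<Sum>(x, \<sigma>)\<in>UNIV \<times> (E \<rightarrow>\<^sub>E UNIV). ?P' (\<sigma>(e := x)))"
      unfolding gadget_value_def PiE_insert_eq
      by (subst sum.reindex) (use inj_combinator[OF e, of "\<lambda>_. UNIV :: bool set"] in \<open>simp_all add: o_def case_prod_unfold\<close>)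
    also have "\<dots> = (\<Sum>x\<in>UNIV. \<Sum>\<sigma>\<in>E \<rightarrow>\<^sub>E UNIV. sym_sig b [\<alpha> ! i, x] * ?P (\<alpha>[i := x]) \<sigma>)"
      unfolding P' by (rule sum.cartesian_product[symmetric])
    also have "\<dots> = (\<Sum>x\<in>UNIV. sym_sig b [\<alpha> ! i, x] * gadget_value V E inc fs (\<alpha>[i := x]))"
      unfolding gadget_value_def sum_distrib_left ..
    finally show "(\<Sum>x\<in>UNIV. sym_sig b [\<alpha> ! i, x] * f (\<alpha>[i := x]))
      = c * gadget_value (insert v V) (insert e E) inc' fs' \<alpha>"
      using f \<alpha> by (simp add: sum_distrib_left mult_ac)
  qed
  ultimately show ?thesis unfolding realized_up_to_const_def using c by blast
qed

lemma realized_diagonal: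
  assumes "realized_up_to_const n f h B k" "I \<subseteq> {..<n}" "\<And>i. i \<in> I \<Longrightarrow> [p i, 0, q i] \<in> B"
  shows "realized_up_to_const n (\<lambda>\<alpha>. (\<Prod>i\<in>I. if \<alpha> ! i then q i else p i) * f \<alpha>) h B (k + card I)"
proof -
  have "finite I" using assms(2) finite_subset by blast
  then show ?thesis using assms(2,3)
  proof (induction I)
    case empty
    then show ?case using assms(1) by simp
  next
    case (insert i I)
    have "realized_up_to_const n (\<lambda>\<alpha>. (\<Prod>i\<in>I. if \<alpha> ! i then q i else p i) * f \<alpha>) h B (k + card I)"
      using insert by auto
    from realized_attach[OF this, of i "[p i, 0, q i]"]
    have real: "realized_up_to_const n (\<lambda>\<alpha>. \<Sum>x\<in>UNIV. sym_sig [p i, 0, q i] [\<alpha> ! i, x] *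
        ((\<Prod>j\<in>I. if \<alpha>[i := x] ! j then q j else p j) * f (\<alpha>[i := x]))) h B (Suc (k + card I))"
      using insert by auto
    show ?case
    proof (rule realized_cong[OF real, where c = 1])
      fix \<alpha> :: "bool list" assume "length \<alpha> = n"
      have "\<alpha>[i := x] = \<alpha>" if "\<alpha> ! i = x" for x unfolding that[symmetric] by simp
      then show "(\<Prod>j\<in>insert i I. if \<alpha> ! j then q j else p j) * f \<alpha> = 1 * (\<Sum>x\<in>UNIV. sym_sig [p i, 0, q i] [\<alpha> ! i, x] *
        ((\<Prod>j\<in>I. if \<alpha>[i := x] ! j then q j else p j) * f (\<alpha>[i := x])))"
        using insert(1,2) by (cases "\<alpha> ! i") (simp_all add: UNIV_bool sym_sig_def)
    qed (use insert in auto)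
  qed
qed

lemma realized_flips:
  assumes "realized_up_to_const n f h B k" "I \<subseteq> {..<n}" "[0, 1, 0] \<in> B"
  shows "realized_up_to_const n (\<lambda>\<alpha>. f (indicator_string n (sym_diff (support n \<alpha>) I))) h B (k + card I)"
proof -
  have "finite I" using assms(2) finite_subset by blast
  then show ?thesis using assms(2)
  proof (induction I)
    case empty
    show ?case
      by (rule realized_cong[OF assms(1), where c = 1]) (auto simp: indicator_support)
  next
    case (insert i I)
    have "realized_up_to_const n (\<lambda>\<alpha>. f (indicator_string n (sym_diff (support n \<alpha>) I))) h B (k + card I)"
      using insert by auto
    from realized_attach[OF this, of i "[0, 1, 0]"]
    have real: "realized_up_to_const n (\<lambda>\<alpha>. \<Sum>x\<in>UNIV. sym_sig [0, 1, 0] [\<alpha> ! i, x] *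
        f (indicator_string n (sym_diff (support n (\<alpha>[i := x])) I))) h B (Suc (k + card I))"
      using insert assms(3) by auto
    show ?case
    proof (rule realized_cong[OF real, where c = 1])
      fix \<alpha> :: "bool list" assume \<alpha>: "length \<alpha> = n"
      have "sym_diff (support n (\<alpha>[i := (\<not> \<alpha> ! i)])) I = sym_diff (support n \<alpha>) (insert i I)"
        using insert \<alpha> by (auto simp: support_def nth_list_update split: if_splits)
      then show "f (indicator_string n (sym_diff (support n \<alpha>) (insert i I))) = 1 * (\<Sum>x\<in>UNIV. sym_sig [0, 1, 0] [\<alpha> ! i, x] *
        f (indicator_string n (sym_diff (support n (\<alpha>[i := x])) I)))"
        by (cases "\<alpha> ! i") (simp_all add: UNIV_bool sym_sig_def)
    qed (use insert in auto)
  qed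
qed

section \<open>Realizations of permutable signatures\<close>

lemma pin_sig_nth: "k \<le> n \<Longrightarrow> pin_sig n ! k = (if k = 0 then 1 else 0)"
  by (simp add: pin_sig_def del: upt_Suc)
lemma even_sig_nth: "k \<le> n \<Longrightarrow> even_sig n ! k = (if even k then 1 else 0)"
  by (simp add: even_sig_def del: upt_Suc)
lemma odd_sig_nth: "k \<le> n \<Longrightarrow> odd_sig n ! k = (if odd k then 1 else 0)"
  by (simp add: odd_sig_def del: upt_Suc)
lemma one_sig_nth: "k \<le> n \<Longrightarrow> one_sig n ! k = (if k = 1 then 1 else 0)"
  by (simp add: one_sig_def del: upt_Suc)

lemma length_sigs [simp]: "length (pin_sig n) = Suc n" "length (even_sig n) = Suc n"
  "length (odd_sig n) = Suc n" "length (one_sig n) = Suc n"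
  by (simp_all add: pin_sig_def even_sig_def odd_sig_def one_sig_def)

lemma card_le_arity: "S \<subseteq> {..<n} \<Longrightarrow> card S \<le> n"
  using card_mono[of "{..<n}" S] by simp

text \<open>
  The form in which a normalization \<open>G\<close> of \<open>F'\<close> is used: \<open>T\<close> is the set of ones of the string \<open>\<beta>\<close> at which
  \<open>F'\<close> was normalized, and \<open>c\<close> is the value of \<open>F'\<close> there.
\<close>

definition is_translate :: "nat \<Rightarrow> signature \<Rightarrow> nat set \<Rightarrow> complex \<Rightarrow> (nat set \<Rightarrow> complex) \<Rightarrow> bool" where
  "is_translate n F' T c G \<longleftrightarrow> T \<subseteq> {..<n} \<and> c \<noteq> 0 \<and>
    (\<forall>\<alpha>. length \<alpha> = n \<longrightarrow> F' \<alpha> = c * G (sym_diff (support n \<alpha>) T))"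

text \<open>
  \<open>F'\<close> is nonzero only at \<open>T\<close>, so flipping the bits in \<open>T\<close> suffices.
\<close>

lemma realized_pinning:
  assumes F': "is_translate n F' T c G"
    and G: "\<And>S. S \<subseteq> {..<n} \<Longrightarrow> G S = (if S = {} then 1 else 0)"
  shows "realized_up_to_const n F' (pin_sig n) {[0, 1, 0]} (2 * n)"
proof -
  have T: "T \<subseteq> {..<n}" and c: "c \<noteq> 0" using F' by (auto simp: is_translate_def)
  show ?thesis
  proof (rule realized_cong[OF realized_flips[OF realized_by_single_vertex T], where c = c])
    fix \<alpha> :: "bool list" assume \<alpha>: "length \<alpha> = n"
    have S: "sym_diff (support n \<alpha>) T \<subseteq> {..<n}" using support_subset T by blast
    then have "finite (sym_diff (support n \<alpha>) T)" using finite_subset by blast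
    then show "F' \<alpha> = c * sym_sig (pin_sig n) (indicator_string n (sym_diff (support n \<alpha>) T))"
      using F' \<alpha> S by (simp only: is_translate_def G sym_sig_indicator pin_sig_nth card_le_arity card_eq_0_iff) simp
  qed (use c card_le_arity[OF T] in auto)
qed

text \<open>
  The size of the translate of a set by \<open>T\<close> is even iff the sizes of both have the same parity, so the parity of
  \<open>T\<close> decides between the even and the odd signature. What remains is a product of factors
  that each depend on one bit.
\<close>

lemma realized_parity:
  assumes F': "is_translate n F' T c G"
    and G: "\<And>S. S \<subseteq> {..<n} \<Longrightarrow> G S = (if even (card S) then \<Prod>i\<in>S. y i else 0)"
  shows "\<exists>h\<in>{even_sig n, odd_sig n}.
    realized_up_to_const n F' h ({[1, 0, y] | y. True} \<union> {[0, 0, 1]}) (2 * n)"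
proof -
  define h where "h = (if even (card T) then even_sig n else odd_sig n)"
  \<comment> \<open>The factor of bit \<open>i\<close> is \<open>1\<close> at \<open>0\<close> and \<open>y i\<close> at \<open>1\<close>, or conversely if \<open>i \<in> T\<close>. In the latter case it has to be scaled by \<open>u i\<close> to have the form \<open>[1, 0, 1 / y i]\<close>, or \<open>[0, 0, 1]\<close> if \<open>y i = 0\<close>.\<close>
  define p where "p = (\<lambda>i. if i \<in> T \<and> y i = 0 then 0 else 1 :: complex)"
  define q where "q = (\<lambda>i. if i \<in> T then if y i = 0 then 1 else 1 / y i else y i)"
  define u where "u = (\<lambda>i. if i \<in> T \<and> y i \<noteq> 0 then y i else 1)"
  have T: "T \<subseteq> {..<n}" and c: "c \<noteq> 0" using F' by (auto simp: is_translate_def)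
  have finT: "finite T" using T finite_subset by blast
  have real: "realized_up_to_const n (\<lambda>\<alpha>. (\<Prod>i\<in>{..<n}. if \<alpha> ! i then q i else p i) * sym_sig h \<alpha>) h
      ({[1, 0, y] | y. True} \<union> {[0, 0, 1]}) (0 + card {..<n})"
    by (rule realized_diagonal[OF realized_by_single_vertex]) (auto simp: h_def p_def q_def)
  have "realized_up_to_const n F' h ({[1, 0, y] | y. True} \<union> {[0, 0, 1]}) (2 * n)"
  proof (rule realized_cong[OF real, where c = "c * (\<Prod>i<n. u i)"])
    fix \<alpha> :: "bool list" assume \<alpha>: "length \<alpha> = n"
    define A where "A = support n \<alpha>"
    have A: "A \<subseteq> {..<n}" unfolding A_def by (rule support_subset)
    then have finA: "finite A" using finite_subset by blast
    have AT: "sym_diff A T \<subseteq> {..<n}" using A T by blast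
    have "even (card (sym_diff A T)) \<longleftrightarrow> (even (card A) \<longleftrightarrow> even (card T))"
    proof -
      have "card (sym_diff A T) = card (A - T) + card (T - A)" using finA finT by (intro card_Un_disjoint) auto
      moreover have "card A = card (A - T) + card (A \<inter> T)" using finA by (metis card_Int_Diff add.commute)
      moreover have "card T = card (T - A) + card (A \<inter> T)" using finT by (metis card_Int_Diff add.commute Int_commute)
      ultimately show ?thesis by auto
    qed
    moreover have "sym_sig h \<alpha> = h ! card A"
      using sym_sig_indicator[OF A, of h] indicator_support[OF \<alpha>] by (simp add: A_def)
    ultimately have h: "sym_sig h \<alpha> = (if even (card (sym_diff A T)) then 1 else 0)"
      using card_le_arity[OF A] by (simp add: h_def even_sig_nth odd_sig_nth)
    have "(\<Prod>i\<in>sym_diff A T. y i) = (\<Prod>i<n. if i \<in> sym_diff A T then y i else 1)"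
      using AT by (subst prod.inter_restrict[symmetric]) (auto simp: Int_absorb1 intro!: prod.cong)
    also have "\<dots> = (\<Prod>i<n. u i * (if \<alpha> ! i then q i else p i))"
      by (rule prod.cong) (auto simp: A_def support_def u_def p_def q_def)
    also have "\<dots> = (\<Prod>i<n. u i) * (\<Prod>i<n. if \<alpha> ! i then q i else p i)" by (rule prod.distrib)
    finally have "(\<Prod>i\<in>sym_diff A T. y i) = (\<Prod>i<n. u i) * (\<Prod>i<n. if \<alpha> ! i then q i else p i)" .
    moreover have "F' \<alpha> = c * G (sym_diff A T)" using F' \<alpha> by (simp add: is_translate_def A_def)
    ultimately show "F' \<alpha> = c * (\<Prod>i<n. u i) * ((\<Prod>i\<in>{..<n}. if \<alpha> ! i then q i else p i) * sym_sig h \<alpha>)"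
      unfolding h G[OF AT] by simp
  next
    show "c * (\<Prod>i<n. u i) \<noteq> 0" using c by (auto simp: u_def)
  qed auto
  then show ?thesis by (rule bexI) (simp add: h_def)
qed

text \<open>
  After flipping bit \<open>a\<close>, the empty set becomes \<open>{a}\<close> and \<open>{a, b}\<close> becomes \<open>{b}\<close>, so the sets where
  \<open>G\<close> may be nonzero become singletons, and the factor \<open>G {a, b}\<close> depends on bit \<open>b\<close> alone.
\<close>

lemma realized_star:
  assumes F': "is_translate n F' T c G" and a: "a < n" and G1: "G {} = 1"
    and G: "\<And>S. S \<subseteq> {..<n} \<Longrightarrow> S \<noteq> {} \<Longrightarrow> (\<And>b. b \<noteq> a \<Longrightarrow> S \<noteq> {a, b}) \<Longrightarrow> G S = 0"
  shows "realized_up_to_const n F' (one_sig n) ({[1, 0, y] | y. True} \<union> {[0, 1, 0]}) (2 * n)"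
proof -
  let ?B = "{[1, 0, y] | y. True} \<union> {[0, 1, 0 :: complex]}"
  let ?w = "\<lambda>\<alpha>. \<Prod>i\<in>{..<n} - {a}. if \<alpha> ! i then G {a, i} else 1"
  define I where "I = sym_diff T {a}"
  have T: "T \<subseteq> {..<n}" and c: "c \<noteq> 0" using F' by (auto simp: is_translate_def)
  have I: "I \<subseteq> {..<n}" using T a by (auto simp: I_def)
  have "realized_up_to_const n (\<lambda>\<alpha>. ?w \<alpha> * sym_sig (one_sig n) \<alpha>) (one_sig n) ?B (0 + card ({..<n} - {a}))"
    by (rule realized_diagonal[OF realized_by_single_vertex]) auto
  from realized_flips[OF this I]
  have real: "realized_up_to_const n (\<lambda>\<alpha>. ?w (indicator_string n (sym_diff (support n \<alpha>) I)) *
      sym_sig (one_sig n) (indicator_string n (sym_diff (support n \<alpha>) I))) (one_sig n) ?B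
      (0 + card ({..<n} - {a}) + card I)" by auto
  show ?thesis
  proof (rule realized_cong[OF real, where c = c])
    fix \<alpha> :: "bool list" assume \<alpha>: "length \<alpha> = n"
    define S where "S = sym_diff (support n \<alpha>) T"
    define R where "R = sym_diff S {a}"
    have S: "S \<subseteq> {..<n}" using T support_subset unfolding S_def by blast
    have R: "R \<subseteq> {..<n}" using S a by (auto simp: R_def)
    have R_eq: "sym_diff (support n \<alpha>) I = R" unfolding R_def S_def I_def by blast
    have w: "?w (indicator_string n R) = (\<Prod>i\<in>R - {a}. G {a, i})"
    proof -
      have "?w (indicator_string n R) = (\<Prod>i\<in>{..<n} - {a}. if i \<in> R then G {a, i} else 1)"
        by (rule prod.cong) (auto simp: indicator_string_def)
      also have "\<dots> = (\<Prod>i\<in>({..<n} - {a}) \<inter> R. G {a, i})" by (rule prod.inter_restrict[symmetric]) simp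
      also have "({..<n} - {a}) \<inter> R = R - {a}" using R by blast
      finally show ?thesis .
    qed
    have one: "sym_sig (one_sig n) (indicator_string n R) = (if card R = 1 then 1 else 0)"
      using R by (simp add: sym_sig_indicator one_sig_nth card_le_arity)
    have "G S = (\<Prod>i\<in>R - {a}. G {a, i}) * (if card R = 1 then 1 else 0)"
    proof (cases "card R = 1")
      case True
      then obtain x where x: "R = {x}" by (auto simp: card_1_singleton_iff)
      show ?thesis
      proof (cases "x = a")
        case True
        then have "S = {}" using x unfolding R_def by blast
        then show ?thesis using True x G1 by simp
      next
        case False
        then have "S = {a, x}" using x unfolding R_def by blast
        then show ?thesis using False x by simp
      qed
    next
      case False
      have "G S = 0"
      proof (rule G[OF S])
        show "S \<noteq> {}" using False by (auto simp: R_def)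
        show "S \<noteq> {a, b}" if "b \<noteq> a" for b
        proof
          assume "S = {a, b}"
          then have "R = {b}" using that by (auto simp: R_def)
          then show False using False by simp
        qed
      qed
      then show ?thesis using False by simp
    qed
    then show "F' \<alpha> = c * (?w (indicator_string n (sym_diff (support n \<alpha>) I)) *
      sym_sig (one_sig n) (indicator_string n (sym_diff (support n \<alpha>) I)))"
      unfolding R_eq w one using F' \<alpha> by (simp add: is_translate_def S_def)
  next
    have "card ({..<n} - {a}) \<le> n" "card I \<le> n" using I by (auto intro: card_le_arity)
    then show "0 + card ({..<n} - {a}) + card I \<le> 2 * n" by simp
  qed (use c in auto)
qed

text \<open>
  A dangling edge through \<open>[1, 0, 0]\<close> and \<open>[0, 0, 1]\<close> requires its bit to be both \<open>0\<close> and \<open>1\<close>. In arity \<open>0\<close> there is no edge,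
  but there the odd signature is \<open>[0]\<close>.
\<close>

lemma realized_zero:
  assumes "\<And>\<alpha>. length \<alpha> = n \<Longrightarrow> F' \<alpha> = 0"
  shows "\<exists>h\<in>{even_sig n, odd_sig n}. realized_up_to_const n F' h {[1, 0, 0], [0, 0, 1]} (2 * n)"
proof (cases "n = 0")
  case True
  have "realized_up_to_const n F' (odd_sig n) {[1, 0, 0], [0, 0, 1]} (2 * n)"
    by (rule realized_cong[OF realized_by_single_vertex[of "odd_sig n"], where c = 1])
      (use True assms in \<open>auto simp: odd_sig_def sym_sig_def\<close>)
  then show ?thesis by blast
next
  case False
  let ?B = "{[1, 0, 0], [0, 0, 1]} :: complex list set"
  have "realized_up_to_const n (\<lambda>\<alpha>. (\<Prod>i\<in>{0}. if \<alpha> ! i then 0 else 1) * sym_sig (even_sig n) \<alpha>) (even_sig n) ?B (0 + card {0 :: nat})"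
    by (rule realized_diagonal[OF realized_by_single_vertex]) (use False in auto)
  then have "realized_up_to_const n (\<lambda>\<alpha>. (\<Prod>i\<in>{0}. if \<alpha> ! i then 1 else 0) * ((\<Prod>i\<in>{0}. if \<alpha> ! i then 0 else 1) * sym_sig (even_sig n) \<alpha>))
      (even_sig n) ?B (0 + card {0 :: nat} + card {0 :: nat})"
    by (rule realized_diagonal) (use False in auto)
  then have "realized_up_to_const n F' (even_sig n) ?B (2 * n)"
    by (rule realized_cong[where c = 1]) (use False assms in auto)
  then show ?thesis by blast
qed

lemma normalization_is_translate:
  assumes norm: "normalization n F' F" and perm: "permutable_matchgate_signature n F'"
  obtains T c where "is_translate n F' T c (\<lambda>S. F (indicator_string n S))"
    "permutable_identities n (\<lambda>S. F (indicator_string n S))" "F (indicator_string n {}) = 1"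
proof -
  obtain \<beta> where \<beta>: "length \<beta> = n" "F' \<beta> \<noteq> 0"
    and F: "\<And>\<alpha>. length \<alpha> = n \<Longrightarrow> F \<alpha> = F' (map2 (\<noteq>) \<alpha> \<beta>) / F' \<beta>"
    using norm unfolding normalization_def by blast
  define T where "T = support n \<beta>"
  define c where "c = F' \<beta>"
  have T: "T \<subseteq> {..<n}" unfolding T_def by (rule support_subset)
  have shift: "map2 (\<noteq>) (indicator_string n S) \<beta> = indicator_string n (sym_diff S T)" for S
    by (rule nth_equalityI) (auto simp: indicator_string_def \<beta>(1) T_def support_def)
  have FF': "F (indicator_string n S) = (1 / c) * F' (indicator_string n (sym_diff S T))" for S
  proof -
    have "length (indicator_string n S) = n" by (simp add: indicator_string_def)
    from F[OF this] show ?thesis unfolding shift c_def by simp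
  qed
  have "is_translate n F' T c (\<lambda>S. F (indicator_string n S))" unfolding is_translate_def
  proof (intro conjI allI impI)
    show "T \<subseteq> {..<n}" by (rule T)
    show c0: "c \<noteq> 0" using \<beta>(2) by (simp add: c_def)
    fix \<alpha> :: "bool list" assume \<alpha>: "length \<alpha> = n"
    have "sym_diff (sym_diff (support n \<alpha>) T) T = support n \<alpha>" by blast
    then show "F' \<alpha> = c * F (indicator_string n (sym_diff (support n \<alpha>) T))"
      using c0 by (simp only: FF' indicator_support[OF \<alpha>]) simp
  qed
  moreover have "permutable_identities n (\<lambda>S. F (indicator_string n S))"
    unfolding FF' by (rule permutable_identities_translate[OF permutable_identities_matchgate_signature[OF perm] T])
  moreover have "F (indicator_string n {}) = 1"
    using FF'[of "{}"] \<beta>(2) indicator_support[OF \<beta>(1)] by (simp add: c_def T_def)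
  ultimately show thesis using that by blast
qed

lemma permutable_identities_matchgate_identities: "permutable_identities n g \<Longrightarrow> matchgate_identities n g"
proof -
  assume "permutable_identities n g"
  then have "matchgate_identities n (\<lambda>S. g (id ` S))"
    using permutes_id[of "{..<n}"] unfolding permutable_identities_def by blast
  then show ?thesis by simp
qed

text \<open>
  A pair with nonzero value but no triangle of such pairs leaves only the star.
\<close>

theorem realizations_by_type:
  assumes norm: "normalization n F' F" and perm: "permutable_matchgate_signature n F'"
  shows realization_pinning_type: "pinning_type n F \<Longrightarrow> realized_up_to_const n F' (pin_sig n) {[0, 1, 0]} (2 * n)"
    and realization_parity_type: "parity_type n F \<Longrightarrow> \<exists>h\<in>{even_sig n, odd_sig n}.
      realized_up_to_const n F' h ({[1, 0, y] | y. True} \<union> {[0, 0, 1]}) (2 * n)"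
    and realization_neither_type: "\<not> pinning_type n F \<Longrightarrow> \<not> parity_type n F \<Longrightarrow>
      realized_up_to_const n F' (one_sig n) ({[1, 0, y] | y. True} \<union> {[0, 1, 0]}) (2 * n)"
proof -
  define G where "G = (\<lambda>S. F (indicator_string n S))"
  obtain T c where F': "is_translate n F' T c G" and G: "permutable_identities n G" and G1: "G {} = 1"
    using normalization_is_translate[OF norm perm] unfolding G_def by blast
  note mi = permutable_identities_matchgate_identities[OF G]
  have pair: "index_expr n F [a, b] = G {a, b}" for a b
    by (simp add: index_expr_def G_def indicator_string_def)
  show "realized_up_to_const n F' (pin_sig n) {[0, 1, 0]} (2 * n)" if "pinning_type n F"
  proof (rule realized_pinning[OF F'])
    fix S assume S: "S \<subseteq> {..<n}"
    show "G S = (if S = {} then 1 else 0)"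
    proof (cases "S = {}")
      case False
      then have "G S = 0"
        by (rule vanish_without_edges[OF mi G1 S]) (use that S in \<open>auto simp: pinning_type_def pair\<close>)
      then show ?thesis using False by simp
    qed (simp add: G1)
  qed
  show "\<exists>h\<in>{even_sig n, odd_sig n}.
      realized_up_to_const n F' h ({[1, 0, y] | y. True} \<union> {[0, 0, 1]}) (2 * n)" if par: "parity_type n F"
  proof -
    obtain a b c' where "a < n" "b < n" "c' < n" "distinct [a, b, c']" "G {a, b} * G {a, c'} * G {b, c'} \<noteq> 0"
      using par unfolding parity_type_def pair by blast
    from pair_values_rank_one[OF G G1 this]
    obtain y where y: "\<And>d e. d < n \<Longrightarrow> e < n \<Longrightarrow> d \<noteq> e \<Longrightarrow> G {d, e} = y d * y e" by blast
    show ?thesis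
      by (rule realized_parity[OF F', of y]) (rule parity_product_form[OF mi G1 y])
  qed
  show "realized_up_to_const n F' (one_sig n) ({[1, 0, y] | y. True} \<union> {[0, 1, 0]}) (2 * n)"
    if nopin: "\<not> pinning_type n F" and nopar: "\<not> parity_type n F"
  proof -
    obtain a b where ab: "a < n" "b < n" "a \<noteq> b" "G {a, b} \<noteq> 0"
      using nopin unfolding pinning_type_def pair by blast
    have "G {x, y} * G {x, z} * G {y, z} = 0" if "x < n" "y < n" "z < n" "distinct [x, y, z]" for x y z
      using nopar that unfolding parity_type_def pair by blast
    from star_if_no_triangle[OF G G1 this ab]
    obtain d where d: "d < n" "\<And>x y. x < n \<Longrightarrow> y < n \<Longrightarrow> x \<noteq> y \<Longrightarrow> x \<noteq> d \<Longrightarrow> y \<noteq> d \<Longrightarrow> G {x, y} = 0"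
      by blast
    show ?thesis
      by (rule realized_star[OF F' d(1) G1]) (rule vanish_off_star[OF mi G1 _ _ d(2)])
  qed
qed

section \<open>Matchgates drawn with straight lines\<close>

definition segment :: "('v \<Rightarrow> complex) \<Rightarrow> 'v \<times> 'v \<Rightarrow> complex set" where
  "segment pos j = closed_segment (pos (fst j)) (pos (snd j))"

text \<open>
  A plane drawing of a graph on abstract vertices. An edge is an ordered pair, but only to name its segment:
  the last conjunct excludes two edges with the same ends.
\<close>

definition straight_line_drawing :: "('v \<Rightarrow> complex) \<Rightarrow> 'v set \<Rightarrow> ('v \<times> 'v) set \<Rightarrow> bool" where
  "straight_line_drawing pos W J \<longleftrightarrow> finite W \<and> finite J \<and> inj_on pos W \<and>
    (\<forall>k l. (k, l) \<in> J \<longrightarrow> k \<in> W \<and> l \<in> W \<and> k \<noteq> l \<and>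
      (\<forall>v\<in>W. pos v \<in> segment pos (k, l) \<longrightarrow> v = k \<or> v = l)) \<and>
    (\<forall>j\<in>J. \<forall>j'\<in>J. j \<noteq> j' \<longrightarrow> segment pos j \<inter> segment pos j' \<subseteq> pos ` W \<and> {fst j, snd j} \<noteq> {fst j', snd j'})"

text \<open>
  The combinatorial counterpart of \<^const>\<open>matching_missing\<close>.
\<close>

definition covers_exactly :: "'v set \<Rightarrow> 'v set \<Rightarrow> ('v \<times> 'v) set \<Rightarrow> bool" where
  "covers_exactly W X N \<longleftrightarrow> (\<forall>v\<in>W. if v \<in> X then \<forall>j\<in>N. v \<noteq> fst j \<and> v \<noteq> snd j
    else \<exists>!j. j \<in> N \<and> (v = fst j \<or> v = snd j))"

lemma straight_line_drawingD:
  assumes "straight_line_drawing pos W J" "j \<in> J"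
  shows "fst j \<in> W" "snd j \<in> W" "fst j \<noteq> snd j"
    and "v \<in> W \<Longrightarrow> pos v \<in> segment pos j \<longleftrightarrow> v = fst j \<or> v = snd j"
    and "segment pos j \<inter> pos ` W = {pos (fst j), pos (snd j)}"
proof -
  have j: "(fst j, snd j) \<in> J" using assms(2) by simp
  show 1: "fst j \<in> W" "snd j \<in> W" "fst j \<noteq> snd j"
    using assms(1) j unfolding straight_line_drawing_def by blast+
  have 2: "pos v \<in> segment pos j \<longleftrightarrow> v = fst j \<or> v = snd j" if "v \<in> W" for v
  proof
    assume "pos v \<in> segment pos j"
    then have "pos v \<in> segment pos (fst j, snd j)" by simp
    then show "v = fst j \<or> v = snd j"
      using assms(1) j that unfolding straight_line_drawing_def by blast
  qed (auto simp: segment_def)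
  then show "v \<in> W \<Longrightarrow> pos v \<in> segment pos j \<longleftrightarrow> v = fst j \<or> v = snd j" .
  show "segment pos j \<inter> pos ` W = {pos (fst j), pos (snd j)}" using 1 2 by auto
qed

lemma straight_line_drawing_separate:
  assumes "straight_line_drawing pos W J" "j \<in> J" "j' \<in> J" "j \<noteq> j'"
  shows "segment pos j \<inter> segment pos j' \<subseteq> pos ` W" "{fst j, snd j} \<noteq> {fst j', snd j'}"
proof -
  have "\<forall>j\<in>J. \<forall>j'\<in>J. j \<noteq> j' \<longrightarrow> segment pos j \<inter> segment pos j' \<subseteq> pos ` W \<and> {fst j, snd j} \<noteq> {fst j', snd j'}"
    using assms(1) unfolding straight_line_drawing_def by (elim conjE)
  note c = this[rule_format, OF assms(2-4)]
  show "segment pos j \<inter> segment pos j' \<subseteq> pos ` W" by (rule conjunct1[OF c])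
  show "{fst j, snd j} \<noteq> {fst j', snd j'}" by (rule conjunct2[OF c])
qed

lemma plane_graph_drawing:
  assumes "straight_line_drawing pos W J"
  shows "plane_graph (pos ` W) (segment pos ` J)"
  unfolding plane_graph_def
proof (intro conjI ballI impI)
  show "finite (pos ` W)" "finite (segment pos ` J)"
    using assms unfolding straight_line_drawing_def by auto
next
  fix e assume "e \<in> segment pos ` J"
  then obtain j where j: "j \<in> J" "e = segment pos j" by blast
  have "inj_on pos W" using assms unfolding straight_line_drawing_def by blast
  then have "pos (fst j) \<noteq> pos (snd j)" using straight_line_drawingD(1-3)[OF assms j(1)] by (meson inj_onD)
  then show "\<exists>g. arc g \<and> path_image g = e \<and> e \<inter> pos ` W = {pathstart g, pathfinish g}"
    using straight_line_drawingD(5)[OF assms j(1)] j(2)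
    by (intro exI[of _ "linepath (pos (fst j)) (pos (snd j))"]) (auto simp: arc_linepath segment_def)
next
  fix e e' assume "e \<in> segment pos ` J" "e' \<in> segment pos ` J" "e \<noteq> e'"
  then obtain j j' where j: "e = segment pos j" "j \<in> J" "e' = segment pos j'" "j' \<in> J" by (elim imageE)
  then have "j \<noteq> j'" using \<open>e \<noteq> e'\<close> by auto
  with j show "e \<inter> e' \<subseteq> pos ` W" using straight_line_drawing_separate(1)[OF assms] by simp
qed

lemma inj_on_segment:
  assumes "straight_line_drawing pos W J"
  shows "inj_on (segment pos) J"
proof
  fix j j' assume j: "j \<in> J" "j' \<in> J" "segment pos j = segment pos j'"
  have "{pos (fst j), pos (snd j)} = {pos (fst j'), pos (snd j')}"
    using straight_line_drawingD(5)[OF assms j(1)] straight_line_drawingD(5)[OF assms j(2)] j(3) by simp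
  then have "pos ` {fst j, snd j} = pos ` {fst j', snd j'}" by simp
  moreover have "inj_on pos W" using assms unfolding straight_line_drawing_def by blast
  ultimately have "{fst j, snd j} = {fst j', snd j'}"
    using straight_line_drawingD(1,2)[OF assms j(1)] straight_line_drawingD(1,2)[OF assms j(2)]
    by (subst (asm) inj_on_image_eq_iff[of pos W]) auto
  then show "j = j'" using straight_line_drawing_separate(2)[OF assms j(1,2)] by blast
qed

lemma ex1_image_iff:
  assumes "inj_on f N"
  shows "(\<exists>!e. e \<in> f ` N \<and> P e) \<longleftrightarrow> (\<exists>!j. j \<in> N \<and> P (f j))"
proof
  assume "\<exists>!e. e \<in> f ` N \<and> P e"
  then obtain j where j: "j \<in> N" "P (f j)" and un: "\<And>e. e \<in> f ` N \<and> P e \<Longrightarrow> e = f j"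
    by (elim ex1E conjE imageE) auto
  show "\<exists>!j. j \<in> N \<and> P (f j)"
    by (rule ex1I[of _ j]) (use j un assms in \<open>auto dest: inj_onD\<close>)
next
  assume "\<exists>!j. j \<in> N \<and> P (f j)"
  then obtain j where j: "j \<in> N" "P (f j)" and un: "\<And>j'. j' \<in> N \<and> P (f j') \<Longrightarrow> j' = j"
    by (elim ex1E conjE) blast
  show "\<exists>!e. e \<in> f ` N \<and> P e"
  proof (rule ex1I[of _ "f j"])
    show "f j \<in> f ` N \<and> P (f j)" using j by blast
    fix e assume "e \<in> f ` N \<and> P e"
    then show "e = f j" using un by blast
  qed
qed

lemma matching_missing_drawing:
  assumes dr: "straight_line_drawing pos W J" and X: "X \<subseteq> W" and N: "N \<subseteq> J"
  shows "matching_missing (pos ` W) (segment pos ` J) (pos ` X) (segment pos ` N) \<longleftrightarrow> covers_exactly W X N"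
proof -
  have inj: "inj_on pos W" using dr unfolding straight_line_drawing_def by blast
  have mem: "pos v \<in> pos ` X \<longleftrightarrow> v \<in> X" if "v \<in> W" for v using inj X that by (meson inj_on_image_mem_iff)
  have inc: "pos v \<in> segment pos j \<longleftrightarrow> v = fst j \<or> v = snd j" if "v \<in> W" "j \<in> N" for v j
    using straight_line_drawingD(4)[OF dr] that N by blast
  have ex1: "(\<exists>!e. e \<in> segment pos ` N \<and> pos v \<in> e) \<longleftrightarrow> (\<exists>!j. j \<in> N \<and> (v = fst j \<or> v = snd j))" if v: "v \<in> W" for v
  proof -
    have "(\<exists>!e. e \<in> segment pos ` N \<and> pos v \<in> e) \<longleftrightarrow> (\<exists>!j. j \<in> N \<and> pos v \<in> segment pos j)"
      by (rule ex1_image_iff[OF inj_on_subset[OF inj_on_segment[OF dr] N]])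
    also have "\<dots> \<longleftrightarrow> (\<exists>!j. j \<in> N \<and> (v = fst j \<or> v = snd j))"
      using inc[OF v] by (intro arg_cong[of _ _ Ex1] ext conj_cong) auto
    finally show ?thesis .
  qed
  have "matching_missing (pos ` W) (segment pos ` J) (pos ` X) (segment pos ` N) \<longleftrightarrow>
      (\<forall>v\<in>W. if pos v \<in> pos ` X then \<forall>e\<in>segment pos ` N. pos v \<notin> e else \<exists>!e. e \<in> segment pos ` N \<and> pos v \<in> e)"
  proof -
    have split: "(\<forall>v\<in>V \<inter> Y. P v) \<and> (\<forall>v\<in>V - Y. Q v) \<longleftrightarrow> (\<forall>v\<in>V. if v \<in> Y then P v else Q v)"
      for V Y :: "complex set" and P Q by auto
    have "segment pos ` N \<subseteq> segment pos ` J" using N by blast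
    then have "matching_missing (pos ` W) (segment pos ` J) (pos ` X) (segment pos ` N) \<longleftrightarrow>
      (\<forall>v\<in>pos ` W. if v \<in> pos ` X then \<forall>e\<in>segment pos ` N. v \<notin> e else \<exists>!e. e \<in> segment pos ` N \<and> v \<in> e)"
      unfolding matching_missing_def split by (simp only: simp_thms)
    also have "\<dots> \<longleftrightarrow> (\<forall>v\<in>W. if pos v \<in> pos ` X then \<forall>e\<in>segment pos ` N. pos v \<notin> e
        else \<exists>!e. e \<in> segment pos ` N \<and> pos v \<in> e)"
      by (rule ball_simps(9))
    finally show ?thesis .
  qed
  also have "\<dots> \<longleftrightarrow> covers_exactly W X N" unfolding covers_exactly_def
  proof (rule ball_cong[OF refl])
    fix v assume v: "v \<in> W"
    show "(if pos v \<in> pos ` X then \<forall>e\<in>segment pos ` N. pos v \<notin> e else \<exists>!e. e \<in> segment pos ` N \<and> pos v \<in> e)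
      \<longleftrightarrow> (if v \<in> X then \<forall>j\<in>N. v \<noteq> fst j \<and> v \<noteq> snd j else \<exists>!j. j \<in> N \<and> (v = fst j \<or> v = snd j))"
      unfolding ex1[OF v] mem[OF v] using inc[OF v] by auto
  qed
  finally show ?thesis .
qed

text \<open>
  If the external nodes lie on a horizontal line above which there is nothing else, vertical segments
  lead from them to the circle. From left to right, the arguments of the points reached
  there decrease, which is the clockwise order.
\<close>

lemma clockwise_on_top_line:
  assumes pg: "plane_graph V E" and below: "V \<union> \<Union>E \<subseteq> {z. Im z \<le> h}" and h: "0 \<le> h"
    and us: "set us \<subseteq> V" "\<And>i. i < length us \<Longrightarrow> Im (us ! i) = h"
      "\<And>i j. i < j \<Longrightarrow> j < length us \<Longrightarrow> Re (us ! i) < Re (us ! j)"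
  shows "clockwise_on_outer_face V E us"
proof -
  have "compact e" if "e \<in> E" for e
    using pg that unfolding plane_graph_def by (metis arc_imp_path compact_path_image)
  then have "bounded (V \<union> \<Union>E)"
    using pg unfolding plane_graph_def by (auto simp: finite_imp_bounded compact_imp_bounded)
  then obtain r where r: "V \<union> \<Union>E \<subseteq> ball 0 r" using bounded_subset_ballD by blast
  have inV: "us ! i \<in> V" if "i < length us" for i using us(1) that by auto
  define \<theta> where "\<theta> = (\<lambda>i. arccos (Re (us ! i) / r))"
  define \<gamma> where "\<gamma> = (\<lambda>i. linepath (us ! i) (rcis r (\<theta> i)))"
  have ext: "\<exists>t. rcis r (\<theta> i) = Complex (Re (us ! i)) t \<and> h < t \<and> (Re (us ! i))\<^sup>2 + t\<^sup>2 = r\<^sup>2 \<and>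
      \<bar>Re (us ! i) / r\<bar> < 1 \<and> 0 < r" if i: "i < length us" for i
  proof -
    let ?x = "Re (us ! i)"
    have nr: "norm (us ! i) < r" using r inV[OF i] by auto
    then have r0: "0 < r" by (meson norm_ge_zero order.strict_trans1)
    have "?x\<^sup>2 + h\<^sup>2 < r\<^sup>2" using nr us(2)[OF i] r0
      by (metis cmod_power2 norm_ge_zero power_strict_mono zero_less_numeral)
    have x: "\<bar>?x / r\<bar> < 1" using nr abs_Re_le_cmod[of "us ! i"] r0 by (simp add: abs_divide)
    define t where "t = r * sin (\<theta> i)"
    have xb: "- 1 \<le> ?x / r" "?x / r \<le> 1" using x by linarith+
    have c: "cos (\<theta> i) = ?x / r" unfolding \<theta>_def by (rule cos_arccos) (fact xb)+
    have rc: "rcis r (\<theta> i) = Complex ?x t" using c r0 by (simp add: complex_eq_iff t_def)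
    have "?x = r * cos (\<theta> i)" using c r0 by simp
    then have sq: "?x\<^sup>2 + t\<^sup>2 = r\<^sup>2"
      unfolding t_def by (simp add: power_mult_distrib flip: distrib_left)
    have "sin (\<theta> i) \<ge> 0" unfolding \<theta>_def using arccos_bounded[OF xb] by (intro sin_ge_zero) auto
    then have "t \<ge> 0" using r0 by (simp add: t_def)
    have "h\<^sup>2 < t\<^sup>2" using \<open>?x\<^sup>2 + h\<^sup>2 < r\<^sup>2\<close> sq by simp
    then have "h < t" using \<open>t \<ge> 0\<close> by (rule power2_less_imp_less)
    then show ?thesis using rc sq x r0 by blast
  qed
  have bound: "- 1 \<le> Re (us ! i) / r" "Re (us ! i) / r \<le> 1" if "i < length us" for i
  proof -
    have "\<bar>Re (us ! i) / r\<bar> < 1" using ext[OF that] by blast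
    then show "- 1 \<le> Re (us ! i) / r" "Re (us ! i) / r \<le> 1" by linarith+
  qed
  have on_\<gamma>: "Re z = Re (us ! i) \<and> (z = us ! i \<or> h < Im z) \<and> (z = rcis r (\<theta> i) \<or> z \<in> ball 0 r)"
    if i: "i < length us" and z: "z \<in> path_image (\<gamma> i)" for i z
  proof -
    obtain t where t: "rcis r (\<theta> i) = Complex (Re (us ! i)) t" "h < t" "(Re (us ! i))\<^sup>2 + t\<^sup>2 = r\<^sup>2" "0 < r"
      using ext[OF i] by blast
    obtain u where u: "0 \<le> u" "u \<le> 1" "z = (1 - u) *\<^sub>R (us ! i) + u *\<^sub>R Complex (Re (us ! i)) t"
      using z unfolding \<gamma>_def t(1) path_image_linepath closed_segment_def by blast
    have re: "Re z = Re (us ! i)" unfolding u(3) by (simp add: algebra_simps)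
    have im: "Im z = h + u * (t - h)" unfolding u(3) using us(2)[OF i] by (simp add: algebra_simps)
    have "z = us ! i \<or> h < Im z"
    proof (cases "u = 0")
      case False
      then show ?thesis using im t(2) u(1) by simp
    qed (use u(3) in simp)
    moreover have "z = rcis r (\<theta> i) \<or> z \<in> ball 0 r"
    proof (cases "u = 1")
      case False
      have "u * (t - h) < 1 * (t - h)" using False u(2) t(2) by (intro mult_strict_right_mono) auto
      then have "Im z < t" unfolding im by (simp only: mult_1_left less_diff_eq add.commute)
      moreover have "0 \<le> Im z" unfolding im using u(1) t(2) h by simp
      ultimately have "0 \<le> Im z" "Im z < t" by blast+
      then have "(Im z)\<^sup>2 < t\<^sup>2" by (simp add: power_strict_mono)
      then have "(norm z)\<^sup>2 < r\<^sup>2" using re t(3) by (simp add: cmod_power2)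
      then have "norm z < r" using t(4) by (intro power2_less_imp_less[of "norm z" r]) auto
      then show ?thesis by simp
    qed (use u(3) t(1) in simp)
    ultimately show ?thesis using re by blast
  qed
  have above: "z \<in> outer_face V E" if "h < Im z" for z
  proof -
    have "convex {z. Im z \<le> h}" using convex_halfspace_Im_le by blast
    then have "- {z. Im z \<le> h} \<subseteq> outside (V \<union> \<Union>E)" using below by (rule outside_subset_convex)
    then show ?thesis using that by (auto simp: outer_face_def)
  qed
  show ?thesis unfolding clockwise_on_outer_face_def
  proof (rule exI[of _ r], rule exI[of _ \<theta>], rule exI[of _ \<gamma>], intro conjI allI impI)
    show "V \<union> \<Union>E \<subseteq> ball 0 r" by (rule r)
  next
    fix i j assume ij: "i < j \<and> j < length us"
    have "Re (us ! i) / r < Re (us ! j) / r" using ext[of i] us(3)[of i j] ij by (auto intro: divide_strict_right_mono)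
    then show "\<theta> j < \<theta> i" unfolding \<theta>_def using bound[of i] bound[of j] ij by (intro arccos_less_arccos) auto
    have "\<theta> i \<le> pi" "0 \<le> \<theta> j" unfolding \<theta>_def using bound[of i] bound[of j] ij
      by (metis arccos_ubound order.strict_trans, metis arccos_lbound)
    then show "\<theta> i < \<theta> j + 2 * pi" using pi_gt_zero by linarith
  next
    fix i assume i: "i < length us"
    obtain t where t: "rcis r (\<theta> i) = Complex (Re (us ! i)) t" "h < t" using ext[OF i] by blast
    have "Im (rcis r (\<theta> i)) = t" unfolding t(1) by simp
    then have "us ! i \<noteq> rcis r (\<theta> i)" using t(2) us(2)[OF i] by auto
    then show "arc (\<gamma> i)" unfolding \<gamma>_def by (rule arc_linepath)
    show "pathstart (\<gamma> i) = us ! i" "pathfinish (\<gamma> i) = rcis r (\<theta> i)" by (simp_all add: \<gamma>_def)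
    show "path_image (\<gamma> i) - {us ! i} \<subseteq> outer_face V E" using on_\<gamma>[OF i] above by blast
    show "path_image (\<gamma> i) - {rcis r (\<theta> i)} \<subseteq> ball 0 r" using on_\<gamma>[OF i] by blast
  next
    fix i j assume ij: "i < length us" "j < length us" "i \<noteq> j"
    have "Re (us ! i) \<noteq> Re (us ! j)" using us(3)[of i j] us(3)[of j i] ij by (cases "i < j") auto
    then show "path_image (\<gamma> i) \<inter> path_image (\<gamma> j) = {}" using on_\<gamma>[OF ij(1)] on_\<gamma>[OF ij(2)] by fastforce
  qed
qed

lemma matchgate_signature_drawing:
  fixes pos :: "'v \<Rightarrow> complex" and ext :: "nat \<Rightarrow> 'v" and w :: "'v \<times> 'v \<Rightarrow> complex"
  assumes dr: "straight_line_drawing pos W J"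
    and h: "0 \<le> h" "\<And>v. v \<in> W \<Longrightarrow> Im (pos v) \<le> h"
    and ext: "\<And>i. i < n \<Longrightarrow> ext i \<in> W" "\<And>i. i < n \<Longrightarrow> Im (pos (ext i)) = h"
      "\<And>i j. i < j \<Longrightarrow> j < n \<Longrightarrow> Re (pos (ext i)) < Re (pos (ext j))"
    and f: "\<And>S. S \<subseteq> {..<n} \<Longrightarrow>
      f (indicator_string n S) = (\<Sum>N | N \<subseteq> J \<and> covers_exactly W (ext ` S) N. prod w N)"
  shows "matchgate_signature n f"
proof -
  define us where "us = map (pos \<circ> ext) [0..<n]"
  define V where "V = pos ` W"
  define E where "E = segment pos ` J"
  have pg: "plane_graph V E" unfolding V_def E_def by (rule plane_graph_drawing[OF dr])
  have len: "length us = n" by (simp add: us_def)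
  have nth: "us ! i = pos (ext i)" if "i < n" for i using that by (simp add: us_def)
  have usV: "set us \<subseteq> V" using ext(1) by (auto simp: us_def V_def)
  have dist: "distinct us" unfolding distinct_conv_nth len
  proof (intro allI impI)
    fix i j assume "i < n" "j < n" "i \<noteq> j"
    then show "us ! i \<noteq> us ! j" using ext(3)[of i j] ext(3)[of j i] by (cases "i < j") (auto simp: nth)
  qed
  have "segment pos j \<subseteq> {z. Im z \<le> h}" if "j \<in> J" for j
    unfolding segment_def using straight_line_drawingD(1,2)[OF dr that] h(2)
    by (intro closed_segment_subset convex_halfspace_Im_le) auto
  then have "V \<union> \<Union>E \<subseteq> {z. Im z \<le> h}" using h(2) by (auto simp: V_def E_def)
  then have "clockwise_on_outer_face V E us"
    by (rule clockwise_on_top_line[OF pg _ h(1) usV]) (simp_all add: len nth ext)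
  then have mg: "matchgate V E us" unfolding matchgate_def using pg dist usV by blast
  \<comment> \<open>Weights are attached to the drawn edges.\<close>
  define w' where "w' = w \<circ> inv_into J (segment pos)"
  note inj = inj_on_segment[OF dr]
  have "f \<alpha> = matchgate_value V E w' us \<alpha>" if \<alpha>: "length \<alpha> = n" for \<alpha>
  proof -
    define S where "S = support n \<alpha>"
    have S: "S \<subseteq> {..<n}" unfolding S_def by (rule support_subset)
    have \<alpha>S: "\<alpha> = indicator_string n S" using indicator_support[OF \<alpha>] by (simp add: S_def)
    have X: "(!) us ` S = pos ` ext ` S" using S nth by (force simp: image_image)
    have XW: "ext ` S \<subseteq> W" using S ext(1) by auto
    have "matchgate_value V E w' us \<alpha> = (\<Sum>M | matching_missing V E (pos ` ext ` S) M. prod w' M)"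
      unfolding \<alpha>S X[symmetric] by (rule matchgate_value_indicator[OF dist usV len S])
    also have "{M. matching_missing V E (pos ` ext ` S) M} = (`) (segment pos) ` {N. N \<subseteq> J \<and> covers_exactly W (ext ` S) N}"
    proof (intro set_eqI iffI)
      fix M assume "M \<in> {M. matching_missing V E (pos ` ext ` S) M}"
      then have M: "matching_missing V E (pos ` ext ` S) M" by simp
      then have "M \<subseteq> segment pos ` J" unfolding E_def by (rule matching_missingD(1))
      then obtain N where "N \<subseteq> J" "M = segment pos ` N" by (meson subset_imageE)
      then show "M \<in> (`) (segment pos) ` {N. N \<subseteq> J \<and> covers_exactly W (ext ` S) N}"
        using M matching_missing_drawing[OF dr XW] unfolding V_def E_def by blast
    next
      fix M assume "M \<in> (`) (segment pos) ` {N. N \<subseteq> J \<and> covers_exactly W (ext ` S) N}"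
      then show "M \<in> {M. matching_missing V E (pos ` ext ` S) M}"
        using matching_missing_drawing[OF dr XW] unfolding V_def E_def by blast
    qed
    also have "(\<Sum>M\<in>(`) (segment pos) ` {N. N \<subseteq> J \<and> covers_exactly W (ext ` S) N}. prod w' M)
      = (\<Sum>N | N \<subseteq> J \<and> covers_exactly W (ext ` S) N. prod w' (segment pos ` N))"
    proof (subst sum.reindex)
      show "inj_on ((`) (segment pos)) {N. N \<subseteq> J \<and> covers_exactly W (ext ` S) N}"
        by (rule inj_onI) (use inj in \<open>auto simp: inj_on_image_eq_iff\<close>)
    qed simp
    also have "\<dots> = (\<Sum>N | N \<subseteq> J \<and> covers_exactly W (ext ` S) N. prod w N)"
    proof (rule sum.cong[OF refl])
      fix N assume "N \<in> {N. N \<subseteq> J \<and> covers_exactly W (ext ` S) N}"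
      then have N: "N \<subseteq> J" by simp
      then have "prod w' (segment pos ` N) = prod (w' \<circ> segment pos) N"
        by (intro prod.reindex inj_on_subset[OF inj])
      also have "\<dots> = prod w N"
        by (rule prod.cong[OF refl]) (use N inj in \<open>auto simp: w'_def\<close>)
      finally show "prod w' (segment pos ` N) = prod w N" .
    qed
    finally show ?thesis using f[OF S] \<alpha>S by simp
  qed
  then show ?thesis unfolding matchgate_signature_def using mg len by blast
qed

section \<open>A triangulated strip\<close>

datatype vertex = Outer nat | Inner nat | Centre

lemma mem_segment_iff:
  "z \<in> segment pos (k, l) \<longleftrightarrow> (\<exists>t. 0 \<le> t \<and> t \<le> 1 \<and>
    Re z = (1 - t) * Re (pos k) + t * Re (pos l) \<and> Im z = (1 - t) * Im (pos k) + t * Im (pos l))"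
  by (auto simp: segment_def closed_segment_def complex_eq_iff)

lemma covers_exactlyD:
  assumes "covers_exactly W X N" "v \<in> W"
  shows "v \<in> X \<Longrightarrow> j \<in> N \<Longrightarrow> v \<noteq> fst j \<and> v \<noteq> snd j"
    and "v \<notin> X \<Longrightarrow> \<exists>j\<in>N. v = fst j \<or> v = snd j"
    and "j \<in> N \<Longrightarrow> j' \<in> N \<Longrightarrow> v = fst j \<or> v = snd j \<Longrightarrow> v = fst j' \<or> v = snd j' \<Longrightarrow> j = j'"
proof -
  have c: "if v \<in> X then \<forall>j\<in>N. v \<noteq> fst j \<and> v \<noteq> snd j else \<exists>!j. j \<in> N \<and> (v = fst j \<or> v = snd j)"
    using assms unfolding covers_exactly_def by (rule bspec)
  show "v \<in> X \<Longrightarrow> j \<in> N \<Longrightarrow> v \<noteq> fst j \<and> v \<noteq> snd j" using c by simp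
  show "v \<notin> X \<Longrightarrow> \<exists>j\<in>N. v = fst j \<or> v = snd j" using c by (metis (no_types, lifting))
  show "j \<in> N \<Longrightarrow> j' \<in> N \<Longrightarrow> v = fst j \<or> v = snd j \<Longrightarrow> v = fst j' \<or> v = snd j' \<Longrightarrow> j = j'"
    using c by (cases "v \<in> X") (simp, metis (no_types, lifting))
qed

text \<open>
  Two rows of vertices, the external nodes in the upper and auxiliary ones in the lower row, with the edges of a zigzag and of
  the lower row. The lower left corner is present or not, according to a parameter \<open>b\<close>.
\<close>

fun strip_pos :: "vertex \<Rightarrow> complex" where
  "strip_pos (Outer i) = Complex (i + 1/2) 1"
| "strip_pos (Inner i) = Complex i 0"
| "strip_pos Centre = 0"

definition strip_vertices :: "bool \<Rightarrow> nat \<Rightarrow> vertex set" where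
  "strip_vertices b n = Outer ` {..<n} \<union> Inner ` (if b then {..n} else {1..n})"

definition strip_edges :: "bool \<Rightarrow> nat \<Rightarrow> (vertex \<times> vertex) set" where
  "strip_edges b n = {(Outer i, Inner i) | i. i < n \<and> (i > 0 \<or> b)} \<union> {(Outer i, Inner (Suc i)) | i. i < n}
    \<union> {(Inner i, Inner (Suc i)) | i. i < n \<and> (i > 0 \<or> b)}"

lemma strip_vertices_iff [simp]:
  "Outer i \<in> strip_vertices b n \<longleftrightarrow> i < n"
  "Inner i \<in> strip_vertices b n \<longleftrightarrow> i \<le> n \<and> (i > 0 \<or> b)"
  "Centre \<notin> strip_vertices b n"
  by (auto simp: strip_vertices_def)

lemma strip_edges_iff [simp]:
  "(Outer i, v) \<in> strip_edges b n \<longleftrightarrow> i < n \<and> (v = Inner i \<and> (i > 0 \<or> b) \<or> v = Inner (Suc i))"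
  "(Inner i, v) \<in> strip_edges b n \<longleftrightarrow> i < n \<and> v = Inner (Suc i) \<and> (i > 0 \<or> b)"
  "(Centre, v) \<notin> strip_edges b n"
  by (auto simp: strip_edges_def)

lemma strip_edges_cases:
  assumes "j \<in> strip_edges b n"
  obtains i where "j = (Outer i, Inner i)" "i < n" "i > 0 \<or> b"
  | i where "j = (Outer i, Inner (Suc i))" "i < n"
  | i where "j = (Inner i, Inner (Suc i))" "i < n" "i > 0 \<or> b"
  using assms unfolding strip_edges_def by blast

lemma finite_strip: "finite (strip_vertices b n)" "finite (strip_edges b n)"
proof -
  show "finite (strip_vertices b n)" by (simp add: strip_vertices_def)
  have "strip_edges b n \<subseteq> (\<lambda>i. (Outer i, Inner i)) ` {..<n} \<union> (\<lambda>i. (Outer i, Inner (Suc i))) ` {..<n}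
    \<union> (\<lambda>i. (Inner i, Inner (Suc i))) ` {..<n}"
    by (auto simp: strip_edges_def)
  then show "finite (strip_edges b n)" by (rule finite_subset) auto
qed

lemma strip_segments:
  "z \<in> segment strip_pos (Outer i, Inner i) \<longleftrightarrow> 0 \<le> Im z \<and> Im z \<le> 1 \<and> Re z = real i + Im z / 2"
  "z \<in> segment strip_pos (Outer i, Inner (Suc i)) \<longleftrightarrow> 0 \<le> Im z \<and> Im z \<le> 1 \<and> Re z = real i + 1 - Im z / 2"
  "z \<in> segment strip_pos (Inner i, Inner (Suc i)) \<longleftrightarrow> Im z = 0 \<and> real i \<le> Re z \<and> Re z \<le> real i + 1"
proof -
  show "z \<in> segment strip_pos (Outer i, Inner i) \<longleftrightarrow> 0 \<le> Im z \<and> Im z \<le> 1 \<and> Re z = real i + Im z / 2"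
    unfolding mem_segment_iff
    by (auto simp: algebra_simps intro: exI[of _ "1 - Im z"])
  show "z \<in> segment strip_pos (Outer i, Inner (Suc i)) \<longleftrightarrow> 0 \<le> Im z \<and> Im z \<le> 1 \<and> Re z = real i + 1 - Im z / 2"
    unfolding mem_segment_iff
    by (auto simp: field_simps intro!: exI[of _ "1 - Im z"])
  show "z \<in> segment strip_pos (Inner i, Inner (Suc i)) \<longleftrightarrow> Im z = 0 \<and> real i \<le> Re z \<and> Re z \<le> real i + 1"
    unfolding mem_segment_iff
    by (auto simp: algebra_simps intro!: exI[of _ "Re z - i"])
qed

lemma drawing_strip: "straight_line_drawing strip_pos (strip_vertices b n) (strip_edges b n)"
  unfolding straight_line_drawing_def
proof (intro conjI allI impI ballI)
  show "finite (strip_vertices b n)" "finite (strip_edges b n)" by (rule finite_strip)+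
  show "inj_on strip_pos (strip_vertices b n)"
  proof
    fix v v' assume "v \<in> strip_vertices b n" "v' \<in> strip_vertices b n" "strip_pos v = strip_pos v'"
    then show "v = v'" by (cases v; cases v') auto
  qed
next
  fix k l assume kl: "(k, l) \<in> strip_edges b n"
  then show "k \<in> strip_vertices b n" "l \<in> strip_vertices b n" "k \<noteq> l" by (auto elim: strip_edges_cases)
  fix v assume v: "v \<in> strip_vertices b n" "strip_pos v \<in> segment strip_pos (k, l)"
  from kl show "v = k \<or> v = l"
  proof (cases rule: strip_edges_cases)
    case (1 i)
    then show ?thesis using v by (cases v) (auto simp: strip_segments)
  next
    case (2 i)
    then show ?thesis using v by (cases v) (auto simp: strip_segments)
  next
    case (3 i)
    show ?thesis
    proof (cases v)
      case (Inner m)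
      have "real i \<le> real m" "real m \<le> real (Suc i)" using v 3 Inner by (auto simp: strip_segments)
      then have "m = i \<or> m = Suc i" by linarith
      then show ?thesis using Inner 3 by auto
    qed (use v 3 in \<open>auto simp: strip_segments\<close>)
  qed
next
  fix j j' assume j: "j \<in> strip_edges b n" "j' \<in> strip_edges b n" "j \<noteq> j'"
  show "{fst j, snd j} \<noteq> {fst j', snd j'}"
    using j(3) by (rule contrapos_nn)
      (use j(1,2) in \<open>auto simp: doubleton_eq_iff elim!: strip_edges_cases\<close>)
  show "segment strip_pos j \<inter> segment strip_pos j' \<subseteq> strip_pos ` strip_vertices b n"
  proof
    fix z assume z: "z \<in> segment strip_pos j \<inter> segment strip_pos j'"
    have grid: "z \<in> strip_pos ` strip_vertices b n"
      if j: "j \<in> strip_edges b n" "z \<in> segment strip_pos j" and z: "Im z = 1 \<or> Im z = 0 \<and> Re z \<in> \<int>" for j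
    proof -
      have outer: "strip_pos (Outer i) = z" if "Im z = 1" "Re z = i + 1/2" for i
        using that by (simp add: complex_eq_iff)
      have inner: "strip_pos (Inner i) = z" if "Im z = 0" "Re z = i" for i
        using that by (simp add: complex_eq_iff)
      from j(1) show ?thesis
      proof (cases rule: strip_edges_cases)
        case (1 i)
        then show ?thesis using z j(2) outer[of i] inner[of i]
          by (auto simp: strip_segments intro!: image_eqI[of _ _ "if Im z = 1 then Outer i else Inner i"])
      next
        case (2 i)
        then show ?thesis using z j(2) outer[of i] inner[of "Suc i"]
          by (auto simp: strip_segments intro!: image_eqI[of _ _ "if Im z = 1 then Outer i else Inner (Suc i)"])
      next
        case (3 i)
        then have "Im z = 0" "Re z \<in> \<int>" "real i \<le> Re z" "Re z \<le> real i + 1" using z j(2) by (auto simp: strip_segments)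
        then obtain m :: int where m: "Re z = m" "int i \<le> m" "m \<le> int i + 1" by (auto elim!: Ints_cases)
        then have "m = int i \<or> m = int (Suc i)" by linarith
        then have "Re z = real i \<or> Re z = real (Suc i)" using m(1) by auto
        then show ?thesis using 3 inner[of i] inner[of "Suc i"] \<open>Im z = 0\<close>
          by (auto intro!: image_eqI[of _ _ "if Re z = real i then Inner i else Inner (Suc i)"])
      qed
    qed
    have cross: "Im z = 1 \<or> Im z = 0 \<and> Re z \<in> \<int>"
      if "Re z = real i + Im z / 2" "Re z = real k + 1 - Im z / 2" "0 \<le> Im z" "Im z \<le> 1" for i k
    proof -
      have "real i \<le> real k + 1" "real k + 1 \<le> real i + 1" using that by linarith+
      then have "i = k \<or> i = k + 1" by linarith
      then show ?thesis
      proof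
        assume "i = k"
        then show ?thesis using that by simp
      next
        assume "i = k + 1"
        then have "Im z = 0" "Re z = of_nat i" using that by simp_all
        then show ?thesis by simp
      qed
    qed
    have base: "Re z \<in> \<int>" if "real i \<le> Re z" "Re z \<le> real i + 1" "real k \<le> Re z" "Re z \<le> real k + 1" "i \<noteq> k" for i k
    proof -
      have "Re z = real i \<or> Re z = real k" using that by linarith
      then show ?thesis by auto
    qed
    have "Im z = 1 \<or> Im z = 0 \<and> Re z \<in> \<int>"
    proof -
      from j(1) show ?thesis
      proof (cases rule: strip_edges_cases)
        case (1 i)
        from j(2) show ?thesis
        proof (cases rule: strip_edges_cases)
          case (2 k)
          then show ?thesis using 1 z by (intro cross[of i k]) (simp_all add: strip_segments)
        qed (use 1 j(3) z in \<open>auto simp: strip_segments\<close>)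
      next
        case (2 i)
        from j(2) show ?thesis
        proof (cases rule: strip_edges_cases)
          case (1 k)
          then show ?thesis using 2 z by (intro cross[of k i]) (simp_all add: strip_segments)
        next
          case (3 k)
          then have "Im z = 0" "Re z = of_nat (Suc i)" using 2 z by (auto simp: strip_segments)
          then show ?thesis by (metis Ints_of_nat)
        qed (use 2 j(3) z in \<open>auto simp: strip_segments\<close>)
      next
        case (3 i)
        from j(2) show ?thesis
        proof (cases rule: strip_edges_cases)
          case (2 k)
          then have "Im z = 0" "Re z = of_nat (Suc k)" using 3 z by (auto simp: strip_segments)
          then show ?thesis by (metis Ints_of_nat)
        qed (use 3 j(3) z base[of i] in \<open>auto simp: strip_segments\<close>)
      qed
    qed
    then show "z \<in> strip_pos ` strip_vertices b n" using grid[OF j(1)] z by blast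
  qed
qed

text \<open>
  Whether the vertex \<open>Inner i\<close> of the lower row is matched to its left in the matching that misses the external nodes in
  \<open>S\<close>. A missing corner counts as matched. This bit is carried along the strip:
  a present external node passes it on and a removed one inverts it, so that it records the parity of
  the number of nodes removed so far.
\<close>

definition strip_used :: "bool \<Rightarrow> nat set \<Rightarrow> nat \<Rightarrow> bool" where
  "strip_used b S i \<longleftrightarrow> (b = odd (card (S \<inter> {..<i})))"

lemma strip_used_0 [simp]: "strip_used b S 0 \<longleftrightarrow> \<not> b"
  by (simp add: strip_used_def)

lemma strip_used_Suc [simp]: "strip_used b S (Suc i) \<longleftrightarrow> strip_used b S i \<noteq> (i \<in> S)"
proof (cases "i \<in> S")
  case True
  then have "S \<inter> {..<Suc i} = insert i (S \<inter> {..<i})" by auto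
  then show ?thesis using True by (auto simp: strip_used_def)
next
  case False
  then have "S \<inter> {..<Suc i} = S \<inter> {..<i}" by (auto simp: less_Suc_eq)
  then show ?thesis using False by (simp add: strip_used_def)
qed

definition strip_matching :: "bool \<Rightarrow> nat \<Rightarrow> nat set \<Rightarrow> (vertex \<times> vertex) set" where
  "strip_matching b n S =
    {(Outer i, if strip_used b S i then Inner (Suc i) else Inner i) | i. i < n \<and> i \<notin> S} \<union>
    {(Inner i, Inner (Suc i)) | i. i < n \<and> i \<in> S \<and> \<not> strip_used b S i}"

lemma strip_matching_iff [simp]:
  "(Outer i, v) \<in> strip_matching b n S \<longleftrightarrow>
    i < n \<and> i \<notin> S \<and> v = (if strip_used b S i then Inner (Suc i) else Inner i)"
  "(Inner i, v) \<in> strip_matching b n S \<longleftrightarrow> i < n \<and> i \<in> S \<and> \<not> strip_used b S i \<and> v = Inner (Suc i)"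
  "(Centre, v) \<notin> strip_matching b n S"
  by (auto simp: strip_matching_def)

lemma ex1_pairI:
  assumes "(k, l) \<in> N" "v = k \<or> v = l"
    and "\<And>k' l'. (k', l') \<in> N \<Longrightarrow> v = k' \<or> v = l' \<Longrightarrow> k' = k \<and> l' = l"
  shows "\<exists>!j. j \<in> N \<and> (v = fst j \<or> v = snd j)"
proof (rule ex1I[of _ "(k, l)"])
  show "(k, l) \<in> N \<and> (v = fst (k, l) \<or> v = snd (k, l))" using assms(1,2) by simp
  fix j assume "j \<in> N \<and> (v = fst j \<or> v = snd j)"
  then show "j = (k, l)" using assms(3)[of "fst j" "snd j"] by (cases j) auto
qed

lemma covers_exactly_strip_matching:
  assumes used: "strip_used b S n"
  shows "covers_exactly (strip_vertices b n) (Outer ` S) (strip_matching b n S)"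
  unfolding covers_exactly_def
proof
  fix v assume v: "v \<in> strip_vertices b n"
  let ?N = "strip_matching b n S"
  show "if v \<in> Outer ` S then \<forall>j\<in>?N. v \<noteq> fst j \<and> v \<noteq> snd j else \<exists>!j. j \<in> ?N \<and> (v = fst j \<or> v = snd j)"
  proof (cases v)
    case (Outer i)
    then have i: "i < n" using v by simp
    show ?thesis
    proof (cases "i \<in> S")
      case True
      have "v \<noteq> k \<and> v \<noteq> l" if "(k, l) \<in> ?N" for k l
        using that True Outer by (cases k) (auto split: if_splits)
      then have "\<forall>j\<in>?N. v \<noteq> fst j \<and> v \<noteq> snd j" by (metis prod.collapse)
      then show ?thesis using True Outer by simp
    next
      case False
      have "\<exists>!j. j \<in> ?N \<and> (v = fst j \<or> v = snd j)"
      proof (rule ex1_pairI[of v "if strip_used b S i then Inner (Suc i) else Inner i"])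
        fix k l assume "(k, l) \<in> ?N" "v = k \<or> v = l"
        then show "k = v \<and> l = (if strip_used b S i then Inner (Suc i) else Inner i)"
          using Outer by (cases k) (auto split: if_splits)
      qed (use Outer False i in auto)
      then show ?thesis using False Outer by auto
    qed
  next
    case (Inner i)
    then have i: "i \<le> n" "i > 0 \<or> b" using v by auto
    have "\<exists>!j. j \<in> ?N \<and> (v = fst j \<or> v = snd j)"
    proof (cases "strip_used b S i")
      case True
      then obtain k where k: "i = Suc k" using i by (cases i) auto
      show ?thesis
      proof (rule ex1_pairI[of "if k \<in> S then Inner k else Outer k" v])
        fix k' l' assume "(k', l') \<in> ?N" "v = k' \<or> v = l'"
        then show "k' = (if k \<in> S then Inner k else Outer k) \<and> l' = v"
          using Inner k True by (cases k') (auto split: if_splits)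
      qed (use Inner k True i in auto)
    next
      case False
      then have "i < n" using used i(1) by (cases "i = n") auto
      show ?thesis
      proof (rule ex1_pairI[of "if i \<in> S then v else Outer i" "if i \<in> S then Inner (Suc i) else v"])
        fix k' l' assume "(k', l') \<in> ?N" "v = k' \<or> v = l'"
        then show "k' = (if i \<in> S then v else Outer i) \<and> l' = (if i \<in> S then Inner (Suc i) else v)"
          using Inner False by (cases k') (auto split: if_splits)
      qed (use Inner \<open>i < n\<close> False in auto)
    qed
    then show ?thesis using Inner by auto
  qed (use v in simp)
qed

text \<open>
  The matching is forced from left to right. If \<open>Inner i\<close> is already matched to its left, then
  \<open>Outer i\<close>, if present, must be matched to \<open>Inner (i + 1)\<close>. Otherwise \<open>Inner i\<close> must be matched to
  \<open>Outer i\<close>, if present, or else to \<open>Inner (i + 1)\<close>. The last vertex has to be matched to its left.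
\<close>

lemma strip_matching_unique:
  assumes N: "N \<subseteq> strip_edges b n" and cov: "covers_exactly (strip_vertices b n) (Outer ` S) N"
  shows "strip_used b S n \<and> N = strip_matching b n S"
proof -
  let ?L = "\<lambda>i. (Outer i, Inner i) \<in> N" and ?R = "\<lambda>i. (Outer i, Inner (Suc i)) \<in> N"
    and ?B = "\<lambda>i. (Inner i, Inner (Suc i)) \<in> N"
  \<comment> \<open>\<open>Inner i\<close> is matched to its left or is the missing corner.\<close>
  let ?from_left = "\<lambda>i. (i = 0 \<and> \<not> b) \<or> (\<exists>k. i = Suc k \<and> (?R k \<or> ?B k))"
  have edge: "?L i \<Longrightarrow> i < n \<and> (i > 0 \<or> b)" "?R i \<Longrightarrow> i < n" "?B i \<Longrightarrow> i < n \<and> (i > 0 \<or> b)" for i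
    using N by (auto dest!: subsetD)
  have removed: "\<not> ?L i" "\<not> ?R i" if "i < n" "i \<in> S" for i
    using covers_exactlyD(1)[OF cov, of "Outer i"] that by force+
  have outer: "?L i \<or> ?R i" if i: "i < n" "i \<notin> S" for i
  proof -
    have "Outer i \<in> strip_vertices b n" "Outer i \<notin> Outer ` S" using i by auto
    then obtain j where j: "j \<in> N" "Outer i = fst j \<or> Outer i = snd j"
      using covers_exactlyD(2)[OF cov] by blast
    then have "j \<in> strip_edges b n" using N by blast
    then show ?thesis using j by (cases rule: strip_edges_cases) auto
  qed
  have outer1: "\<not> (?L i \<and> ?R i)" if "i < n" for i
    using covers_exactlyD(3)[OF cov, of "Outer i" "(Outer i, Inner i)" "(Outer i, Inner (Suc i))"] that by auto
  have inner: "?from_left i \<or> ?L i \<or> ?B i" if i: "i \<le> n" for i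
  proof (cases "i = 0 \<and> \<not> b")
    case False
    then have "Inner i \<in> strip_vertices b n" "Inner i \<notin> Outer ` S" using i by auto
    then obtain j where j: "j \<in> N" "Inner i = fst j \<or> Inner i = snd j"
      using covers_exactlyD(2)[OF cov] by blast
    then have "j \<in> strip_edges b n" using N by blast
    then show ?thesis using j by (cases rule: strip_edges_cases) auto
  qed simp
  have inner1: "j = j'" if "i \<le> n" "i > 0 \<or> b" "j \<in> N" "j' \<in> N" "Inner i = fst j \<or> Inner i = snd j"
      "Inner i = fst j' \<or> Inner i = snd j'" for i j j'
    using covers_exactlyD(3)[OF cov, of "Inner i" j j'] that by auto
  have not_LB: "\<not> ?L i \<and> \<not> ?B i" if i: "?from_left i" "i \<le> n" for i
  proof (cases "i = 0 \<and> \<not> b")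
    case True
    then show ?thesis using edge by blast
  next
    case False
    then obtain k where k: "i = Suc k" "?R k \<or> ?B k" using i by blast
    then show ?thesis using inner1[of i _ "(Outer i, Inner i)"] inner1[of i _ "(Inner i, Inner (Suc i))"] i(2)
      by fastforce
  qed
  have not_both: "\<not> (?L i \<and> ?B i)" if "i < n" for i
    using inner1[of i "(Outer i, Inner i)" "(Inner i, Inner (Suc i))"] that edge(1)[of i] by auto
  have not_RB: "\<not> (?R i \<and> ?B i)" if "i < n" for i
    using inner1[of "Suc i" "(Outer i, Inner (Suc i))" "(Inner i, Inner (Suc i))"] that by auto
  have step: "(?L i \<longleftrightarrow> i \<notin> S \<and> \<not> strip_used b S i) \<and> (?R i \<longleftrightarrow> i \<notin> S \<and> strip_used b S i) \<and>
      (?B i \<longleftrightarrow> i \<in> S \<and> \<not> strip_used b S i)" if "?from_left i \<longleftrightarrow> strip_used b S i" "i < n" for i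
    using that inner[of i] not_LB[of i] not_both[of i] not_RB[of i] outer[of i] outer1[of i] removed[of i]
    by (cases "i \<in> S"; cases "strip_used b S i") (meson less_imp_le)+
  have used: "?from_left i \<longleftrightarrow> strip_used b S i" if "i \<le> n" for i
    using that
  proof (induction i)
    case 0
    show ?case by simp
  next
    case (Suc i)
    then have "i < n" "?from_left i \<longleftrightarrow> strip_used b S i" by auto
    from step[OF this(2,1)] show ?case by auto
  qed
  have "strip_used b S n"
    using used[of n] inner[of n] edge[of n] by auto
  moreover have "j \<in> N \<longleftrightarrow> j \<in> strip_matching b n S" for j
  proof
    assume j: "j \<in> N"
    then have "j \<in> strip_edges b n" using N by blast
    then show "j \<in> strip_matching b n S"
    proof (cases rule: strip_edges_cases)
      case (1 i)
      then show ?thesis using step[OF used[of i]] j by auto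
    next
      case (2 i)
      then show ?thesis using step[OF used[of i]] j by auto
    next
      case (3 i)
      then show ?thesis using step[OF used[of i]] j by auto
    qed
  next
    assume "j \<in> strip_matching b n S"
    then consider i where "i < n" "i \<notin> S" "j = (Outer i, if strip_used b S i then Inner (Suc i) else Inner i)"
      | i where "i < n" "i \<in> S" "\<not> strip_used b S i" "j = (Inner i, Inner (Suc i))"
      unfolding strip_matching_def by blast
    then show "j \<in> N"
    proof cases
      case (1 i)
      then show ?thesis using step[OF used[of i]] by (cases "strip_used b S i") auto
    next
      case (2 i)
      then show ?thesis using step[OF used[of i]] by auto
    qed
  qed
  ultimately show ?thesis by blast
qed

lemma strip_matchings:
  "{N. N \<subseteq> strip_edges b n \<and> covers_exactly (strip_vertices b n) (Outer ` S) N}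
    = (if strip_used b S n then {strip_matching b n S} else {})"
proof -
  have "j \<in> strip_edges b n" if "j \<in> strip_matching b n S" for j
  proof (cases j)
    case (Pair k l)
    have "i > 0 \<or> b" if "\<not> strip_used b S i" for i using that by (cases i) auto
    then show ?thesis using that Pair by (cases k) (auto split: if_splits)
  qed
  then have sub: "strip_matching b n S \<subseteq> strip_edges b n" by blast
  show ?thesis
  proof (intro set_eqI iffI)
    fix N assume "N \<in> {N. N \<subseteq> strip_edges b n \<and> covers_exactly (strip_vertices b n) (Outer ` S) N}"
    then have "strip_used b S n \<and> N = strip_matching b n S" by (intro strip_matching_unique) blast+
    then show "N \<in> (if strip_used b S n then {strip_matching b n S} else {})" by simp
  next
    fix N assume "N \<in> (if strip_used b S n then {strip_matching b n S} else {})"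
    then have N: "strip_used b S n" "N = strip_matching b n S" by (simp_all split: if_splits)
    show "N \<in> {N. N \<subseteq> strip_edges b n \<and> covers_exactly (strip_vertices b n) (Outer ` S) N}"
      unfolding N(2) using sub covers_exactly_strip_matching[OF N(1)] by blast
  qed
qed

lemma matchgate_signature_strip:
  assumes "\<And>S. S \<subseteq> {..<n} \<Longrightarrow>
    f (indicator_string n S) = (if b = odd (card S) then prod w (strip_matching b n S) else 0)"
  shows "matchgate_signature n f"
proof (rule matchgate_signature_drawing[where h = 1 and ext = Outer and w = w])
  show "straight_line_drawing strip_pos (strip_vertices b n) (strip_edges b n)" by (rule drawing_strip)
  show "Im (strip_pos v) \<le> 1" for v by (cases v) auto
  fix S assume S: "S \<subseteq> {..<n}"
  then have "S \<inter> {..<n} = S" by blast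
  then have "strip_used b S n \<longleftrightarrow> (b = odd (card S))" by (simp add: strip_used_def)
  then show "f (indicator_string n S) =
      (\<Sum>N | N \<subseteq> strip_edges b n \<and> covers_exactly (strip_vertices b n) (Outer ` S) N. prod w N)"
    unfolding strip_matchings using assms[OF S] by simp
qed auto

section \<open>A spider\<close>

text \<open>
  Legs \<open>Outer i\<close> -- \<open>Inner i\<close> that are joined by spokes from \<open>Inner i\<close> to a centre. Removing \<open>Outer i\<close> forces the
  spoke of \<open>i\<close> into the matching, and the centre admits exactly one spoke. Without the centre no node may be removed.
\<close>

fun spider_pos :: "vertex \<Rightarrow> complex" where
  "spider_pos (Outer i) = Complex i 2"
| "spider_pos (Inner i) = Complex i 1"
| "spider_pos Centre = 0"

definition spider_vertices :: "bool \<Rightarrow> nat \<Rightarrow> vertex set" where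
  "spider_vertices b n = Outer ` {..<n} \<union> Inner ` {..<n} \<union> (if b then {Centre} else {})"

definition spider_edges :: "bool \<Rightarrow> nat \<Rightarrow> (vertex \<times> vertex) set" where
  "spider_edges b n = {(Outer i, Inner i) | i. i < n} \<union> {(Inner i, Centre) | i. i < n \<and> b}"

lemma spider_vertices_iff [simp]:
  "Outer i \<in> spider_vertices b n \<longleftrightarrow> i < n" "Inner i \<in> spider_vertices b n \<longleftrightarrow> i < n"
  "Centre \<in> spider_vertices b n \<longleftrightarrow> b"
  by (auto simp: spider_vertices_def)

lemma spider_edges_iff [simp]:
  "(Outer i, v) \<in> spider_edges b n \<longleftrightarrow> i < n \<and> v = Inner i"
  "(Inner i, v) \<in> spider_edges b n \<longleftrightarrow> i < n \<and> b \<and> v = Centre"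
  "(Centre, v) \<notin> spider_edges b n"
  by (auto simp: spider_edges_def)

lemma spider_edges_cases:
  assumes "j \<in> spider_edges b n"
  obtains i where "j = (Outer i, Inner i)" "i < n" | i where "j = (Inner i, Centre)" "i < n" "b"
  using assms unfolding spider_edges_def by blast

lemma spider_segments:
  "z \<in> segment spider_pos (Outer i, Inner i) \<longleftrightarrow> 1 \<le> Im z \<and> Im z \<le> 2 \<and> Re z = real i"
  "z \<in> segment spider_pos (Inner i, Centre) \<longleftrightarrow> 0 \<le> Im z \<and> Im z \<le> 1 \<and> Re z = real i * Im z"
proof -
  show "z \<in> segment spider_pos (Outer i, Inner i) \<longleftrightarrow> 1 \<le> Im z \<and> Im z \<le> 2 \<and> Re z = real i"
    unfolding mem_segment_iff
    by (auto simp: algebra_simps intro: exI[of _ "2 - Im z"])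
  show "z \<in> segment spider_pos (Inner i, Centre) \<longleftrightarrow> 0 \<le> Im z \<and> Im z \<le> 1 \<and> Re z = real i * Im z"
  proof
    assume "z \<in> segment spider_pos (Inner i, Centre)"
    then obtain t where t: "0 \<le> t" "t \<le> 1" "Re z = (1 - t) * real i" "Im z = 1 - t"
      unfolding mem_segment_iff by auto
    then show "0 \<le> Im z \<and> Im z \<le> 1 \<and> Re z = real i * Im z" by simp
  next
    assume "0 \<le> Im z \<and> Im z \<le> 1 \<and> Re z = real i * Im z"
    then show "z \<in> segment spider_pos (Inner i, Centre)"
      unfolding mem_segment_iff by (intro exI[of _ "1 - Im z"]) simp
  qed
qed

lemma drawing_spider: "straight_line_drawing spider_pos (spider_vertices b n) (spider_edges b n)"
  unfolding straight_line_drawing_def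
proof (intro conjI allI impI ballI)
  show "finite (spider_vertices b n)" by (simp add: spider_vertices_def)
  have "spider_edges b n \<subseteq> (\<lambda>i. (Outer i, Inner i)) ` {..<n} \<union> (\<lambda>i. (Inner i, Centre)) ` {..<n}"
    by (auto simp: spider_edges_def)
  then show "finite (spider_edges b n)" by (rule finite_subset) auto
  show "inj_on spider_pos (spider_vertices b n)"
  proof
    fix v v' assume "spider_pos v = spider_pos v'"
    then show "v = v'" by (cases v; cases v') (auto simp: complex_eq_iff)
  qed
next
  fix k l assume kl: "(k, l) \<in> spider_edges b n"
  then show "k \<in> spider_vertices b n" "l \<in> spider_vertices b n" "k \<noteq> l" by (auto elim: spider_edges_cases)
  fix v assume v: "v \<in> spider_vertices b n" "spider_pos v \<in> segment spider_pos (k, l)"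
  from kl show "v = k \<or> v = l"
    by (cases rule: spider_edges_cases) (use v in \<open>cases v, auto simp: spider_segments\<close>)+
next
  fix j j' assume j: "j \<in> spider_edges b n" "j' \<in> spider_edges b n" "j \<noteq> j'"
  show "{fst j, snd j} \<noteq> {fst j', snd j'}"
    using j(3) by (rule contrapos_nn)
      (use j(1,2) in \<open>auto simp: doubleton_eq_iff elim!: spider_edges_cases\<close>)
  show "segment spider_pos j \<inter> segment spider_pos j' \<subseteq> spider_pos ` spider_vertices b n"
  proof
    fix z assume z: "z \<in> segment spider_pos j \<inter> segment spider_pos j'"
    have centre: "z \<in> spider_pos ` spider_vertices b n" if "Im z = 0" "Re z = 0" b
      using that by (auto simp: complex_eq_iff intro!: image_eqI[of _ _ Centre])
    have inner: "z \<in> spider_pos ` spider_vertices b n" if "Im z = 1" "Re z = real i" "i < n" for i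
      using that by (auto simp: complex_eq_iff intro!: image_eqI[of _ _ "Inner i"])
    from j(1) show "z \<in> spider_pos ` spider_vertices b n"
    proof (cases rule: spider_edges_cases)
      case (1 i)
      from j(2) show ?thesis
      proof (cases rule: spider_edges_cases)
        case (2 k)
        then show ?thesis using 1 z by (intro inner[of i]) (simp_all add: spider_segments)
      qed (use 1 j(3) z in \<open>auto simp: spider_segments\<close>)
    next
      case (2 i)
      from j(2) show ?thesis
      proof (cases rule: spider_edges_cases)
        case (1 k)
        then show ?thesis using 2 z by (intro inner[of k]) (simp_all add: spider_segments)
      next
        case (2 k)
        have "real i * Im z = real k * Im z" "i \<noteq> k"
          using 2 \<open>j = (Inner i, Centre)\<close> j(3) z by (auto simp: spider_segments)
        then have "Im z = 0" by simp
        moreover have "Re z = real i * Im z" using \<open>j = (Inner i, Centre)\<close> z by (auto simp: spider_segments)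
        ultimately show ?thesis using centre \<open>b\<close> by simp
      qed
    qed
  qed
qed

definition spider_matching :: "nat \<Rightarrow> nat set \<Rightarrow> (vertex \<times> vertex) set" where
  "spider_matching n S = {(Outer i, Inner i) | i. i < n \<and> i \<notin> S} \<union> {(Inner i, Centre) | i. i < n \<and> i \<in> S}"

lemma spider_matching_iff [simp]:
  "(Outer i, v) \<in> spider_matching n S \<longleftrightarrow> i < n \<and> i \<notin> S \<and> v = Inner i"
  "(Inner i, v) \<in> spider_matching n S \<longleftrightarrow> i < n \<and> i \<in> S \<and> v = Centre"
  "(Centre, v) \<notin> spider_matching n S"
  by (auto simp: spider_matching_def)

lemma spider_matchings:
  assumes S: "S \<subseteq> {..<n}"
  shows "{N. N \<subseteq> spider_edges b n \<and> covers_exactly (spider_vertices b n) (Outer ` S) N}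
    = (if card S = of_bool b then {spider_matching n S} else {})"
proof -
  have finS: "finite S" using S finite_subset by blast
  have unique: "card S = of_bool b \<and> N = spider_matching n S"
    if N: "N \<subseteq> spider_edges b n" and cov: "covers_exactly (spider_vertices b n) (Outer ` S) N" for N
  proof -
    let ?L = "\<lambda>i. (Outer i, Inner i) \<in> N" and ?C = "\<lambda>i. (Inner i, Centre) \<in> N"
    have leg: "?L i \<longleftrightarrow> i \<notin> S" if i: "i < n" for i
    proof
      show "i \<notin> S" if "?L i"
        using covers_exactlyD(1)[OF cov, of "Outer i" "(Outer i, Inner i)"] that i by auto
      assume "i \<notin> S"
      then have "Outer i \<in> spider_vertices b n" "Outer i \<notin> Outer ` S" using i by auto
      then obtain j where j: "j \<in> N" "Outer i = fst j \<or> Outer i = snd j"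
        using covers_exactlyD(2)[OF cov] by blast
      then have "j \<in> spider_edges b n" using N by blast
      then show "?L i" using j by (cases rule: spider_edges_cases) auto
    qed
    have spoke: "?C i \<longleftrightarrow> i \<in> S" if i: "i < n" for i
    proof
      show "i \<in> S" if "?C i"
        using covers_exactlyD(3)[OF cov, of "Inner i" "(Outer i, Inner i)" "(Inner i, Centre)"] that i leg[OF i] by auto
      assume "i \<in> S"
      have "Inner i \<in> spider_vertices b n" "Inner i \<notin> Outer ` S" using i by auto
      then obtain j where j: "j \<in> N" "Inner i = fst j \<or> Inner i = snd j"
        using covers_exactlyD(2)[OF cov] by blast
      then have "j \<in> spider_edges b n" using N by blast
      then show "?C i" using j leg[OF i] \<open>i \<in> S\<close> by (cases rule: spider_edges_cases) auto
    qed
    have eq: "N = spider_matching n S"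
    proof (intro set_eqI iffI)
      fix j assume j: "j \<in> N"
      then have "j \<in> spider_edges b n" using N by blast
      then show "j \<in> spider_matching n S" using j leg spoke by (cases rule: spider_edges_cases) auto
    next
      fix j assume "j \<in> spider_matching n S"
      then show "j \<in> N" using leg spoke by (auto simp: spider_matching_def)
    qed
    have "card S = of_bool b"
    proof (cases b)
      case True
      then have "Centre \<in> spider_vertices b n" "Centre \<notin> Outer ` S" by auto
      then obtain j where j: "j \<in> N" "Centre = fst j \<or> Centre = snd j"
        using covers_exactlyD(2)[OF cov] by blast
      then have "j \<in> spider_edges b n" using N by blast
      then obtain i where i: "j = (Inner i, Centre)" "i < n" using j by (cases rule: spider_edges_cases) auto
      have "k = i" if "k \<in> S" for k
        using covers_exactlyD(3)[OF cov, of Centre j "(Inner k, Centre)"] that i j(1) spoke[of k] S True by auto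
      moreover have "i \<in> S" using spoke[OF i(2)] i(1) j(1) by simp
      ultimately have "S = {i}" by blast
      then show ?thesis using True by simp
    next
      case False
      have "i \<notin> S" for i
      proof
        assume "i \<in> S"
        then have "(Inner i, Centre) \<in> spider_edges b n" using spoke[of i] S N by blast
        then show False using False by simp
      qed
      then have "S = {}" by blast
      then show ?thesis using False by simp
    qed
    with eq show ?thesis by blast
  qed
  have exists: "spider_matching n S \<subseteq> spider_edges b n \<and>
      covers_exactly (spider_vertices b n) (Outer ` S) (spider_matching n S)" if card: "card S = of_bool b"
  proof
    have b: "b" if "i \<in> S" for i using that card finS by (cases b) auto
    show "spider_matching n S \<subseteq> spider_edges b n"
      using b by (auto simp: spider_matching_def)
    show "covers_exactly (spider_vertices b n) (Outer ` S) (spider_matching n S)" unfolding covers_exactly_def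
    proof
      fix v assume v: "v \<in> spider_vertices b n"
      let ?N = "spider_matching n S"
      show "if v \<in> Outer ` S then \<forall>j\<in>?N. v \<noteq> fst j \<and> v \<noteq> snd j else \<exists>!j. j \<in> ?N \<and> (v = fst j \<or> v = snd j)"
      proof (cases v)
        case (Outer i)
        show ?thesis
        proof (cases "i \<in> S")
          case True
          then show ?thesis using Outer by (auto simp: spider_matching_def)
        next
          case False
          have "\<exists>!j. j \<in> ?N \<and> (v = fst j \<or> v = snd j)"
            by (rule ex1_pairI[of v "Inner i"]) (use Outer False v in \<open>auto simp: spider_matching_def\<close>)
          then show ?thesis using False Outer by auto
        qed
      next
        case (Inner i)
        have "\<exists>!j. j \<in> ?N \<and> (v = fst j \<or> v = snd j)"
        proof (cases "i \<in> S")
          case True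
          show ?thesis
            by (rule ex1_pairI[of v Centre]) (use Inner True v in \<open>auto simp: spider_matching_def\<close>)
        next
          case False
          show ?thesis
            by (rule ex1_pairI[of "Outer i" v]) (use Inner False v in \<open>auto simp: spider_matching_def\<close>)
        qed
        then show ?thesis using Inner by auto
      next
        case Centre
        then have b using v by simp
        then obtain i where i: "S = {i}" using card by (auto simp: card_1_singleton_iff)
        have "\<exists>!j. j \<in> ?N \<and> (v = fst j \<or> v = snd j)"
          by (rule ex1_pairI[of "Inner i" v]) (use Centre i S in \<open>auto simp: spider_matching_def\<close>)
        then show ?thesis using Centre by auto
      qed
    qed
  qed
  show ?thesis
  proof (intro set_eqI iffI)
    fix N assume "N \<in> {N. N \<subseteq> spider_edges b n \<and> covers_exactly (spider_vertices b n) (Outer ` S) N}"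
    then have "card S = of_bool b \<and> N = spider_matching n S" by (intro unique) blast+
    then show "N \<in> (if card S = of_bool b then {spider_matching n S} else {})" by simp
  next
    fix N assume "N \<in> (if card S = of_bool b then {spider_matching n S} else {})"
    then have N: "card S = of_bool b" "N = spider_matching n S" by (simp_all split: if_splits)
    show "N \<in> {N. N \<subseteq> spider_edges b n \<and> covers_exactly (spider_vertices b n) (Outer ` S) N}"
      unfolding N(2) using exists[OF N(1)] by blast
  qed
qed

lemma matchgate_signature_spider:
  assumes "\<And>S. S \<subseteq> {..<n} \<Longrightarrow> f (indicator_string n S) = (if card S = of_bool b then 1 else 0)"
  shows "matchgate_signature n f"
proof (rule matchgate_signature_drawing[where h = 2 and ext = Outer and w = "\<lambda>_. 1"])
  show "straight_line_drawing spider_pos (spider_vertices b n) (spider_edges b n)" by (rule drawing_spider)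
  show "Im (spider_pos v) \<le> 2" for v by (cases v) auto
  fix S assume S: "S \<subseteq> {..<n}"
  show "f (indicator_string n S) =
      (\<Sum>N | N \<subseteq> spider_edges b n \<and> covers_exactly (spider_vertices b n) (Outer ` S) N. \<Prod>j\<in>N. 1)"
    unfolding spider_matchings[OF S] using assms[OF S] by simp
qed auto

section \<open>The realization theorem\<close>

lemma matchgate_signature_even: "matchgate_signature n (sym_sig (even_sig n))"
  by (rule matchgate_signature_strip[where b = False and w = "\<lambda>_. 1"])
    (simp add: sym_sig_indicator even_sig_nth card_le_arity)

lemma matchgate_signature_odd: "matchgate_signature n (sym_sig (odd_sig n))"
  by (rule matchgate_signature_strip[where b = True and w = "\<lambda>_. 1"])
    (simp add: sym_sig_indicator odd_sig_nth card_le_arity)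

lemma matchgate_signature_one: "matchgate_signature n (sym_sig (one_sig n))"
  by (rule matchgate_signature_spider[where b = True])
    (simp add: sym_sig_indicator one_sig_nth card_le_arity)

lemma matchgate_signature_pin: "matchgate_signature n (sym_sig (pin_sig n))"
  by (rule matchgate_signature_spider[where b = False])
    (simp add: sym_sig_indicator pin_sig_nth card_le_arity)

text \<open>
  In the strip with two external nodes and no corner, two edges of the zigzag form the matching
  for the empty set, and the single edge of the lower row is the matching for the full set. The two matchings share no edge, so
  their weights can be prescribed.
\<close>

lemma matchgate_signature_binary_diagonal: "matchgate_signature 2 (sym_sig [p, 0, q])"
proof -
  let ?w = "\<lambda>j. if j = (Outer 0, Inner 1) then p else if j = (Inner 1, Inner 2) then q else 1"
  show ?thesis
  proof (rule matchgate_signature_strip[where b = False and w = ?w])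
    fix S :: "nat set" assume S: "S \<subseteq> {..<2}"
    have lt: "i < 2 \<longleftrightarrow> i = 0 \<or> i = 1" for i :: nat by auto
    have "{..<2} = {0, 1 :: nat}" by auto
    then have "S \<in> Pow {0, 1}" using S by simp
    then consider "S = {}" | "S = {0}" | "S = {1}" | "S = {0, 1}" by (auto simp: Pow_insert)
    then show "sym_sig [p, 0, q] (indicator_string 2 S)
      = (if False = odd (card S) then prod ?w (strip_matching False 2 S) else 0)"
    proof cases
      case 1
      have "strip_matching False 2 S = {(Outer 0, Inner 1), (Outer 1, Inner 2)}"
        unfolding strip_matching_def lt by (auto simp: 1 strip_used_def numeral_2_eq_2)
      then show ?thesis using 1 S by (simp add: sym_sig_indicator)
    next
      case 4
      have "strip_matching False 2 S = {(Inner 1, Inner 2)}"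
        unfolding strip_matching_def lt by (auto simp: 4 numeral_2_eq_2)
      then show ?thesis using 4 S by (simp add: sym_sig_indicator)
    qed (use S in \<open>simp_all add: sym_sig_indicator\<close>)
  qed
qed

lemma binary_matchgates_diagonal: "[p, 0, q] \<in> binary_matchgates"
  by (simp add: binary_matchgates_def matchgate_signature_binary_diagonal)

lemma binary_matchgates_flip: "[0, 1, 0] \<in> binary_matchgates"
proof -
  have "odd_sig 2 = [0, 1, 0]" by (simp add: odd_sig_def numeral_2_eq_2)
  then show ?thesis using matchgate_signature_odd[of 2] by (simp add: binary_matchgates_def)
qed

theorem theorem28:
  shows "\<exists>C::nat. \<forall>(n::nat) (F'::signature). permutable_matchgate_signature n F' \<longrightarrow>
    (\<exists>h. length h = Suc n \<and> matchgate_signature n (sym_sig h) \<and>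
       realized_up_to_const n F' h binary_matchgates (C * n)) \<and>
    (\<forall>F. normalization n F' F \<longrightarrow>
       (pinning_type n F \<longrightarrow>
          matchgate_signature n (sym_sig (pin_sig n)) \<and>
          realized_up_to_const n F' (pin_sig n) (binary_matchgates \<inter> {[0, 1, 0]}) (C * n)) \<and>
       (parity_type n F \<longrightarrow>
          (\<exists>h \<in> {even_sig n, odd_sig n}.
             matchgate_signature n (sym_sig h) \<and>
             realized_up_to_const n F' h
               (binary_matchgates \<inter> ({[1, 0, y] | y. True} \<union> {[0, 0, 1]})) (C * n))) \<and>
       (matching_type n F \<and> \<not> pinning_type n F \<and> \<not> parity_type n F \<longrightarrow>
          matchgate_signature n (sym_sig (one_sig n)) \<and>
          realized_up_to_const n F' (one_sig n)
            (binary_matchgates \<inter> ({[1, 0, y] | y. True} \<union> {[0, 1, 0]})) (C * n)))"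
proof (rule exI[of _ 2], intro allI impI conjI)
  fix n :: nat and F' :: signature assume perm: "permutable_matchgate_signature n F'"
  have pin: "{[0, 1, 0]} \<subseteq> binary_matchgates"
    and par: "{[1, 0, y] | y. True} \<union> {[0, 0, 1]} \<subseteq> binary_matchgates"
    and star: "{[1, 0, y] | y. True} \<union> {[0, 1, 0]} \<subseteq> binary_matchgates"
    using binary_matchgates_flip binary_matchgates_diagonal by blast+
  have any_binary: "realized_up_to_const n F' h binary_matchgates (2 * n)"
    if "realized_up_to_const n F' h B (2 * n)" "B \<subseteq> binary_matchgates" for h B
    by (rule realized_cong[OF that(1), where c = 1]) (use that(2) in auto)
  have parity_matchgate: "length h = Suc n \<and> matchgate_signature n (sym_sig h)" if "h \<in> {even_sig n, odd_sig n}" for h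
    using that matchgate_signature_even matchgate_signature_odd by auto
  show "\<exists>h. length h = Suc n \<and> matchgate_signature n (sym_sig h) \<and>
      realized_up_to_const n F' h binary_matchgates (2 * n)"
  proof (cases "\<exists>\<beta>. length \<beta> = n \<and> F' \<beta> \<noteq> 0")
    case False
    then obtain h where "h \<in> {even_sig n, odd_sig n}" "realized_up_to_const n F' h {[1, 0, 0], [0, 0, 1]} (2 * n)"
      using realized_zero[of n F'] by blast
    then show ?thesis
      using any_binary[of h "{[1, 0, 0], [0, 0, 1]}"] parity_matchgate[of h] binary_matchgates_diagonal by blast
  next
    case True
    then obtain \<beta> where \<beta>: "length \<beta> = n" "F' \<beta> \<noteq> 0" by blast
    then have norm: "normalization n F' (\<lambda>\<alpha>. F' (map2 (\<noteq>) \<alpha> \<beta>) / F' \<beta>)" (is "normalization n F' ?F")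
      unfolding normalization_def by blast
    consider "pinning_type n ?F" | "parity_type n ?F" | "\<not> pinning_type n ?F" "\<not> parity_type n ?F" by blast
    then show ?thesis
    proof cases
      case 1
      then show ?thesis
        using any_binary[OF realization_pinning_type[OF norm perm]] pin matchgate_signature_pin length_sigs(1)
        by blast
    next
      case 2
      then obtain h where "h \<in> {even_sig n, odd_sig n}"
        "realized_up_to_const n F' h ({[1, 0, y] | y. True} \<union> {[0, 0, 1]}) (2 * n)"
        using realization_parity_type[OF norm perm] by blast
      then show ?thesis using any_binary[of h] par parity_matchgate[of h] by blast
    next
      case 3
      then show ?thesis
        using any_binary[OF realization_neither_type[OF norm perm]] star matchgate_signature_one length_sigs(4)
        by blast
    qed
  qed
next
  fix n :: nat and F' F :: signature
  assume perm: "permutable_matchgate_signature n F'" and norm: "normalization n F' F"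
  show "matchgate_signature n (sym_sig (pin_sig n))" by (rule matchgate_signature_pin)
  show "matchgate_signature n (sym_sig (one_sig n))" by (rule matchgate_signature_one)
  have pin: "binary_matchgates \<inter> {[0, 1, 0]} = {[0, 1, 0]}"
    and par: "binary_matchgates \<inter> ({[1, 0, y] | y. True} \<union> {[0, 0, 1]}) = {[1, 0, y] | y. True} \<union> {[0, 0, 1]}"
    and star: "binary_matchgates \<inter> ({[1, 0, y] | y. True} \<union> {[0, 1, 0]}) = {[1, 0, y] | y. True} \<union> {[0, 1, 0]}"
    using binary_matchgates_flip binary_matchgates_diagonal by blast+
  show "realized_up_to_const n F' (pin_sig n) (binary_matchgates \<inter> {[0, 1, 0]}) (2 * n)"
    if "pinning_type n F"
    unfolding pin using that by (rule realization_pinning_type[OF norm perm])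
  show "\<exists>h \<in> {even_sig n, odd_sig n}. matchgate_signature n (sym_sig h) \<and>
      realized_up_to_const n F' h (binary_matchgates \<inter> ({[1, 0, y] | y. True} \<union> {[0, 0, 1]})) (2 * n)"
    if "parity_type n F"
    unfolding par using realization_parity_type[OF norm perm that]
      matchgate_signature_even matchgate_signature_odd by blast
  show "realized_up_to_const n F' (one_sig n)
      (binary_matchgates \<inter> ({[1, 0, y] | y. True} \<union> {[0, 1, 0]})) (2 * n)"
    if "matching_type n F \<and> \<not> pinning_type n F \<and> \<not> parity_type n F"
    unfolding star using that realization_neither_type[OF norm perm] by blast
qed

end
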